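(* Let $n,d\ge1$ be integers, let $w\colon G\to[0,\infty)$ be a measurable function on an open set $G\subset\mathbb{R}^n$, let $\mu$ be a probability measure on $G$ satisfying the weighted Poincaré-type inequality with weight $w$, and let $f\colon G\to\mathbb{R}$ be a $\mathcal{C}^d$-smooth function with $\int_G f\,d\mu=0$ such that $$\lVert f^{(k)}\rVert_{\mathrm{Op},2}\le 1\quad\text{for all }k=1,\ldots,d-1,\qquad\text{and}\qquad\lVert f^{(d)}\rVert_{\mathrm{Op},\infty}\le 1.$$ Assume $\lVert w\rVert_{2^dp}\le C$ for some $p\ge 2$ and some $C\ge 2^{-(d-1)/2}$. Then, for any $0\le t\le\big(2^{\frac{d+5}{2}}C\,\mathrm{e}\,p\big)^d$, $$\mu(|f|\ge t)\le \mathrm{e}^{d/\mathrm{e}}\exp\Big(-\frac{d\,t^{1/d}}{2^{\frac{d+5}{2}}C\,\mathrm{e}}\Big).$$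
   Context: A Borel probability measure $\mu$ on an open set $G\subset\mathbb{R}^n$ satisfies a weighted Poincaré-type inequality with (measurable) weight $w\colon G\to[0,\infty)$ if for every bounded smooth function $g$ on $G$ with gradient $\nabla g$, $\mathrm{Var}_\mu(g)\le\int|\nabla g|^2w^2\,d\mu$, where $\mathrm{Var}_\mu(g)=\int g^2\,d\mu-(\int g\,d\mu)^2$ and $|\cdot|$ is the Euclidean norm. For $q>0$ and a measurable function $g$ on $G$, $\lVert g\rVert_q=\big(\int_G|g|^q\,d\mu\big)^{1/q}\in[0,\infty]$. For $f\in\mathcal{C}^d(G)$ and $1\le k\le d$, $f^{(k)}(x)$ is the (hyper-)matrix with entries $f^{(k)}_{i_1\ldots i_k}(x)=\partial_{i_1\ldots i_k}f(x)$, regarded as a symmetric multilinear $k$-form, and its operator norm is $|f^{(k)}(x)|_{\mathrm{Op}}=\sup\{f^{(k)}(x)[v_1,\ldots,v_k]\colon v_i\in\mathbb{R}^n,\ |v_1|=\cdots=|v_k|=1\}$. For $q\in(0,\infty)$, $\lVert f^{(k)}\rVert_{\mathrm{Op},q}=\big(\int_G|f^{(k)}|_{\mathrm{Op}}^q\,d\mu\big)^{1/q}$, and $\lVert f^{(k)}\rVert_{\mathrm{Op},\infty}$ is the $L^\infty(\mu)$-norm of $|f^{(k)}|_{\mathrm{Op}}$. Here $\mathrm{e}$ is Euler's number. *)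

theory Defs
  imports "HOL-Probability.Probability"
begin

section \<open>Classical partial derivatives and smoothness\<close>

definition partial_deriv :: "'n \<Rightarrow> (real ^ 'n \<Rightarrow> real) \<Rightarrow> real ^ 'n \<Rightarrow> real" where
  "partial_deriv i f x = deriv (\<lambda>s. f (x + s *\<^sub>R axis i 1)) 0"

definition has_partial_at :: "'n \<Rightarrow> (real ^ 'n \<Rightarrow> real) \<Rightarrow> real ^ 'n \<Rightarrow> bool" where
  "has_partial_at i f x \<longleftrightarrow> (\<lambda>s. f (x + s *\<^sub>R axis i 1)) field_differentiable (at 0)"

fun iter_partial :: "'n list \<Rightarrow> (real ^ 'n \<Rightarrow> real) \<Rightarrow> real ^ 'n \<Rightarrow> real" where
  "iter_partial [] f = f"
| "iter_partial (i # js) f = partial_deriv i (iter_partial js f)"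

text \<open>All the notions below are used on an open set \<open>G\<close> only; there they depend only on the
  restriction of the function to \<open>G\<close>.\<close>

definition C_k_on :: "nat \<Rightarrow> (real ^ 'n) set \<Rightarrow> (real ^ 'n \<Rightarrow> real) \<Rightarrow> bool" where
  "C_k_on k G f \<longleftrightarrow>
     (\<forall>js. length js < k \<longrightarrow> (\<forall>i. \<forall>x\<in>G. has_partial_at i (iter_partial js f) x)) \<and>
     (\<forall>js. length js \<le> k \<longrightarrow> continuous_on G (iter_partial js f))"

definition C_infinity_on :: "(real ^ 'n) set \<Rightarrow> (real ^ 'n \<Rightarrow> real) \<Rightarrow> bool" where
  "C_infinity_on G f \<longleftrightarrow> (\<forall>k. C_k_on k G f)"

definition gradient :: "(real ^ 'n \<Rightarrow> real) \<Rightarrow> real ^ 'n \<Rightarrow> real ^ 'n" where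
  "gradient f x = (\<chi> i. partial_deriv i f x)"

section \<open>Derivative tensors and their operator norms\<close>

text \<open>The \<open>k\<close>-form \<open>f\<^sup>(\<^sup>k\<^sup>)(x)[v\<^sub>1, \<dots>, v\<^sub>k]\<close>, where the vector \<open>v j\<close> for \<open>j < k\<close>
  stands for the argument with number \<open>j + 1\<close>.\<close>

definition deriv_form ::
    "nat \<Rightarrow> (real ^ 'n \<Rightarrow> real) \<Rightarrow> real ^ 'n \<Rightarrow> (nat \<Rightarrow> real ^ 'n) \<Rightarrow> real" where
  "deriv_form k f x v =
     (\<Sum>js | length js = k. iter_partial js f x * (\<Prod>j<k. v j $ (js ! j)))"

text \<open>The set under the supremum is nonempty and bounded above (compactness of the unit
  sphere), so the real supremum is the actual one.\<close>

definition op_norm :: "nat \<Rightarrow> (real ^ 'n \<Rightarrow> real) \<Rightarrow> real ^ 'n \<Rightarrow> real" where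
  "op_norm k f x = Sup {deriv_form k f x v | v. \<forall>j<k. norm (v j) = 1}"

section \<open>Norms with respect to a measure\<close>

definition Lq_norm :: "'a measure \<Rightarrow> real \<Rightarrow> ('a \<Rightarrow> real) \<Rightarrow> ennreal" where
  "Lq_norm M q g =
     (let I = (\<integral>\<^sup>+ x. ennreal (\<bar>g x\<bar> powr q) \<partial>M)
      in if I = \<infinity> then \<infinity> else ennreal (enn2real I powr (1 / q)))"

definition Linf_norm :: "'a measure \<Rightarrow> ('a \<Rightarrow> real) \<Rightarrow> ennreal" where
  "Linf_norm M g = esssup M (\<lambda>x. ennreal \<bar>g x\<bar>)"

section \<open>The weighted Poincare-type inequality\<close>

definition borel_prob_on :: "(real ^ 'n) set \<Rightarrow> (real ^ 'n) measure \<Rightarrow> bool" where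
  "borel_prob_on G \<mu> \<longleftrightarrow> prob_space \<mu> \<and> sets \<mu> = sets (restrict_space borel G)"

definition Var :: "'a measure \<Rightarrow> ('a \<Rightarrow> real) \<Rightarrow> real" where
  "Var \<mu> g = (\<integral>x. (g x)\<^sup>2 \<partial>\<mu>) - (\<integral>x. g x \<partial>\<mu>)\<^sup>2"

text \<open>The right-hand side may be infinite, hence the integral with values in \<open>[0, \<infinity>]\<close>.\<close>

definition weighted_poincare ::
    "(real ^ 'n) set \<Rightarrow> (real ^ 'n) measure \<Rightarrow> (real ^ 'n \<Rightarrow> real) \<Rightarrow> bool" where
  "weighted_poincare G \<mu> w \<longleftrightarrow>
     (\<forall>g. C_infinity_on G g \<longrightarrow> bounded (g ` G) \<longrightarrow>
        ennreal (Var \<mu> g) \<le> (\<integral>\<^sup>+ x. ennreal ((norm (gradient g x))\<^sup>2 * (w x)\<^sup>2) \<partial>\<mu>))"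

end

theory Submission
  imports Defs
begin

text \<open>
  For \<open>u\<close> locally Lipschitz with pointwise slope at most \<open>h\<close>, smooth functions \<open>g\<close> with
  \<open>\<bar>g - u\<bar> \<le> \<epsilon>\<close> and \<open>\<bar>\<nabla>g\<bar> \<le> h + \<epsilon>\<close> on all of \<open>G\<close> (mollification glued by a partition of unity)
  extend the Poincare inequality to \<open>Var u \<le> \<integral>h\<^sup>2w\<^sup>2\<close>. Applied to powers of truncations of \<open>\<bar>u\<bar>\<close> it
  gives \<open>\<parallel>u\<parallel>\<^bsub>2m\<^esub>\<^sup>2 \<le> \<parallel>u\<parallel>\<^bsub>m\<^esub>\<^sup>2 + m\<^sup>2\<parallel>hw\<parallel>\<^bsub>2m\<^esub>\<^sup>2\<close>, hence by doubling
  \<open>\<parallel>u\<parallel>\<^bsub>Q\<^esub>\<^sup>2 \<le> \<parallel>u\<parallel>\<^bsub>2\<^esub>\<^sup>2 + (Q\<^sup>2/3)\<parallel>hw\<parallel>\<^bsub>Q\<^esub>\<^sup>2\<close> for every \<open>Q = 2\<^sup>j\<close>. Since the operator norm of \<open>f\<^sup>(\<^sup>k\<^sup>)\<close>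
  has slope at most the operator norm of \<open>f\<^sup>(\<^sup>k\<^sup>+\<^sup>1\<^sup>)\<close>, and \<open>\<parallel>hw\<parallel>\<^bsub>Q\<^esub> \<le> \<parallel>h\<parallel>\<^bsub>2Q\<^esub>\<parallel>w\<parallel>\<^bsub>2Q\<^esub>\<close>, iterating over \<open>k\<close> bounds
  \<open>\<parallel>f\<parallel>\<^bsub>q\<^esub>\<close> by \<open>(2qX)\<^sup>d\<close> with \<open>X = 2\<^bsup>(d-1)/2\<^esup>C \<ge> 1\<close> for all powers of two \<open>2 \<le> q \<le> p\<close>. The loss from the
  restriction to dyadic exponents is absorbed by the constant in Markov's inequality.
\<close>

section \<open>Calculus of \<open>C\<^sup>k\<close> functions\<close>

text \<open>The Poincare inequality is given for bounded smooth functions, but is needed for powers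
  of operator norms, which as suprema are merely locally Lipschitz. The approximation must hold up
  to the boundary of \<open>G\<close>: an additive error \<open>e\<close> in the gradient costs a
  multiple of \<open>e\<close> times the integral of \<open>w\<^sup>2\<close>, finite by the moment
  bound on \<open>w\<close>. Powers of \<open>u\<close> lead from order \<open>m\<close> to
  \<open>2m\<close>, hence dyadic orders, and the steps \<open>m = Q/2, Q/4, ...\<close> add up to
  \<open>Q\<^sup>2/4 + Q\<^sup>2/16 + ... \<le> Q\<^sup>2/3\<close>. Each splitting of
  \<open>hw\<close> doubles the exponent, so order \<open>k\<close> is needed at
  \<open>2\<^sup>k q\<close> and \<open>w\<close> at \<open>2\<^sup>d q\<close>, whence
  \<open>2\<^sup>d p\<close>. The factors \<open>2\<^sup>k\<close> for \<open>k < d\<close> also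
  enter the constants; their product \<open>2^(d(d-1)/2)\<close> is the \<open>d\<close>-th power of
  the factor \<open>2^((d-1)/2)\<close> in \<open>X\<close>. With
  \<open>t = (8 X e q)\<^sup>d\<close>, Markov's inequality at a dyadic \<open>n\<close> in
  \<open>(q/2, q]\<close> gives \<open>(n/(4 e q))^(dn)\<close>, whose base is at most
  \<open>exp(-2)\<close>; this compensates \<open>n\<close> being as small as \<open>q/2\<close>.
  The prefactor \<open>exp(d/e)\<close> makes the bound trivial for
  \<open>q \<le> 1/e\<close>.\<close>

lemma eventually_line_in_open:
  fixes x v :: "'a::real_normed_vector"
  assumes "open V" "x \<in> V"
  shows "eventually (\<lambda>s::real. x + s *\<^sub>R v \<in> V) (nhds 0)"
proof -
  have "((\<lambda>s::real. x + s *\<^sub>R v) \<longlongrightarrow> x + 0 *\<^sub>R v) (nhds 0)"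
    by (intro tendsto_intros filterlim_ident)
  then show ?thesis using assms by (simp add: topological_tendstoD)
qed

lemma partial_deriv_cong:
  assumes "open V" "\<And>y. y \<in> V \<Longrightarrow> f y = g y" "x \<in> V"
  shows "partial_deriv i f x = partial_deriv i g x"
  unfolding partial_deriv_def
  by (rule deriv_cong_ev, rule eventually_mono[OF eventually_line_in_open[OF assms(1,3), of "axis i 1"]])
     (auto simp: assms(2))

lemma has_partial_at_cong:
  assumes "open V" "\<And>y. y \<in> V \<Longrightarrow> f y = g y" "x \<in> V"
  shows "has_partial_at i f x \<longleftrightarrow> has_partial_at i g x"
proof -
  have "eventually (\<lambda>s. f (x + s *\<^sub>R axis i 1) = g (x + s *\<^sub>R axis i 1)) (nhds 0)"
    by (rule eventually_mono[OF eventually_line_in_open[OF assms(1,3), of "axis i 1"]]) (auto simp: assms(2))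
  then show ?thesis
    unfolding has_partial_at_def field_differentiable_def
    by (intro ex_cong1 DERIV_cong_ev) auto
qed

lemma iter_partial_cong:
  assumes "open V" "\<And>y. y \<in> V \<Longrightarrow> f y = g y" "x \<in> V"
  shows "iter_partial js f x = iter_partial js g x"
  using assms(3)
proof (induction js arbitrary: x)
  case (Cons i js)
  then show ?case by (simp add: partial_deriv_cong[OF assms(1) Cons.IH])
qed (simp add: assms)

lemma iter_partial_append: "iter_partial (js @ ks) f = iter_partial js (iter_partial ks f)"
  by (induction js) auto

lemma C_k_on_cong:
  assumes "open V" "\<And>y. y \<in> V \<Longrightarrow> f y = g y"
  shows "C_k_on k V f \<longleftrightarrow> C_k_on k V g"
proof -
  note ip = iter_partial_cong[where V=V and f=f and g=g, OF assms]
  have "continuous_on V (iter_partial js f) = continuous_on V (iter_partial js g)" for js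
    by (rule continuous_on_cong) (auto simp: ip)
  moreover have "has_partial_at i (iter_partial js f) x = has_partial_at i (iter_partial js g) x"
    if "x \<in> V" for i js x
    by (rule has_partial_at_cong[OF assms(1)]) (auto simp: ip that)
  ultimately show ?thesis unfolding C_k_on_def by auto
qed

lemma C_k_on_0: "C_k_on 0 G f \<longleftrightarrow> continuous_on G f"
  by (simp add: C_k_on_def)

text \<open>\<open>iter_partial\<close> exposes the derivative taken last, at the head of the list.
  Splitting off the one taken first, at the tail, gives a recursion on \<open>k\<close> by which the
  closure properties are proved by induction.\<close>

lemma C_k_on_Suc:
  "C_k_on (Suc k) G f \<longleftrightarrow>
     continuous_on G f \<and> (\<forall>i. \<forall>x\<in>G. has_partial_at i f x) \<and> (\<forall>i. C_k_on k G (partial_deriv i f))"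
  (is "?L \<longleftrightarrow> ?R")
proof
  assume L: ?L
  have 1: "iter_partial js (partial_deriv i f) = iter_partial (js @ [i]) f" for js i
    by (simp add: iter_partial_append)
  have "C_k_on k G (partial_deriv i f)" for i
    using L unfolding C_k_on_def 1 by simp
  moreover have "continuous_on G f" "\<And>i x. x \<in> G \<Longrightarrow> has_partial_at i f x"
    using L unfolding C_k_on_def by (metis iter_partial.simps(1) list.size(3) zero_le,
       metis iter_partial.simps(1) list.size(3) zero_less_Suc)
  ultimately show ?R by auto
next
  assume R: ?R
  have "continuous_on G (iter_partial js f)" if "length js \<le> Suc k" for js
  proof (cases js rule: rev_cases)
    case (snoc ks i)
    then show ?thesis using R that by (auto simp: iter_partial_append C_k_on_def)
  qed (use R in simp)
  moreover have "has_partial_at i (iter_partial js f) x" if "length js < Suc k" "x \<in> G" for js i x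
  proof (cases js rule: rev_cases)
    case (snoc ks i)
    then show ?thesis using R that by (auto simp: iter_partial_append C_k_on_def)
  qed (use R that in simp)
  ultimately show ?L by (auto simp: C_k_on_def)
qed

lemma C_k_on_mono: "C_k_on k G f \<Longrightarrow> j \<le> k \<Longrightarrow> C_k_on j G f"
  by (auto simp: C_k_on_def)

lemma C_k_on_imp_continuous_on: "C_k_on k G f \<Longrightarrow> continuous_on G f"
  by (metis C_k_on_0 C_k_on_mono zero_le)

lemma C_k_on_subset: "C_k_on k G f \<Longrightarrow> U \<subseteq> G \<Longrightarrow> C_k_on k U f"
  unfolding C_k_on_def by (meson continuous_on_subset subsetD)

lemma C_k_on_local:
  assumes "\<And>x. x \<in> G \<Longrightarrow> \<exists>V. open V \<and> x \<in> V \<and> C_k_on k V f"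
  shows "C_k_on k G f"
proof -
  have "continuous_on G (iter_partial js f)" if "length js \<le> k" for js
  proof (rule continuous_at_imp_continuous_on, safe)
    fix x assume "x \<in> G"
    with assms obtain V where "open V" "x \<in> V" "C_k_on k V f" by blast
    then show "isCont (iter_partial js f) x"
      using that by (auto simp: C_k_on_def continuous_on_eq_continuous_at)
  qed
  moreover have "has_partial_at i (iter_partial js f) x" if "length js < k" "x \<in> G" for js i x
    using assms[OF that(2)] that(1) by (auto simp: C_k_on_def)
  ultimately show ?thesis by (auto simp: C_k_on_def)
qed

abbreviation has_partial :: "(real ^ 'n \<Rightarrow> real) \<Rightarrow> real \<Rightarrow> 'n \<Rightarrow> real ^ 'n \<Rightarrow> bool" where
  "has_partial f D i x \<equiv> ((\<lambda>s. f (x + s *\<^sub>R axis i 1)) has_real_derivative D) (at 0)"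

lemma has_partial_imp: "has_partial f D i x \<Longrightarrow> partial_deriv i f x = D"
  unfolding partial_deriv_def by (rule DERIV_imp_deriv)

lemma has_partial_at_imp: "has_partial_at i f x \<Longrightarrow> has_partial f (partial_deriv i f x) i x"
  unfolding has_partial_at_def partial_deriv_def by (simp add: field_differentiable_derivI)

lemma C_k_on_SucI:
  assumes "open G" "continuous_on G f" "\<And>i x. x \<in> G \<Longrightarrow> has_partial f (F i x) i x"
    "\<And>i. C_k_on k G (F i)"
  shows "C_k_on (Suc k) G f"
  unfolding C_k_on_Suc
proof (intro conjI allI ballI)
  show "has_partial_at i f x" if "x \<in> G" for i x
    using assms(3)[OF that] unfolding has_partial_at_def field_differentiable_def by blast
  show "C_k_on k G (partial_deriv i f)" for i
    using assms(4)[of i] C_k_on_cong[OF assms(1), of "F i" "partial_deriv i f" k]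
    by (simp add: has_partial_imp[OF assms(3)])
qed fact

lemma C_k_on_SucD:
  assumes "C_k_on (Suc k) G f"
  shows "continuous_on G f" "x \<in> G \<Longrightarrow> has_partial f (partial_deriv i f x) i x"
    "C_k_on k G (partial_deriv i f)"
  using assms has_partial_at_imp unfolding C_k_on_Suc by blast+

section \<open>Closure properties of the class C^k\<close>

lemma C_k_on_const: "open G \<Longrightarrow> C_k_on k G (\<lambda>x. c)"
proof (induction k arbitrary: c)
  case (Suc k)
  show ?case by (rule C_k_on_SucI[where F="\<lambda>_ _. 0"]) (auto intro: Suc)
qed (simp add: C_k_on_0)

lemma C_k_on_coord:
  fixes G :: "(real ^ 'n) set"
  assumes "open G" shows "C_k_on k G (\<lambda>x. x $ j)"
proof (cases k)
  case (Suc k)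
  have "has_partial (\<lambda>x. x $ j) (axis i 1 $ j) i x" for i and x :: "real^'n"
    by (auto intro!: derivative_eq_intros)
  then show ?thesis unfolding Suc
    by (intro C_k_on_SucI[where F="\<lambda>i _. axis i 1 $ j"] assms C_k_on_const continuous_intros)
qed (simp add: C_k_on_0 continuous_intros)

lemma C_k_on_add:
  assumes "open G"
  shows "C_k_on k G f \<Longrightarrow> C_k_on k G g \<Longrightarrow> C_k_on k G (\<lambda>x. f x + g x)"
proof (induction k arbitrary: f g)
  case (Suc k)
  show ?case
    by (rule C_k_on_SucI[OF assms, where F="\<lambda>i x. partial_deriv i f x + partial_deriv i g x"])
       (intro continuous_intros derivative_intros Suc.IH C_k_on_SucD[OF Suc.prems(1)]
          C_k_on_SucD[OF Suc.prems(2)] | assumption)+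
qed (auto simp: C_k_on_0 intro: continuous_intros)

lemma C_k_on_mult:
  assumes "open G"
  shows "C_k_on k G f \<Longrightarrow> C_k_on k G g \<Longrightarrow> C_k_on k G (\<lambda>x. f x * g x)"
proof (induction k arbitrary: f g)
  case (Suc k)
  note f = Suc.prems(1) and g = Suc.prems(2)
  have P: "has_partial (\<lambda>x. f x * g x) (partial_deriv i f x * g x + partial_deriv i g x * f x) i x"
    if "x \<in> G" for i x
    using DERIV_mult[OF C_k_on_SucD(2)[OF f that] C_k_on_SucD(2)[OF g that], of i i] by simp
  show ?case
    by (rule C_k_on_SucI[OF assms _ P])
       (intro continuous_intros C_k_on_add[OF assms] Suc.IH C_k_on_SucD[OF f]
          C_k_on_SucD[OF g] C_k_on_mono[OF f] C_k_on_mono[OF g] | simp)+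
qed (auto simp: C_k_on_0 intro: continuous_intros)

lemma C_k_on_sum:
  assumes "open G" "\<And>a. a \<in> A \<Longrightarrow> C_k_on k G (f a)"
  shows "C_k_on k G (\<lambda>x. \<Sum>a\<in>A. f a x)"
  using assms(2) by (induction A rule: infinite_finite_induct)
    (auto intro: C_k_on_const C_k_on_add assms(1))

lemma C_k_on_diff:
  assumes "open G" "C_k_on k G f" "C_k_on k G g"
  shows "C_k_on k G (\<lambda>x. f x - g x)"
  using C_k_on_add[OF assms(1,2) C_k_on_mult[OF assms(1) C_k_on_const[OF assms(1), of k "-1"] assms(3)]]
  by simp

text \<open>The outer function comes with all its derivatives as a sequence \<open>H\<close>, so the
  chain rule turns \<open>H n\<close> into \<open>H (Suc n)\<close> and an induction on
  \<open>k\<close> for all \<open>n\<close> at once closes.\<close>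

lemma C_k_on_compose:
  assumes "open G" "open T" "\<And>n t. t \<in> T \<Longrightarrow> (H n has_real_derivative H (Suc n) t) (at t)"
    and "\<And>x. x \<in> G \<Longrightarrow> f x \<in> T"
    and "C_k_on k G f"
  shows "C_k_on k G (\<lambda>x. H n (f x))"
proof -
  have cont: "continuous_on T (H n)" for n
    using assms(3) by (meson DERIV_isCont continuous_at_imp_continuous_on)
  have cH: "continuous_on G (\<lambda>x. H n (f x))" if "continuous_on G f" for n
    by (rule continuous_on_compose2[OF cont that]) (use assms(4) in auto)
  show ?thesis using assms(5)
  proof (induction k arbitrary: n)
    case 0
    then show ?case using cH by (simp add: C_k_on_0)
  next
    case (Suc k)
    note f = Suc.prems
    have P: "has_partial (\<lambda>x. H n (f x)) (H (Suc n) (f x) * partial_deriv i f x) i x"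
      if "x \<in> G" for i x
    proof (rule DERIV_chain2[where f="H n" and g="\<lambda>s. f (x + s *\<^sub>R axis i 1)"])
      show "(H n has_real_derivative H (Suc n) (f x)) (at (f (x + 0 *\<^sub>R axis i 1)))"
        using assms(3)[OF assms(4)[OF that]] by simp
    qed (rule C_k_on_SucD(2)[OF f that])
    show ?case
      by (rule C_k_on_SucI[OF assms(1) _ P])
         (intro cH C_k_on_mult[OF assms(1)] Suc.IH C_k_on_SucD[OF f] C_k_on_mono[OF f] | simp)+
  qed
qed

lemma C_k_on_inverse:
  assumes "open G" "\<And>x. x \<in> G \<Longrightarrow> f x > 0" "C_k_on k G f"
  shows "C_k_on k G (\<lambda>x. inverse (f x))"
proof -
  \<comment> \<open>The \<open>n\<close>-th derivative of the reciprocal.\<close>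
  define H :: "nat \<Rightarrow> real \<Rightarrow> real" where "H n t = (-1) ^ n * fact n * inverse t ^ Suc n" for n t
  have "(H n has_real_derivative H (Suc n) t) (at t)" if "t \<in> {0<..}" for n t
  proof -
    have "(inverse has_real_derivative - (inverse t ^ 2)) (at t)"
      using DERIV_inverse[of t] that by (simp add: numeral_2_eq_2)
    from DERIV_cmult[OF DERIV_power[OF this, of "Suc n"], of "(-1) ^ n * fact n"]
    show ?thesis unfolding H_def by (simp add: power2_eq_square algebra_simps)
  qed
  from C_k_on_compose[of G "{0<..}" H, OF assms(1) open_greaterThan this _ assms(3), of 0] assms(2)
  show ?thesis by (simp add: H_def)
qed

lemma has_partial_line:
  assumes "has_partial f D i (a + s *\<^sub>R axis i 1)"
  shows "((\<lambda>t. f (a + t *\<^sub>R axis i 1)) has_real_derivative D) (at s)"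
proof -
  have "((\<lambda>t. f (a + (t + s) *\<^sub>R axis i 1)) has_real_derivative D) (at 0)"
    using assms by (simp add: scaleR_add_left algebra_simps)
  then show ?thesis using DERIV_shift[of "\<lambda>t. f (a + t *\<^sub>R axis i 1)" D 0 s] by simp
qed

text \<open>Continuous partial derivatives suffice: the increment from \<open>x\<close> to
  \<open>x + v\<close> is split into moves along one axis at a time, and the mean value inequality
  bounds the error of each move by the oscillation of one partial derivative near
  \<open>x\<close>.\<close>

lemma C_1_has_derivative:
  fixes f :: "real ^ 'n \<Rightarrow> real"
  assumes "open G" "C_k_on (Suc 0) G f" "x \<in> G"
  shows "(f has_derivative (\<lambda>v. gradient f x \<bullet> v)) (at x)"
  unfolding has_derivative_at_alt
proof (intro conjI allI impI)
  show "bounded_linear (\<lambda>v. gradient f x \<bullet> v)" by (rule bounded_linear_inner_right)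
  fix e :: real assume "e > 0"
  let ?n = "real CARD('n)"
  define e' where "e' = e / ?n"
  have e': "e' > 0" using \<open>e > 0\<close> by (simp add: e'_def)
  have "eventually (\<lambda>y. \<forall>i\<in>UNIV. dist (partial_deriv i f y) (partial_deriv i f x) < e') (nhds x)"
  proof (rule eventually_ball_finite, simp, safe)
    fix i
    have "continuous_on G (partial_deriv i f)"
      using C_k_on_SucD(3)[OF assms(2)] by (simp add: C_k_on_0)
    then have "isCont (partial_deriv i f) x" using assms by (simp add: continuous_on_eq_continuous_at)
    then show "eventually (\<lambda>y. dist (partial_deriv i f y) (partial_deriv i f x) < e') (nhds x)"
      using e' by (simp add: continuous_at tendstoD tendsto_at_iff_tendsto_nhds)
  qed
  then have "eventually (\<lambda>y. y \<in> G \<and> (\<forall>i. \<bar>partial_deriv i f y - partial_deriv i f x\<bar> < e')) (nhds x)"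
    using eventually_nhds_in_open[OF assms(1,3)] by (simp add: eventually_conj_iff dist_real_def)
  then obtain r where r: "r > 0" "\<And>y. dist y x < r \<Longrightarrow> y \<in> G"
     "\<And>y i. dist y x < r \<Longrightarrow> \<bar>partial_deriv i f y - partial_deriv i f x\<bar> < e'"
    unfolding eventually_nhds_metric by blast
  \<comment> \<open>\<open>P S v\<close> keeps the coordinates of \<open>v\<close> in
    \<open>S\<close> and erases the others; enlarging \<open>S\<close> one element at a time walks
    from \<open>0\<close> to \<open>v\<close>.\<close>
  define P where "P S v = (\<chi> i. if i \<in> S then v $ i else 0)" for S and v :: "real^'n"
  have key: "\<bar>f (x + P S v) - f x - (\<Sum>i\<in>S. v $ i * partial_deriv i f x)\<bar> \<le> real (card S) * (e' * norm v)"
    if v: "norm v < r" for v S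
  proof (induction S rule: finite_induct[OF finite])
    case 1
    have "P {} v = 0" by (simp add: P_def vec_eq_iff)
    then show ?case by simp
  next
    case (2 j S)
    define a where "a = x + P S v"
    define g where "g s = f (a + s *\<^sub>R axis j 1) - s * partial_deriv j f x" for s
    \<comment> \<open>No coordinate of the displacement exceeds that of \<open>v\<close>, so the
      walk stays in the ball.\<close>
    have mem: "dist (a + s *\<^sub>R axis j 1) x < r" if "\<bar>s\<bar> \<le> \<bar>v $ j\<bar>" for s
    proof -
      have "norm (P S v + s *\<^sub>R axis j 1) \<le> norm v"
        by (rule norm_le_componentwise_cart) (use that 2 in \<open>auto simp: P_def axis_def\<close>)
      then show ?thesis using v by (simp add: a_def dist_norm)
    qed
    define I where "I = {- \<bar>v $ j\<bar>..\<bar>v $ j\<bar>}"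
    have "norm (g (v $ j) - g 0) \<le> e' * norm (v $ j - 0)"
    proof (rule field_differentiable_bound[where S=I])
      fix s assume "s \<in> I"
      then have s: "dist (a + s *\<^sub>R axis j 1) x < r" by (intro mem) (auto simp: I_def)
      have "((\<lambda>t. f (a + t *\<^sub>R axis j 1)) has_real_derivative partial_deriv j f (a + s *\<^sub>R axis j 1)) (at s)"
        by (rule has_partial_line, rule C_k_on_SucD(2)[OF assms(2)], rule r(2)[OF s])
      then have "(g has_real_derivative partial_deriv j f (a + s *\<^sub>R axis j 1) - partial_deriv j f x) (at s)"
        unfolding g_def by (auto intro!: derivative_eq_intros)
      then show "(g has_real_derivative partial_deriv j f (a + s *\<^sub>R axis j 1) - partial_deriv j f x) (at s within I)"
        by (rule has_field_derivative_at_within)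
      show "norm (partial_deriv j f (a + s *\<^sub>R axis j 1) - partial_deriv j f x) \<le> e'"
        using r(3)[OF s, of j] by simp
    qed (auto simp: I_def)
    also have "\<dots> \<le> e' * norm v"
      using e' component_le_norm_cart[of v j] by simp
    finally have 3: "\<bar>g (v $ j) - g 0\<bar> \<le> e' * norm v" by simp
    have "P (insert j S) v = P S v + v $ j *\<^sub>R axis j 1"
      using 2 by (auto simp: P_def vec_eq_iff axis_def)
    then have "f (x + P (insert j S) v) - f x - (\<Sum>i\<in>insert j S. v $ i * partial_deriv i f x)
      = (f (x + P S v) - f x - (\<Sum>i\<in>S. v $ i * partial_deriv i f x)) + (g (v $ j) - g 0)"
      using 2 by (simp add: g_def a_def algebra_simps)
    then show ?case using 3 2 by (simp add: algebra_simps)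
  qed
  show "\<exists>d>0. \<forall>y. norm (y - x) < d \<longrightarrow> norm (f y - f x - gradient f x \<bullet> (y - x)) \<le> e * norm (y - x)"
  proof (intro exI conjI allI impI)
    fix y assume y: "norm (y - x) < r"
    have "P UNIV (y - x) = y - x" by (simp add: P_def vec_eq_iff)
    then have "\<bar>f y - f x - (\<Sum>i\<in>UNIV. (y - x) $ i * partial_deriv i f x)\<bar> \<le> ?n * (e' * norm (y - x))"
      using key[OF y, of UNIV] by simp
    then show "norm (f y - f x - gradient f x \<bullet> (y - x)) \<le> e * norm (y - x)"
      by (simp add: inner_vec_def gradient_def e'_def mult.commute)
  qed (rule r(1))
qed

section \<open>Smooth cutoff functions\<close>

text \<open>This class of functions is closed under differentiation, which gives smoothness at 0.\<close>

definition flat :: "real poly \<Rightarrow> real \<Rightarrow> real" where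
  "flat p t = (if t > 0 then poly p (inverse t) * exp (- inverse t) else 0)"

lemma tendsto_poly_times_exp_minus: "((\<lambda>s. poly p s * exp (- s)) \<longlongrightarrow> 0) (at_top :: real filter)"
proof -
  have "((\<lambda>s. \<Sum>i\<le>degree p. coeff p i * (s ^ i / exp s)) \<longlongrightarrow> (\<Sum>i\<le>degree p. coeff p i * 0)) at_top"
    by (intro tendsto_sum tendsto_mult tendsto_const tendsto_power_div_exp_0)
  moreover have "(\<Sum>i\<le>degree p. coeff p i * (s ^ i / exp s)) = poly p s * exp (- s)" for s
    by (simp add: poly_altdef sum_distrib_right exp_minus divide_inverse mult.assoc)
  ultimately show ?thesis by simp
qed

lemma flat_tendsto_0: "(flat p \<longlongrightarrow> 0) (at_right 0)"
proof -
  have "((\<lambda>t. poly p (inverse t) * exp (- inverse t)) \<longlongrightarrow> 0) (at_right (0::real))"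
    by (rule filterlim_compose[OF tendsto_poly_times_exp_minus filterlim_inverse_at_top_right])
  then show ?thesis
    by (rule Lim_transform_eventually)
       (auto simp: flat_def eventually_at_filter)
qed

text \<open>With \<open>s = 1/t\<close> one has \<open>d/dt = - s\<^sup>2 d/ds\<close>, and
  \<open>d/ds\<close> sends \<open>p e^(-s)\<close> to \<open>(p' - p) e^(-s)\<close>; hence the new
  polynomial \<open>s\<^sup>2 (p - p')\<close>.\<close>

lemma DERIV_flat:
  "(flat p has_real_derivative flat ([:0, 0, 1:] * (p - pderiv p)) t) (at t)"
proof -
  consider "t > 0" | "t < 0" | "t = 0" by linarith
  then show ?thesis
  proof cases
    case 1
    have "((\<lambda>t. poly p (inverse t) * exp (- inverse t)) has_real_derivative
        poly (pderiv p) (inverse t) * (- (inverse t)\<^sup>2) * exp (- inverse t)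
        + (exp (- inverse t) * (- (- (inverse t)\<^sup>2))) * poly p (inverse t)) (at t)"
      using 1 by (intro DERIV_mult DERIV_chain2[OF poly_DERIV] DERIV_chain2[OF DERIV_exp] DERIV_minus)
        (auto intro!: derivative_eq_intros simp: power2_eq_square)
    then have "((\<lambda>t. poly p (inverse t) * exp (- inverse t)) has_real_derivative
        flat ([:0, 0, 1:] * (p - pderiv p)) t) (at t)"
      using 1 by (simp add: flat_def algebra_simps power2_eq_square)
    then show ?thesis
      by (rule DERIV_cong_ev[OF refl _ refl, THEN iffD1, rotated])
         (use 1 eventually_nhds_in_open[of "{0<..}" t] in \<open>auto simp: flat_def elim: eventually_mono\<close>)
  next
    case 2
    have "((\<lambda>t. 0) has_real_derivative 0) (at t)" by simp
    then have "(flat p has_real_derivative 0) (at t)"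
      by (rule DERIV_cong_ev[OF refl _ refl, THEN iffD1, rotated])
         (use 2 eventually_nhds_in_open[of "{..<0}" t] in \<open>auto simp: flat_def elim: eventually_mono\<close>)
    then show ?thesis using 2 by (simp add: flat_def)
  next
    case 3
    \<comment> \<open>To the right of 0, division by \<open>h\<close> multiplies the polynomial by
      its variable, so the quotient is \<open>flat (pCons 0 p)\<close> and again tends to 0.\<close>
    have "((\<lambda>h. flat p h / h) \<longlongrightarrow> 0) (at_right 0)"
      by (rule Lim_transform_eventually[OF flat_tendsto_0[of "pCons 0 p"]])
         (auto simp: flat_def eventually_at_filter divide_inverse)
    moreover have "((\<lambda>h. flat p h / h) \<longlongrightarrow> 0) (at_left 0)"
      by (rule Lim_transform_eventually[OF tendsto_const])
         (auto simp: flat_def eventually_at_filter)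
    ultimately have "((\<lambda>h. flat p h / h) \<longlongrightarrow> 0) (at 0)"
      by (simp add: filterlim_split_at)
    then show ?thesis using 3 by (simp add: DERIV_def flat_def)
  qed
qed

abbreviation bump :: "real \<Rightarrow> real" where "bump \<equiv> flat 1"

lemma bump_nonneg: "bump t \<ge> 0" and bump_pos_iff: "bump t > 0 \<longleftrightarrow> t > 0"
  and bump_eq_0: "t \<le> 0 \<Longrightarrow> bump t = 0"
  by (auto simp: flat_def)

lemma C_k_on_bump:
  assumes "open G" "C_k_on k G f"
  shows "C_k_on k G (\<lambda>x. bump (f x))"
proof -
  define P where "P = rec_nat (1 :: real poly) (\<lambda>_ p. [:0, 0, 1:] * (p - pderiv p))"
  have "(flat (P n) has_real_derivative flat (P (Suc n)) t) (at t)" for n t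
    unfolding P_def using DERIV_flat by simp
  from C_k_on_compose[of G UNIV "\<lambda>n. flat (P n)" f k 0, OF assms(1) open_UNIV this _ assms(2)]
  show ?thesis by (simp add: P_def)
qed

text \<open>The squared norm is a polynomial in the coordinates, so no singularity arises at the
  centre.\<close>

definition radial_bump :: "real \<Rightarrow> real ^ 'n \<Rightarrow> real" where
  "radial_bump r x = bump (r\<^sup>2 - (norm x)\<^sup>2)"

lemma radial_bump_nonneg: "radial_bump r x \<ge> 0"
  and radial_bump_eq_0: "norm x \<ge> r \<Longrightarrow> r \<ge> 0 \<Longrightarrow> radial_bump r x = 0"
  and radial_bump_pos: "norm x < r \<Longrightarrow> radial_bump r x > 0"
  and radial_bump_minus: "radial_bump r (- x) = radial_bump r x"
  by (auto simp: radial_bump_def bump_nonneg bump_pos_iff intro!: bump_eq_0 power_mono power_strict_mono)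

lemma C_k_on_radial_bump: "C_k_on k UNIV (\<lambda>x. radial_bump r (x - a))"
proof -
  have "(norm (x - a))\<^sup>2 = (\<Sum>i\<in>UNIV. (x $ i - a $ i) * (x $ i - a $ i))" for x
    by (simp add: power2_norm_eq_inner inner_vec_def)
  then show ?thesis unfolding radial_bump_def
    by (simp only:) (intro C_k_on_bump C_k_on_diff C_k_on_sum C_k_on_mult C_k_on_const C_k_on_coord open_UNIV)
qed

text \<open>The ranges \<open>s > 1/3\<close> and \<open>s < 2/3\<close> where the two bumps are
  positive overlap and cover the line, so the denominator never vanishes.\<close>

definition smooth_step :: "real \<Rightarrow> real" where
  "smooth_step s = bump (s - 1/3) * inverse (bump (s - 1/3) + bump (2/3 - s))"

lemma bump_sum_pos: "bump (s - 1/3) + bump (2/3 - s) > 0"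
  using bump_nonneg[of "s - 1/3"] bump_nonneg[of "2/3 - s"] bump_pos_iff[of "s - 1/3"]
    bump_pos_iff[of "2/3 - s"] by (cases "s > 1/3") linarith+

lemma smooth_step_bounds: "0 \<le> smooth_step s" "smooth_step s \<le> 1"
  using bump_nonneg[of "s - 1/3"] bump_nonneg[of "2/3 - s"] bump_sum_pos[of s]
  by (auto simp: smooth_step_def field_simps)

lemma smooth_step_0: "s \<le> 1/3 \<Longrightarrow> smooth_step s = 0"
  by (simp add: smooth_step_def bump_eq_0)

lemma smooth_step_1: "s \<ge> 2/3 \<Longrightarrow> smooth_step s = 1"
  using bump_sum_pos[of s] by (simp add: smooth_step_def bump_eq_0[of "2/3 - s"])

lemma C_k_on_smooth_step:
  assumes "open G" "C_k_on k G f"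
  shows "C_k_on k G (\<lambda>x. smooth_step (f x))"
  unfolding smooth_step_def
  by (intro C_k_on_mult C_k_on_inverse C_k_on_add C_k_on_bump C_k_on_diff C_k_on_const assms bump_sum_pos)

text \<open>At every point of \<open>K\<close> one of finitely many bumps, each normalised to 1 at
  its centre, exceeds 2/3. Their sum is not constant on \<open>K\<close>, but
  \<open>smooth_step\<close> is saturated from 2/3 on.\<close>

lemma smooth_cutoff:
  fixes K U :: "(real ^ 'n) set"
  assumes "compact K" "open U" "K \<subseteq> U"
  obtains \<psi> where "C_infinity_on UNIV \<psi>" "\<And>x. 0 \<le> \<psi> x" "\<And>x. \<psi> x \<le> 1"
    "\<And>x. x \<in> K \<Longrightarrow> \<psi> x = 1" "\<And>x. x \<notin> U \<Longrightarrow> \<psi> x = 0"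
proof -
  have "\<exists>r>0. ball x r \<subseteq> U" if "x \<in> K" for x
    using assms that by (meson openE subsetD)
  then obtain r where r: "\<And>x. x \<in> K \<Longrightarrow> r x > 0 \<and> ball x (r x) \<subseteq> U" by metis
  define c where "c a x = radial_bump (r a) (x - a) * inverse (radial_bump (r a) (0 :: real ^ 'n))" for a x :: "real^'n"
  have C: "C_k_on k UNIV (c a)" for k a
    unfolding c_def by (intro C_k_on_mult C_k_on_radial_bump C_k_on_const open_UNIV)
  have pos: "c a x \<ge> 0" for a x by (simp add: c_def radial_bump_nonneg)
  have "\<exists>D\<subseteq>K. finite D \<and> K \<subseteq> (\<Union>a\<in>D. {x. c a x > 2/3})"
  proof (rule compactE_image[OF assms(1), of K "\<lambda>a. {x. c a x > 2/3}"])
    show "open {x. c a x > 2/3}" for a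
      by (intro open_Collect_less continuous_on_const C_k_on_imp_continuous_on[OF C])
    have "c a a = 1" if "a \<in> K" for a
    proof -
      have "radial_bump (r a) (0 :: real ^ 'n) > 0" using r[OF that] by (intro radial_bump_pos) simp
      then have "radial_bump (r a) (0 :: real ^ 'n) \<noteq> 0" by simp
      then show ?thesis by (simp add: c_def)
    qed
    then show "K \<subseteq> (\<Union>a\<in>K. {x. c a x > 2/3})" by force
  qed blast
  then obtain D where D: "D \<subseteq> K" "finite D" "K \<subseteq> (\<Union>a\<in>D. {x. c a x > 2/3})" by blast
  define \<psi> where "\<psi> x = smooth_step (\<Sum>a\<in>D. c a x)" for x
  show ?thesis
  proof
    show "C_infinity_on UNIV \<psi>"
      unfolding C_infinity_on_def \<psi>_def by (intro allI C_k_on_smooth_step C_k_on_sum C open_UNIV)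
    show "0 \<le> \<psi> x" "\<psi> x \<le> 1" for x by (auto simp: \<psi>_def smooth_step_bounds)
    show "\<psi> x = 1" if "x \<in> K" for x
    proof -
      from that D obtain a where a: "a \<in> D" "c a x > 2/3" by auto
      have "c a x \<le> (\<Sum>a\<in>D. c a x)" by (rule member_le_sum) (use a D pos in auto)
      with a show ?thesis by (simp add: \<psi>_def smooth_step_1)
    qed
    show "\<psi> x = 0" if "x \<notin> U" for x
    proof -
      have "c a x = 0" if "a \<in> D" for a
      proof -
        have "x \<notin> ball a (r a)" "r a > 0" using r[of a] that D(1) \<open>x \<notin> U\<close> by blast+
        then show ?thesis by (simp add: c_def dist_norm norm_minus_commute radial_bump_eq_0)
      qed
      then show ?thesis by (simp add: \<psi>_def smooth_step_0)
    qed
  qed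
qed

section \<open>Mollification on compact sets\<close>

text \<open>A convolution restricted to a box: for continuous \<open>v\<close> and kernel the
  integrand is continuous on a compact set, so continuity and differentiation under the integral
  sign apply directly.\<close>

definition mollify :: "real ^ 'n \<Rightarrow> real ^ 'n \<Rightarrow> (real ^ 'n \<Rightarrow> real) \<Rightarrow> (real ^ 'n \<Rightarrow> real) \<Rightarrow> real ^ 'n \<Rightarrow> real" where
  "mollify a b \<kappa> v x = integral (cbox a b) (\<lambda>y. v y * \<kappa> (x - y))"

text \<open>Every derivative falls on the kernel, so continuity of \<open>v\<close> suffices and the
  induction runs over all kernels.\<close>

lemma C_k_on_mollify:
  assumes v: "continuous_on (cbox a b) v"
  shows "C_k_on k UNIV \<kappa> \<Longrightarrow> C_k_on k UNIV (mollify a b \<kappa> v)"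
proof (induction k arbitrary: \<kappa>)
  have cont: "continuous_on UNIV (mollify a b \<kappa> v)" if "continuous_on UNIV \<kappa>" for \<kappa>
    unfolding mollify_def
  proof (rule integral_continuous_on_param)
    have "continuous_on (UNIV \<times> cbox a b) (\<lambda>z. v (snd z) * \<kappa> (fst z - snd z))"
      by (intro continuous_intros continuous_on_compose2[OF v] continuous_on_compose2[OF that]) auto
    then show "continuous_on (UNIV \<times> cbox a b) (\<lambda>(x, y). v y * \<kappa> (x - y))"
      by (simp add: case_prod_beta)
  qed
  {
    case 0
    then show ?case using cont by (simp add: C_k_on_0)
  next
    case (Suc k)
    note \<kappa> = C_k_on_SucD[OF Suc.prems]
    show ?case
    proof (rule C_k_on_SucI[where F="\<lambda>i. mollify a b (partial_deriv i \<kappa>) v"])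
      show "C_k_on k UNIV (mollify a b (partial_deriv i \<kappa>) v)" for i
        by (intro Suc.IH \<kappa>)
      show "continuous_on UNIV (mollify a b \<kappa> v)" by (intro cont \<kappa>)
      fix i :: 'a and x :: "real ^ 'a"
      have c1: "continuous_on UNIV (partial_deriv i \<kappa>)"
        by (rule C_k_on_imp_continuous_on[OF \<kappa>(3)])
      have "((\<lambda>s. integral (cbox a b) (\<lambda>y. v y * \<kappa> (x + s *\<^sub>R axis i 1 - y))) has_real_derivative
          integral (cbox a b) (\<lambda>y. v y * partial_deriv i \<kappa> (x + 0 *\<^sub>R axis i 1 - y))) (at 0 within UNIV)"
      proof (rule leibniz_rule_field_derivative[where U=UNIV])
        fix s :: real and y
        have "has_partial \<kappa> (partial_deriv i \<kappa> (x - y + s *\<^sub>R axis i 1)) i (x - y + s *\<^sub>R axis i 1)"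
          by (rule \<kappa>(2)) simp
        from DERIV_cmult[OF has_partial_line[OF this], of "v y"]
        show "((\<lambda>s. v y * \<kappa> (x + s *\<^sub>R axis i 1 - y)) has_real_derivative
            v y * partial_deriv i \<kappa> (x + s *\<^sub>R axis i 1 - y)) (at s within UNIV)"
          by (simp add: algebra_simps)
        show "(\<lambda>y. v y * \<kappa> (x + s *\<^sub>R axis i 1 - y)) integrable_on cbox a b"
          by (intro integrable_continuous continuous_intros v continuous_on_compose2[OF \<kappa>(1)]) auto
      next
        have "continuous_on (UNIV \<times> cbox a b)
            (\<lambda>z. v (snd z) * partial_deriv i \<kappa> (x + fst z *\<^sub>R axis i 1 - snd z))"
          by (intro continuous_intros continuous_on_compose2[OF v] continuous_on_compose2[OF c1]) auto
        then show "continuous_on (UNIV \<times> cbox a b)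
            (\<lambda>(s, y). v y * partial_deriv i \<kappa> (x + s *\<^sub>R axis i 1 - y))"
          by (simp add: case_prod_beta)
      qed auto
      then show "has_partial (mollify a b \<kappa> v) (mollify a b (partial_deriv i \<kappa>) v x) i x"
        by (simp add: mollify_def)
    qed simp
  }
qed

text \<open>Smoothness needs the variable in the kernel; estimates need it in \<open>v\<close>, so
  that values at different points are averages with the same weights. The change of variables is
  exact once the box contains the ball around \<open>x\<close> that carries the kernel.\<close>

lemma mollify_eq_shifted_integral:
  fixes a b c x :: "real ^ 'n"
  assumes supp: "\<And>z. norm z \<ge> r \<Longrightarrow> \<kappa> z = 0" and even: "\<And>z. \<kappa> (- z) = \<kappa> z"
    and c: "cball 0 r \<subseteq> cbox (- c) c" and sub: "cball x r \<subseteq> cbox a b"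
    and cont: "continuous_on UNIV \<kappa>" "continuous_on UNIV v"
  shows "mollify a b \<kappa> v x = integral (cbox (- c) c) (\<lambda>z. v (x + z) * \<kappa> z)"
proof -
  define F where "F y = v y * \<kappa> (x - y)" for y
  have *: "integral S F = integral UNIV F" if "cball x r \<subseteq> S" for S
  proof -
    have "(\<lambda>y. if y \<in> S then F y else 0) = F"
    proof
      fix y
      have "F y = 0" if "y \<notin> S"
      proof -
        have "norm (x - y) \<ge> r" using that \<open>cball x r \<subseteq> S\<close> by (auto simp: dist_norm subset_eq not_le)
        then show ?thesis by (simp add: F_def supp)
      qed
      then show "(if y \<in> S then F y else 0) = F y" by auto
    qed
    then show ?thesis using integral_restrict_UNIV[of S F] by simp
  qed
  have sub2: "cball x r \<subseteq> cbox (x - c) (x + c)"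
  proof
    fix y assume "y \<in> cball x r"
    then have "y - x \<in> cball 0 r" by (simp add: dist_norm norm_minus_commute)
    with c have "y - x \<in> cbox (- c) c" by blast
    then show "y \<in> cbox (x - c) (x + c)" by (auto simp: mem_box_cart algebra_simps)
  qed
  have "continuous_on UNIV F" unfolding F_def
    by (intro continuous_intros cont continuous_on_compose2[OF cont(1)]) auto
  have "mollify a b \<kappa> v x = integral (cbox a b) F"
    by (simp add: mollify_def F_def[abs_def])
  also have "\<dots> = integral (cbox (x - c) (x + c)) F"
    using *[OF sub] *[OF sub2] by simp
  also have "\<dots> = integral (cbox (- c) c) (\<lambda>z. F (z + x))"
    using integral_shift_cbox_plus[of "- c" c F x] by (simp add: o_def algebra_simps)
  also have "\<dots> = integral (cbox (- c) c) (\<lambda>z. v (x + z) * \<kappa> z)"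
    by (simp add: F_def even add.commute)
  finally show ?thesis .
qed

lemma mollifier_exists:
  assumes "r > 0"
  obtains \<kappa> :: "real ^ 'n \<Rightarrow> real" and c where "\<And>k. C_k_on k UNIV \<kappa>" "\<And>z. \<kappa> z \<ge> 0"
    "\<And>z. norm z \<ge> r \<Longrightarrow> \<kappa> z = 0" "\<And>z. \<kappa> (- z) = \<kappa> z"
    "cball 0 r \<subseteq> cbox (- c) c" "integral (cbox (- c) c) \<kappa> = 1"
proof -
  define \<rho> :: "real ^ 'n \<Rightarrow> real" where "\<rho> = radial_bump r"
  have C: "C_k_on k UNIV \<rho>" for k
    using C_k_on_radial_bump[of k r 0] by (simp add: \<rho>_def)
  obtain c :: "real ^ 'n" where c: "cball 0 r \<subseteq> cbox (- c) c"
    using bounded_subset_cbox_symmetric[OF bounded_cball] by blast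
  define I where "I = integral (cbox (- c) c) \<rho>"
  have cont: "continuous_on S \<rho>" for S
    by (rule continuous_on_subset[OF C_k_on_imp_continuous_on[OF C]]) simp
  have int: "\<rho> integrable_on cbox (- c) c"
    by (intro integrable_continuous cont)
  have z: "(0 :: real ^ 'n) \<in> box (- c) c"
  proof -
    have "interior (cball (0 :: real ^ 'n) r) \<subseteq> interior (cbox (- c) c)" by (rule interior_mono[OF c])
    moreover have "0 \<in> interior (cball (0 :: real ^ 'n) r)" using assms by simp
    ultimately show ?thesis by (auto simp: interior_cbox)
  qed
  \<comment> \<open>A continuous nonnegative function with integral 0 over a box vanishes there, but
    the bump is positive at its centre.\<close>
  have "I \<noteq> 0"
  proof
    assume "I = 0"
    then have "(\<rho> has_integral 0) (cbox (- c) c)"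
      using int by (metis I_def has_integral_integral)
    then have "\<rho> 0 = 0"
      using z box_subset_cbox[of "- c" c]
      by (intro has_integral_0_cbox_imp_0[of "- c" c \<rho>] cont)
         (auto simp: \<rho>_def radial_bump_nonneg)
    then show False using radial_bump_pos[of "0 :: real ^ 'n" r] assms by (simp add: \<rho>_def)
  qed
  moreover have "I \<ge> 0"
    unfolding I_def by (rule integral_nonneg[OF int]) (simp add: \<rho>_def radial_bump_nonneg)
  ultimately have I: "I > 0" by simp
  show ?thesis
  proof (rule that[of "\<lambda>z. inverse I * \<rho> z" c])
    show "C_k_on k UNIV (\<lambda>z. inverse I * \<rho> z)" for k
      by (intro C_k_on_mult C_k_on_const C open_UNIV)
    show "integral (cbox (- c) c) (\<lambda>z. inverse I * \<rho> z) = 1"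
      using I by (simp add: I_def)
  qed (use I c assms in \<open>auto simp: \<rho>_def radial_bump_nonneg radial_bump_eq_0 radial_bump_minus\<close>)
qed

text \<open>\<open>h\<close> bounds the local Lipschitz constant of \<open>u\<close> pointwise.\<close>

definition slope_le :: "(real ^ 'n) set \<Rightarrow> (real ^ 'n \<Rightarrow> real) \<Rightarrow> (real ^ 'n \<Rightarrow> real) \<Rightarrow> bool" where
  "slope_le G u h \<longleftrightarrow> (\<forall>x\<in>G. \<forall>e>0. \<exists>r>0. \<forall>y\<in>ball x r. \<forall>z\<in>ball x r.
     \<bar>u y - u z\<bar> \<le> (h x + e) * dist y z)"

text \<open>\<open>slope_le\<close> gives a radius for each point. Continuity of \<open>h\<close>
  transfers the bound at a centre to all nearby points, and a Lebesgue number of the resulting cover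
  of \<open>K\<close> is a common radius.\<close>

lemma slope_le_uniform:
  assumes "open G" "compact K" "K \<subseteq> G" "slope_le G u h" "continuous_on G h" "e > 0"
  obtains r where "r > 0" "\<And>x. x \<in> K \<Longrightarrow> ball x r \<subseteq> G"
    "\<And>x y z. x \<in> K \<Longrightarrow> y \<in> ball x r \<Longrightarrow> z \<in> ball x r \<Longrightarrow> \<bar>u y - u z\<bar> \<le> (h x + e) * dist y z"
proof -
  have "\<exists>r>0. ball a r \<subseteq> G \<and> (\<forall>x\<in>ball a r. \<forall>y\<in>ball a r. \<forall>z\<in>ball a r.
      \<bar>u y - u z\<bar> \<le> (h x + e) * dist y z)" if a: "a \<in> K" for a
  proof -
    have aG: "a \<in> G" using a assms by auto
    obtain r1 where r1: "r1 > 0" "ball a r1 \<subseteq> G" using assms(1) aG openE by blast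
    obtain r2 where r2: "r2 > 0" "\<And>y z. y \<in> ball a r2 \<Longrightarrow> z \<in> ball a r2 \<Longrightarrow>
       \<bar>u y - u z\<bar> \<le> (h a + e / 2) * dist y z"
      using assms(4,6) aG unfolding slope_le_def by (meson half_gt_zero)
    have "isCont h a" using assms(1,5) aG by (simp add: continuous_on_eq_continuous_at)
    then obtain r3 where r3: "r3 > 0" "\<And>x. dist x a < r3 \<Longrightarrow> dist (h x) (h a) < e / 2"
      using assms(6) unfolding continuous_at_eps_delta by (meson half_gt_zero)
    let ?r = "min r1 (min r2 r3)"
    have "\<bar>u y - u z\<bar> \<le> (h x + e) * dist y z"
      if "x \<in> ball a ?r" "y \<in> ball a ?r" "z \<in> ball a ?r" for x y z
    proof -
      have "\<bar>u y - u z\<bar> \<le> (h a + e / 2) * dist y z" using r2(2)[of y z] that by simp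
      also have "\<dots> \<le> (h x + e) * dist y z"
        using r3(2)[of x] that by (intro mult_right_mono) (auto simp: dist_real_def dist_commute abs_if split: if_splits)
      finally show ?thesis .
    qed
    then show ?thesis using r1 r2(1) r3(1) by (intro exI[of _ ?r]) auto
  qed
  then obtain \<delta> where \<delta>: "\<And>a. a \<in> K \<Longrightarrow> \<delta> a > 0 \<and> ball a (\<delta> a) \<subseteq> G \<and>
      (\<forall>x\<in>ball a (\<delta> a). \<forall>y\<in>ball a (\<delta> a). \<forall>z\<in>ball a (\<delta> a). \<bar>u y - u z\<bar> \<le> (h x + e) * dist y z)"
    by metis
  have "K \<subseteq> \<Union>((\<lambda>a. ball a (\<delta> a)) ` K)" using \<delta> by force
  then obtain r where r: "r > 0" "\<And>x. x \<in> K \<Longrightarrow> \<exists>B\<in>(\<lambda>a. ball a (\<delta> a)) ` K. ball x r \<subseteq> B"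
    using Heine_Borel_lemma[OF assms(2)] by (metis (no_types, lifting) imageE open_ball)
  show ?thesis
  proof (rule that[OF r(1)])
    fix x assume "x \<in> K"
    then obtain a where a: "a \<in> K" "ball x r \<subseteq> ball a (\<delta> a)" using r(2) by blast
    then show "ball x r \<subseteq> G" using \<delta>[OF a(1)] by blast
    have x: "x \<in> ball a (\<delta> a)" using a(2) r(1) by (metis centre_in_ball subsetD)
    fix y z assume "y \<in> ball x r" "z \<in> ball x r"
    then have "y \<in> ball a (\<delta> a)" "z \<in> ball a (\<delta> a)" using a(2) by auto
    then show "\<bar>u y - u z\<bar> \<le> (h x + e) * dist y z" using \<delta>[OF a(1)] x by blast
  qed
qed

text \<open>The difference quotients in the direction of the gradient \<open>w\<close> itself tend
  to \<open>w \<bullet> w\<close> and are at most \<open>L * norm w\<close>.\<close>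

lemma norm_gradient_le:
  assumes "open G" "C_k_on (Suc 0) G g" "x \<in> G" "r > 0"
    and L: "\<And>y. y \<in> ball x r \<Longrightarrow> \<bar>g y - g x\<bar> \<le> L * dist y x"
  shows "norm (gradient g x) \<le> L"
proof (cases "gradient g x = 0")
  case True
  have "axis undefined 1 \<noteq> (0 :: real ^ 'a)" by (simp add: axis_eq_0_iff)
  \<comment> \<open>Any point of the ball other than \<open>x\<close> shows that \<open>L\<close> is
    nonnegative.\<close>
  define y where "y = x + (r / 2) *\<^sub>R axis undefined 1"
  have "y \<in> ball x r" "dist y x > 0" using assms(4) by (auto simp: y_def dist_norm axis_eq_0_iff)
  with L[of y] have "0 \<le> L * dist y x" by linarith
  then show ?thesis using True \<open>dist y x > 0\<close> by (simp add: zero_le_mult_iff)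
next
  case False
  define w where "w = gradient g x"
  have w: "norm w > 0" using False by (simp add: w_def)
  have "((\<lambda>s. x + s *\<^sub>R w) has_derivative (\<lambda>s. s *\<^sub>R w)) (at 0)"
    by (auto intro!: derivative_eq_intros)
  moreover have "(g has_derivative (\<lambda>v. w \<bullet> v)) (at (x + 0 *\<^sub>R w))"
    using C_1_has_derivative[OF assms(1-3)] by (simp add: w_def)
  ultimately have "((\<lambda>s. g (x + s *\<^sub>R w)) has_derivative (\<lambda>s. w \<bullet> (s *\<^sub>R w))) (at 0)"
    by (rule has_derivative_compose)
  then have "((\<lambda>s. g (x + s *\<^sub>R w)) has_real_derivative (w \<bullet> w)) (at 0)"
    by (simp add: has_field_derivative_def mult.commute[of _ "w \<bullet> w"])
  then have "((\<lambda>s. (g (x + s *\<^sub>R w) - g x) / s) \<longlongrightarrow> w \<bullet> w) (at 0)"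
    by (simp add: DERIV_def)
  moreover have "eventually (\<lambda>s. (g (x + s *\<^sub>R w) - g x) / s \<le> L * norm w) (at 0)"
  proof -
    have "eventually (\<lambda>s::real. s \<noteq> 0 \<and> dist s 0 < r / norm w) (at 0)"
      using w assms(4) unfolding eventually_at by (intro exI[of _ "r / norm w"]) auto
    then show ?thesis
    proof (rule eventually_mono)
      fix s :: real assume s: "s \<noteq> 0 \<and> dist s 0 < r / norm w"
      then have "x + s *\<^sub>R w \<in> ball x r" using w by (simp add: dist_norm field_simps)
      from L[OF this] have "\<bar>g (x + s *\<^sub>R w) - g x\<bar> \<le> L * (\<bar>s\<bar> * norm w)" by (simp add: dist_norm)
      then have "\<bar>(g (x + s *\<^sub>R w) - g x) / s\<bar> \<le> L * norm w" using s by (simp add: field_simps)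
      then show "(g (x + s *\<^sub>R w) - g x) / s \<le> L * norm w" by linarith
    qed
  qed
  ultimately have "w \<bullet> w \<le> L * norm w" by (intro tendsto_upperbound) auto
  then have "norm w * norm w \<le> L * norm w" by (simp add: norm_eq_sqrt_inner)
  then show ?thesis using w by (simp add: w_def)
qed

text \<open>Averaging translates of \<open>u\<close> keeps a Lipschitz bound: increments of
  \<open>g\<close> near \<open>x\<close> are averages of increments of \<open>u\<close> between
  equally shifted points, all inside one ball where \<open>h x + e\<close> is a Lipschitz
  constant.\<close>

lemma smooth_approx_on_compact:
  fixes G K :: "(real ^ 'n) set"
  assumes G: "open G" and K: "compact K" "K \<subseteq> G"
    and u: "continuous_on G u" "slope_le G u h" "continuous_on G h" and e: "e > 0"
  obtains g where "C_infinity_on UNIV g" "\<And>x. x \<in> K \<Longrightarrow> \<bar>g x - u x\<bar> \<le> e"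
    "\<And>x. x \<in> K \<Longrightarrow> norm (gradient g x) \<le> h x + e"
proof -
  obtain r1 where r1: "r1 > 0" "\<And>x. x \<in> K \<Longrightarrow> ball x r1 \<subseteq> G"
    "\<And>x y z. x \<in> K \<Longrightarrow> y \<in> ball x r1 \<Longrightarrow> z \<in> ball x r1 \<Longrightarrow> \<bar>u y - u z\<bar> \<le> (h x + e) * dist y z"
    using slope_le_uniform[OF G K u(2,3) e] by blast
  have "bounded (h ` K)"
    by (intro compact_imp_bounded compact_continuous_image continuous_on_subset[OF u(3)] K)
  then obtain B where B: "B > 0" "\<And>x. x \<in> K \<Longrightarrow> \<bar>h x\<bar> \<le> B"
    unfolding bounded_pos by auto
  \<comment> \<open>\<open>r1 / 3\<close> leaves room for a point at distance \<open>r\<close>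
    shifted by another \<open>r\<close>; \<open>e / (B + e)\<close> turns the Lipschitz bound into
    the error \<open>e\<close> for the values.\<close>
  define r where "r = min (r1 / 3) (e / (B + e))"
  have r: "r > 0" "2 * r < r1" using r1(1) e B(1) by (auto simp: r_def min_def field_simps)
  have rB: "(h x + e) * r \<le> e" if "x \<in> K" for x
  proof -
    have "(h x + e) * r \<le> (B + e) * r" using B(2)[OF that] r by (intro mult_right_mono) auto
    also have "\<dots> \<le> (B + e) * (e / (B + e))" using B(1) e by (intro mult_left_mono) (auto simp: r_def)
    finally show ?thesis using B(1) e by simp
  qed
  define K' where "K' = {x + z |x z. x \<in> K \<and> z \<in> cball (0 :: real ^ 'n) (2 * r)}"
  have K': "compact K'" unfolding K'_def by (intro compact_sums K compact_cball)
  have cb: "cball x (2 * r) \<subseteq> K'" if "x \<in> K" for x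
  proof
    fix y assume "y \<in> cball x (2 * r)"
    then have "y = x + (y - x)" "y - x \<in> cball 0 (2 * r)" by (auto simp: dist_norm norm_minus_commute)
    then show "y \<in> K'" using that unfolding K'_def by blast
  qed
  have "K' \<subseteq> G"
  proof
    fix y assume "y \<in> K'"
    then obtain x z where "y = x + z" "x \<in> K" "norm z \<le> 2 * r" by (auto simp: K'_def)
    then show "y \<in> G" using r1(2)[of x] r by (auto simp: subset_eq dist_norm)
  qed
  \<comment> \<open>\<open>u\<close> is controlled on \<open>G\<close> only, whereas the
    mollification integrates over a whole box; the continuous extension changes nothing within
    distance \<open>2 * r\<close> of \<open>K\<close>.\<close>
  obtain v where v: "continuous_on UNIV v" "\<And>x. x \<in> K' \<Longrightarrow> v x = u x"
    using Tietze_unbounded[OF continuous_on_subset[OF u(1) \<open>K' \<subseteq> G\<close>], of UNIV] compact_imp_closed[OF K']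
    by auto
  obtain \<kappa> :: "real ^ 'n \<Rightarrow> real" and c where \<kappa>: "\<And>k. C_k_on k UNIV \<kappa>" "\<And>z. \<kappa> z \<ge> 0"
    "\<And>z. norm z \<ge> r \<Longrightarrow> \<kappa> z = 0" "\<And>z. \<kappa> (- z) = \<kappa> z"
    "cball 0 r \<subseteq> cbox (- c) c" "integral (cbox (- c) c) \<kappa> = 1"
    using mollifier_exists[OF r(1)] by blast
  obtain b where b: "K' \<subseteq> cbox (- b) b"
    using bounded_subset_cbox_symmetric[OF compact_imp_bounded[OF K']] by blast
  define g where "g = mollify (- b) b \<kappa> v"
  have g: "C_k_on k UNIV g" for k
    unfolding g_def by (intro C_k_on_mollify continuous_on_subset[OF v(1)] \<kappa>(1)) auto
  have c\<kappa>: "continuous_on S \<kappa>" for S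
    by (rule continuous_on_subset[OF C_k_on_imp_continuous_on[OF \<kappa>(1)]]) simp
  have int: "(\<lambda>z. F z * \<kappa> z) integrable_on cbox (- c) c" if "continuous_on UNIV F" for F
    by (intro integrable_continuous continuous_intros c\<kappa> continuous_on_subset[OF that]) auto
  have cs: "continuous_on UNIV (\<lambda>z. v (y + z))" for y
    by (intro continuous_on_compose2[OF v(1)] continuous_intros) auto
  have gs: "g y = integral (cbox (- c) c) (\<lambda>z. v (y + z) * \<kappa> z)" if "x \<in> K" "dist y x < r" for x y
    unfolding g_def
  proof (rule mollify_eq_shifted_integral[where r=r])
    have "cball y r \<subseteq> cball x (2 * r)" using that(2) by (simp add: cball_subset_cball_iff dist_commute)
    then show "cball y r \<subseteq> cbox (- b) b" using cb[OF that(1)] b by blast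
  qed (use \<kappa> c\<kappa> v in auto)
  have bound: "\<bar>integral (cbox (- c) c) (\<lambda>z. F z * \<kappa> z)\<bar> \<le> L"
    if "continuous_on UNIV F" "\<And>z. norm z < r \<Longrightarrow> \<bar>F z\<bar> \<le> L" for F L
  proof -
    have "norm (integral (cbox (- c) c) (\<lambda>z. F z * \<kappa> z)) \<le> integral (cbox (- c) c) (\<lambda>z. L * \<kappa> z)"
    proof (rule Henstock_Kurzweil_Integration.integral_norm_bound_integral)
      show "(\<lambda>z. F z * \<kappa> z) integrable_on cbox (- c) c" by (rule int[OF that(1)])
      show "(\<lambda>z. L * \<kappa> z) integrable_on cbox (- c) c" by (rule int) simp
      show "norm (F z * \<kappa> z) \<le> L * \<kappa> z" for z
        using that(2)[of z] \<kappa>(2,3)[of z] by (cases "norm z < r") (auto simp: abs_mult mult_right_mono)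
    qed
    then show ?thesis by (simp add: \<kappa>(6))
  qed
  show ?thesis
  proof (rule that[of g])
    show "C_infinity_on UNIV g" using g by (simp add: C_infinity_on_def)
  next
    fix x assume x: "x \<in> K"
    have vu: "v (y + z) = u (y + z)" "y + z \<in> ball x r1" if "dist y x < r" "norm z < r" for y z
    proof -
      have "dist x (y + z) \<le> dist x y + dist y (y + z)" by (rule dist_triangle)
      also have "\<dots> < 2 * r" using that by (simp add: dist_commute dist_norm)
      finally have d: "dist x (y + z) < 2 * r" .
      then show "y + z \<in> ball x r1" using r by simp
      show "v (y + z) = u (y + z)" using d cb[OF x] by (intro v(2)) auto
    qed
    have "integral (cbox (- c) c) (\<lambda>z. u x * \<kappa> z) = u x" using \<kappa>(6) by simp
    then have "g x - u x = integral (cbox (- c) c) (\<lambda>z. v (x + z) * \<kappa> z) -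
        integral (cbox (- c) c) (\<lambda>z. u x * \<kappa> z)"
      using gs[OF x, of x] r by simp
    also have "\<dots> = integral (cbox (- c) c) (\<lambda>z. (v (x + z) - u x) * \<kappa> z)"
      unfolding left_diff_distrib by (intro Henstock_Kurzweil_Integration.integral_diff[symmetric] int cs continuous_intros)
    finally have "\<bar>g x - u x\<bar> = \<bar>integral (cbox (- c) c) (\<lambda>z. (v (x + z) - u x) * \<kappa> z)\<bar>" by simp
    also have "\<dots> \<le> e"
    proof (rule bound)
      show "continuous_on UNIV (\<lambda>z. v (x + z) - u x)" by (intro continuous_intros cs)
      fix z :: "real ^ 'n" assume z: "norm z < r"
      have "\<bar>v (x + z) - u x\<bar> \<le> (h x + e) * norm z"
        using r1(3)[OF x vu(2)[of x z], of x] vu(1)[of x z] z r by (simp add: dist_norm)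
      also have "\<dots> \<le> e"
      proof (cases "h x + e \<ge> 0")
        case True
        have "(h x + e) * norm z \<le> (h x + e) * r" using True z by (intro mult_left_mono) auto
        then show ?thesis using rB[OF x] by simp
      next
        case False
        then have "(h x + e) * norm z \<le> 0" by (simp add: mult_nonpos_nonneg)
        then show ?thesis using e by simp
      qed
      finally show "\<bar>v (x + z) - u x\<bar> \<le> e" .
    qed
    finally show "\<bar>g x - u x\<bar> \<le> e" .
    show "norm (gradient g x) \<le> h x + e"
    proof (rule norm_gradient_le[OF open_UNIV g _ r(1)])
      fix y assume "y \<in> ball x r"
      then have y: "dist y x < r" by (simp add: dist_commute)
      have "g y - g x = integral (cbox (- c) c) (\<lambda>z. (v (y + z) - v (x + z)) * \<kappa> z)"
        unfolding left_diff_distrib gs[OF x y] using gs[OF x, of x] r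
        by (simp add: Henstock_Kurzweil_Integration.integral_diff[OF int[OF cs] int[OF cs]])
      also have "\<bar>\<dots>\<bar> \<le> (h x + e) * dist y x"
      proof (rule bound)
        show "continuous_on UNIV (\<lambda>z. v (y + z) - v (x + z))" by (intro continuous_intros cs)
        fix z :: "real ^ 'n" assume z: "norm z < r"
        show "\<bar>v (y + z) - v (x + z)\<bar> \<le> (h x + e) * dist y x"
          using r1(3)[OF x vu(2)[OF y z] vu(2)[OF _ z, of x]] vu(1)[OF y z] vu(1)[OF _ z, of x] r(1)
          by (simp add: dist_norm)
      qed
      finally show "\<bar>g y - g x\<bar> \<le> (h x + e) * dist y x" .
    qed simp
  qed
qed

section \<open>Smooth approximation on open sets\<close>

lemma gradient_eqI:
  assumes "\<And>i. has_partial f (D $ i) i x"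
  shows "gradient f x = D"
  using has_partial_imp[OF assms] by (simp add: gradient_def vec_eq_iff)

lemma has_partial_gradient:
  assumes "C_k_on (Suc 0) G f" "x \<in> G"
  shows "has_partial f (gradient f x $ i) i x"
  using C_k_on_SucD(2)[OF assms] by (simp add: gradient_def)

lemma gradient_cong:
  assumes "open V" "\<And>y. y \<in> V \<Longrightarrow> f y = g y" "x \<in> V"
  shows "gradient f x = gradient g x"
  unfolding gradient_def by (simp add: partial_deriv_cong[OF assms])

lemma gradient_const: "gradient (\<lambda>x. c) x = 0"
  by (rule gradient_eqI) simp

lemma gradient_sum_mult:
  assumes "\<And>j. C_k_on (Suc 0) UNIV (\<phi> j)" "\<And>j. C_k_on (Suc 0) UNIV (U j)"
  shows "gradient (\<lambda>x. \<Sum>j\<in>J. \<phi> j x * U j x) x =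
    (\<Sum>j\<in>J. \<phi> j x *\<^sub>R gradient (U j) x + U j x *\<^sub>R gradient (\<phi> j) x)"
proof (rule gradient_eqI)
  fix i
  have "has_partial (\<lambda>x. \<phi> j x * U j x) (gradient (\<phi> j) x $ i * U j x + gradient (U j) x $ i * \<phi> j x) i x" for j
    using DERIV_mult[OF has_partial_gradient[OF assms(1)[of j], of x i] has_partial_gradient[OF assms(2)[of j], of x i]]
    by simp
  from DERIV_sum[of J, OF this]
  show "has_partial (\<lambda>x. \<Sum>j\<in>J. \<phi> j x * U j x)
      ((\<Sum>j\<in>J. \<phi> j x *\<^sub>R gradient (U j) x + U j x *\<^sub>R gradient (\<phi> j) x) $ i) i x"
    by (simp add: algebra_simps)
qed

lemma continuous_on_gradient:
  assumes "C_k_on (Suc 0) G f"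
  shows "continuous_on G (gradient f)"
  unfolding gradient_def
  using C_k_on_imp_continuous_on[OF C_k_on_SucD(3)[OF assms]] by (intro continuous_on_vec_lambda)

text \<open>\<open>\<phi> j = \<psi> (j+1) - \<psi> j\<close> for cutoffs \<open>\<psi> j\<close>
  equal to 1 on \<open>A j\<close> and 0 off \<open>A (j+1)\<close>. The difference is nonnegative
  since \<open>\<psi> (j+1) = 1\<close> wherever \<open>\<psi> j\<close> may be nonzero, and partial
  sums telescope to one cutoff.\<close>

lemma smooth_telescoping_partition:
  fixes G :: "(real ^ 'n) set"
  assumes "open G"
  obtains A :: "nat \<Rightarrow> (real ^ 'n) set" and \<phi> :: "nat \<Rightarrow> real ^ 'n \<Rightarrow> real"
  where "\<And>j. compact (A j)" "\<And>j. A j \<subseteq> G" "\<And>j. A j \<subseteq> A (Suc j)" "\<And>x. x \<in> G \<Longrightarrow> \<exists>m. x \<in> interior (A m)"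
    "\<And>j. C_infinity_on UNIV (\<phi> j)" "\<And>j x. \<phi> j x \<ge> 0" "\<And>j x. x \<notin> A (j + 2) \<Longrightarrow> \<phi> j x = 0"
    "\<And>j m x. x \<in> A m \<Longrightarrow> j \<ge> m \<Longrightarrow> \<phi> j x = 0" "\<And>m x. x \<in> A m \<Longrightarrow> (\<Sum>j<m. \<phi> j x) = 1"
proof -
  obtain C where C: "\<And>n. compact (C n)" "\<And>n. C n \<subseteq> G" "\<And>n. C n \<subseteq> interior (C (Suc n))" "\<Union>(range C) = G"
    using open_Union_compact_subsets[OF assms] by metis
  \<comment> \<open>The empty set in front makes \<open>\<psi> 0 = 0\<close> admissible, so the
    telescoping sum starts at 0.\<close>
  define A where "A j = (case j of 0 \<Rightarrow> {} | Suc i \<Rightarrow> C i)" for j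
  have A: "compact (A j)" "A j \<subseteq> G" "A j \<subseteq> interior (A (Suc j))" for j
    using C by (auto simp: A_def split: nat.split)
  have A1: "A j \<subseteq> A (Suc j)" for j using A(3)[of j] interior_subset by blast
  have "\<exists>\<psi>. C_infinity_on UNIV \<psi> \<and> (\<forall>x. 0 \<le> \<psi> x \<and> \<psi> x \<le> 1) \<and> (\<forall>x\<in>A j. \<psi> x = 1) \<and>
      (\<forall>x. x \<notin> interior (A (Suc j)) \<longrightarrow> \<psi> x = 0)" for j
    by (rule smooth_cutoff[OF A(1) open_interior A(3)[of j]]) blast
  then obtain \<psi>' where \<psi>': "\<And>j. C_infinity_on UNIV (\<psi>' j)" "\<And>j x. 0 \<le> \<psi>' j x \<and> \<psi>' j x \<le> 1"
     "\<And>j x. x \<in> A j \<Longrightarrow> \<psi>' j x = 1" "\<And>j x. x \<notin> interior (A (Suc j)) \<Longrightarrow> \<psi>' j x = 0"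
    by metis
  define \<psi> where "\<psi> j = (if j = 0 then (\<lambda>x. 0) else \<psi>' j)" for j :: nat
  have \<psi>1: "C_infinity_on UNIV (\<psi> j)" for j
    using \<psi>'(1)[of j] by (auto simp: \<psi>_def C_infinity_on_def intro!: C_k_on_const)
  have \<psi>2: "0 \<le> \<psi> j x" "\<psi> j x \<le> 1" for j x
    using \<psi>'(2)[of j x] by (cases "j = 0"; simp add: \<psi>_def)+
  have \<psi>3: "\<psi> j x = 1" if "x \<in> A j" for j x
    using \<psi>'(3)[OF that] that by (cases "j = 0") (simp_all add: \<psi>_def A_def)
  have \<psi>4: "\<psi> j x = 0" if "x \<notin> A (Suc j)" for j x
  proof -
    have "x \<notin> interior (A (Suc j))" using that interior_subset by blast
    then show ?thesis using \<psi>'(4) by (cases "j = 0") (simp_all add: \<psi>_def)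
  qed
  have mono: "A i \<subseteq> A j" if "i \<le> j" for i j using lift_Suc_mono_le[of A, OF A1 that] .
  define \<phi> where "\<phi> j x = \<psi> (Suc j) x - \<psi> j x" for j x
  show ?thesis
  proof (rule that[of A \<phi>])
    show "\<exists>m. x \<in> interior (A m)" if "x \<in> G" for x
    proof -
      obtain n where "x \<in> C n" using \<open>x \<in> G\<close> C(4) by blast
      then have "x \<in> interior (A (Suc (Suc n)))" using C(3)[of n] by (auto simp: A_def)
      then show ?thesis ..
    qed
    show "C_infinity_on UNIV (\<phi> j)" for j
      unfolding C_infinity_on_def \<phi>_def
      using \<psi>1 by (intro allI C_k_on_diff open_UNIV) (simp_all add: C_infinity_on_def)
    show "\<phi> j x \<ge> 0" for j x
    proof (cases "x \<in> A (Suc j)")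
      case True
      then show ?thesis using \<psi>2(2)[of j x] \<psi>3[OF True] by (simp add: \<phi>_def)
    next
      case False
      then show ?thesis using \<psi>2(1)[of "Suc j" x] \<psi>4[OF False] by (simp add: \<phi>_def)
    qed
    show "\<phi> j x = 0" if x: "x \<notin> A (j + 2)" for j x
    proof -
      have "x \<notin> A (Suc j)" "x \<notin> A (Suc (Suc j))" using x A1[of "Suc j"] by auto
      then show ?thesis using \<psi>4[of x j] \<psi>4[of x "Suc j"] by (simp add: \<phi>_def)
    qed
    show "\<phi> j x = 0" if "x \<in> A m" "j \<ge> m" for j m x
    proof -
      have "x \<in> A j" "x \<in> A (Suc j)" using that mono[of m j] mono[of m "Suc j"] by auto
      then show ?thesis using \<psi>3[of x j] \<psi>3[of x "Suc j"] by (simp add: \<phi>_def)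
    qed
    show "(\<Sum>j<m. \<phi> j x) = 1" if "x \<in> A m" for m x
    proof -
      have "(\<Sum>j<m. \<phi> j x) = \<psi> m x - \<psi> 0 x" unfolding \<phi>_def by (rule sum_lessThan_telescope)
      then show ?thesis using \<psi>3[OF that] by (simp add: \<psi>_def)
    qed
    show "compact (A j)" "A j \<subseteq> G" "A j \<subseteq> A (Suc j)" for j using A A1 by auto
  qed
qed

text \<open>In the manner of Meyers and Serrin, each layer of the partition gets its own
  approximation of \<open>u\<close>, as accurate as the gradient of its partition function requires;
  so the estimates hold up to the boundary of \<open>G\<close>.\<close>

lemma smooth_approx:
  fixes G :: "(real ^ 'n) set"
  assumes G: "open G" and u: "continuous_on G u" "slope_le G u h" "continuous_on G h" and e: "e > 0"
  obtains g where "C_infinity_on G g" "\<And>x. x \<in> G \<Longrightarrow> \<bar>g x - u x\<bar> \<le> e"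
    "\<And>x. x \<in> G \<Longrightarrow> norm (gradient g x) \<le> h x + e"
proof -
  obtain A :: "nat \<Rightarrow> (real ^ 'n) set" and \<phi> where A: "\<And>j. compact (A j)" "\<And>j. A j \<subseteq> G"
      "\<And>j. A j \<subseteq> A (Suc j)" "\<And>x. x \<in> G \<Longrightarrow> \<exists>m. x \<in> interior (A m)"
    and \<phi>: "\<And>j. C_infinity_on UNIV (\<phi> j)" "\<And>j x. \<phi> j x \<ge> 0" "\<And>j x. x \<notin> A (j + 2) \<Longrightarrow> \<phi> j x = 0"
      "\<And>j m x. x \<in> A m \<Longrightarrow> j \<ge> m \<Longrightarrow> \<phi> j x = 0" "\<And>m x. x \<in> A m \<Longrightarrow> (\<Sum>j<m. \<phi> j x) = 1"
    using smooth_telescoping_partition[OF G] by blast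
  have \<phi>C: "C_k_on k UNIV (\<phi> j)" for k j using \<phi>(1) by (simp add: C_infinity_on_def)
  have "\<exists>M>0. \<forall>x. norm (gradient (\<phi> j) x) \<le> M" for j
  proof -
    have "bounded (gradient (\<phi> j) ` A (j + 2))"
      by (intro compact_imp_bounded compact_continuous_image A(1)
          continuous_on_subset[OF continuous_on_gradient[OF \<phi>C]]) simp
    then obtain M where M: "M > 0" "\<And>x. x \<in> A (j + 2) \<Longrightarrow> norm (gradient (\<phi> j) x) \<le> M"
      unfolding bounded_pos by auto
    have "gradient (\<phi> j) x = 0" if "x \<notin> A (j + 2)" for x
    proof -
      have "gradient (\<phi> j) x = gradient (\<lambda>x. 0) x"
        by (rule gradient_cong[of "- A (j + 2)"])
           (use that \<phi>(3)[of _ j] compact_imp_closed[OF A(1)[of "j + 2"]] in \<open>simp_all add: open_Compl\<close>)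
      then show ?thesis by (simp add: gradient_const)
    qed
    then have "norm (gradient (\<phi> j) x) \<le> M" for x using M by (cases "x \<in> A (j + 2)") simp_all
    then show ?thesis using M(1) by blast
  qed
  then obtain M where M: "\<And>j. M j > 0" "\<And>j x. norm (gradient (\<phi> j) x) \<le> M j" by metis
  \<comment> \<open>Accuracy times gradient bound is at most \<open>e / 2^(j+2)\<close>, which sums
    to at most \<open>e/2\<close>; the other half of \<open>e\<close> is consumed by
    \<open>\<delta> j \<le> e / 2\<close>.\<close>
  define \<delta> where "\<delta> j = (e / 2 ^ (j + 2)) / (1 + M j)" for j
  have \<delta>: "\<delta> j > 0" "\<delta> j * M j \<le> e / 2 ^ (j + 2)" "\<delta> j \<le> e / 2" for j
  proof -
    show "\<delta> j > 0" using e M(1)[of j] by (simp add: \<delta>_def add_pos_pos)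
    have 1: "\<delta> j * (1 + M j) = e / 2 ^ (j + 2)" using M(1)[of j] by (simp add: \<delta>_def)
    then show "\<delta> j * M j \<le> e / 2 ^ (j + 2)" using \<open>\<delta> j > 0\<close> by (simp add: algebra_simps)
    have "\<delta> j \<le> \<delta> j * (1 + M j)" using \<open>\<delta> j > 0\<close> M(1)[of j] by simp
    also have "\<dots> \<le> e / 2 ^ 1" unfolding 1 using e by (intro divide_left_mono power_increasing) auto
    finally show "\<delta> j \<le> e / 2" by simp
  qed
  have "\<exists>U. C_infinity_on UNIV U \<and> (\<forall>x\<in>A (j + 2). \<bar>U x - u x\<bar> \<le> \<delta> j \<and> norm (gradient U x) \<le> h x + \<delta> j)" for j
    by (rule smooth_approx_on_compact[OF G A(1,2)[of "j + 2"] u \<delta>(1)[of j]]) blast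
  then obtain U where U: "\<And>j. C_infinity_on UNIV (U j)"
    "\<And>j x. x \<in> A (j + 2) \<Longrightarrow> \<bar>U j x - u x\<bar> \<le> \<delta> j"
    "\<And>j x. x \<in> A (j + 2) \<Longrightarrow> norm (gradient (U j) x) \<le> h x + \<delta> j"
    by metis
  have UC: "C_k_on k UNIV (U j)" for k j using U(1) by (simp add: C_infinity_on_def)
  \<comment> \<open>The infinite sum is locally finite. It is cut at the first \<open>m\<close> with
    \<open>x\<close> in \<open>interior (A m)\<close>; by \<open>gm\<close> every such
    \<open>m\<close> gives the same value, so \<open>g\<close> is one fixed finite sum on each of
    these open sets.\<close>
  define N where "N x = (LEAST m. x \<in> interior (A m))" for x
  define g where "g x = (\<Sum>j<N x. \<phi> j x * U j x)" for x
  have gm: "g x = (\<Sum>j<m. \<phi> j x * U j x)" if "x \<in> interior (A m)" for x m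
  proof -
    have "N x \<le> m" unfolding N_def by (rule Least_le) (rule that)
    moreover have "x \<in> A (N x)" using LeastI[of "\<lambda>m. x \<in> interior (A m)", OF that] interior_subset
      unfolding N_def by blast
    ultimately show ?thesis unfolding g_def
      by (intro sum.mono_neutral_left) (auto simp: \<phi>(4)[of x "N x"])
  qed
  show ?thesis
  proof (rule that[of g])
    show "C_infinity_on G g" unfolding C_infinity_on_def
    proof (intro allI C_k_on_local)
      fix k x assume "x \<in> G"
      then obtain m where m: "x \<in> interior (A m)" using A(4) by blast
      have "C_k_on k (interior (A m)) (\<lambda>x. \<Sum>j<m. \<phi> j x * U j x)"
        by (rule C_k_on_subset[OF _ subset_UNIV]) (intro C_k_on_sum C_k_on_mult \<phi>C UC open_UNIV)
      then have "C_k_on k (interior (A m)) g"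
        using C_k_on_cong[of "interior (A m)" g "\<lambda>x. \<Sum>j<m. \<phi> j x * U j x" k, OF open_interior gm]
        by blast
      then show "\<exists>V. open V \<and> x \<in> V \<and> C_k_on k V g" using m open_interior by blast
    qed
    fix x assume "x \<in> G"
    then obtain m where m: "x \<in> interior (A m)" using A(4) by blast
    have xm: "x \<in> A m" using m interior_subset by blast
    have "\<bar>g x - u x\<bar> = \<bar>\<Sum>j<m. \<phi> j x * (U j x - u x)\<bar>"
      unfolding gm[OF m] right_diff_distrib sum_subtractf
      by (simp add: sum_distrib_right[symmetric] \<phi>(5)[OF xm])
    also have "\<dots> \<le> (\<Sum>j<m. \<bar>\<phi> j x * (U j x - u x)\<bar>)" by (rule sum_abs)
    also have "\<dots> \<le> (\<Sum>j<m. \<phi> j x * e)"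
    proof (rule sum_mono)
      fix j
      show "\<bar>\<phi> j x * (U j x - u x)\<bar> \<le> \<phi> j x * e"
        using U(2)[of x j] \<phi>(3)[of x j] \<delta>(3)[of j] e \<phi>(2)[of j x]
        by (cases "x \<in> A (j + 2)") (auto simp: abs_mult intro!: mult_left_mono)
    qed
    also have "\<dots> = e" by (simp add: sum_distrib_right[symmetric] \<phi>(5)[OF xm])
    finally show "\<bar>g x - u x\<bar> \<le> e" .
    \<comment> \<open>Hence the gradients of the partition, which are unbounded in \<open>j\<close>, only meet the small differences \<open>U j - u\<close>.\<close>
    have g0: "(\<Sum>j<m. gradient (\<phi> j) x) = 0"
    proof -
      have "(\<Sum>j<m. gradient (\<phi> j) x) = gradient (\<lambda>x. \<Sum>j<m. \<phi> j x * 1) x"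
        by (subst gradient_sum_mult) (auto simp: \<phi>C C_k_on_const gradient_const)
      also have "\<dots> = gradient (\<lambda>x. 1) x"
        using interior_subset[of "A m"] by (intro gradient_cong[OF open_interior _ m]) (auto intro!: \<phi>(5))
      finally show ?thesis by (simp add: gradient_const)
    qed
    have "gradient g x = gradient (\<lambda>x. \<Sum>j<m. \<phi> j x * U j x) x"
      by (rule gradient_cong[OF open_interior gm m])
    also have "\<dots> = (\<Sum>j<m. \<phi> j x *\<^sub>R gradient (U j) x + U j x *\<^sub>R gradient (\<phi> j) x)
        - u x *\<^sub>R (\<Sum>j<m. gradient (\<phi> j) x)"
      by (simp add: gradient_sum_mult[OF \<phi>C UC] g0)
    also have "\<dots> = (\<Sum>j<m. \<phi> j x *\<^sub>R gradient (U j) x + (U j x - u x) *\<^sub>R gradient (\<phi> j) x)"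
      by (simp add: scaleR_sum_right sum_subtractf[symmetric] algebra_simps)
    finally have "norm (gradient g x) \<le>
        (\<Sum>j<m. norm (\<phi> j x *\<^sub>R gradient (U j) x + (U j x - u x) *\<^sub>R gradient (\<phi> j) x))"
      by (simp add: norm_sum)
    also have "\<dots> \<le> (\<Sum>j<m. \<phi> j x * (h x + e / 2) + (e / 4) * (1 / 2) ^ j)"
    proof (rule sum_mono)
      fix j
      show "norm (\<phi> j x *\<^sub>R gradient (U j) x + (U j x - u x) *\<^sub>R gradient (\<phi> j) x)
          \<le> \<phi> j x * (h x + e / 2) + (e / 4) * (1 / 2) ^ j"
      proof (cases "x \<in> A (j + 2)")
        case True
        have "norm (\<phi> j x *\<^sub>R gradient (U j) x) \<le> \<phi> j x * (h x + e / 2)"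
          using U(3)[OF True] \<delta>(3)[of j] \<phi>(2)[of j x] by (auto intro!: mult_left_mono)
        moreover have "norm ((U j x - u x) *\<^sub>R gradient (\<phi> j) x) \<le> \<delta> j * M j"
          using U(2)[OF True] M(2)[of j x] \<delta>(1)[of j] by (auto intro!: mult_mono)
        moreover have "e / 2 ^ (j + 2) = (e / 4) * (1 / 2) ^ j"
          by (simp add: power_add power_divide)
        ultimately show ?thesis using \<delta>(2)[of j]
          norm_triangle_ineq[of "\<phi> j x *\<^sub>R gradient (U j) x" "(U j x - u x) *\<^sub>R gradient (\<phi> j) x"]
          by linarith
      next
        case False
        have "gradient (\<phi> j) x = gradient (\<lambda>x. 0) x"
          by (rule gradient_cong[of "- A (j + 2)"])
             (use False \<phi>(3)[of _ j] compact_imp_closed[OF A(1)[of "j + 2"]] in \<open>simp_all add: open_Compl\<close>)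
        then show ?thesis using \<phi>(3)[OF False] e by (simp add: gradient_const)
      qed
    qed
    also have "\<dots> = (\<Sum>j<m. \<phi> j x) * (h x + e / 2) + (e / 4) * (\<Sum>j<m. (1 / 2) ^ j)"
      by (simp add: sum.distrib sum_distrib_left sum_distrib_right)
    also have "\<dots> \<le> h x + e"
    proof -
      have "(\<Sum>j<m. (1 / 2 :: real) ^ j) = 2 - 2 * (1 / 2) ^ m" by (simp add: sum_gp_strict)
      also have "\<dots> \<le> 2" by simp
      finally have "(\<Sum>j<m. (1 / 2 :: real) ^ j) \<le> 2" .
      then have "(e / 4) * (\<Sum>j<m. (1 / 2) ^ j) \<le> (e / 4) * 2" using e by (intro mult_left_mono) auto
      then show ?thesis using \<phi>(5)[OF xm] by simp
    qed
    finally show "norm (gradient g x) \<le> h x + e" .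
  qed
qed

section \<open>The weighted Poincare inequality for locally Lipschitz functions\<close>

lemma slope_le_abs: "slope_le G u h \<Longrightarrow> slope_le G (\<lambda>x. \<bar>u x\<bar>) h"
  unfolding slope_le_def by (meson abs_triangle_ineq3 order_trans)

lemma slope_le_min:
  assumes "slope_le G u h" shows "slope_le G (\<lambda>x. min (u x) N) h"
proof -
  have "\<bar>min a N - min b N\<bar> \<le> \<bar>a - b\<bar>" for a b :: real by (auto simp: min_def)
  with assms show ?thesis unfolding slope_le_def by (meson order_trans)
qed

lemma slope_le_max:
  assumes "slope_le G u h" shows "slope_le G (\<lambda>x. max (u x) N) h"
proof -
  have "\<bar>max a N - max b N\<bar> \<le> \<bar>a - b\<bar>" for a b :: real by (auto simp: max_def)
  with assms show ?thesis unfolding slope_le_def by (meson order_trans)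
qed

lemma abs_power_diff_le:
  fixes a b c :: real
  assumes "0 \<le> a" "a \<le> c" "0 \<le> b" "b \<le> c"
  shows "\<bar>a ^ m - b ^ m\<bar> \<le> real m * c ^ (m - 1) * \<bar>a - b\<bar>"
proof -
  have "norm (a ^ m - b ^ m) \<le> real m * c ^ (m - 1) * norm (a - b)"
  proof (rule field_differentiable_bound[where S="{0..c}" and f'="\<lambda>z. real m * z ^ (m - 1)"])
    fix z assume "z \<in> {0..c}"
    then show "norm (real m * z ^ (m - 1)) \<le> real m * c ^ (m - 1)"
      by (auto simp: abs_mult power_abs intro!: mult_left_mono power_mono)
  qed (use assms in \<open>auto intro!: derivative_eq_intros\<close>)
  then show ?thesis by simp
qed

lemma slope_le_power:
  assumes G: "open G" and u: "continuous_on G u" "slope_le G u h"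
    and u0: "\<And>x. x \<in> G \<Longrightarrow> 0 \<le> u x"
  shows "slope_le G (\<lambda>x. u x ^ m) (\<lambda>x. real m * u x ^ (m - 1) * h x)"
  unfolding slope_le_def
proof (intro ballI allI impI)
  fix x e assume x: "x \<in> G" and e: "(e :: real) > 0"
  \<comment> \<open>The Lipschitz constant of the power when \<open>u x\<close> and
    \<open>h x\<close> are both enlarged by \<open>s\<close>; by continuity at \<open>0\<close> some
    \<open>s > 0\<close> costs less than \<open>e\<close>.\<close>
  define F where "F s = real m * (u x + s) ^ (m - 1) * (h x + s)" for s
  have "(F \<longlongrightarrow> F 0) (at_right 0)" unfolding F_def by (intro tendsto_intros)
  then have "eventually (\<lambda>s. F s < F 0 + e) (at_right 0)" using e by (intro order_tendstoD) auto
  then have "eventually (\<lambda>s. F s < F 0 + e \<and> s > 0) (at_right 0)"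
    by (intro eventually_conj) (auto simp: eventually_at_right_less)
  then obtain s where s: "F s < F 0 + e" "s > 0"
    using eventually_happens[of _ "at_right (0::real)"] by (auto simp: trivial_limit_at_right_real)
  obtain r1 where r1: "r1 > 0" "ball x r1 \<subseteq> G" using G x openE by blast
  obtain r2 where r2: "r2 > 0" "\<And>y z. y \<in> ball x r2 \<Longrightarrow> z \<in> ball x r2 \<Longrightarrow> \<bar>u y - u z\<bar> \<le> (h x + s) * dist y z"
    using u(2) x s(2) unfolding slope_le_def by meson
  have "isCont u x" using G u(1) x by (simp add: continuous_on_eq_continuous_at)
  then obtain r3 where r3: "r3 > 0" "\<And>y. dist y x < r3 \<Longrightarrow> dist (u y) (u x) < s"
    using s(2) unfolding continuous_at_eps_delta by meson
  let ?r = "min r1 (min r2 r3)"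
  show "\<exists>r>0. \<forall>y\<in>ball x r. \<forall>z\<in>ball x r. \<bar>u y ^ m - u z ^ m\<bar> \<le> (real m * u x ^ (m - 1) * h x + e) * dist y z"
  proof (intro exI[of _ ?r] conjI ballI)
    fix y z assume yz: "y \<in> ball x ?r" "z \<in> ball x ?r"
    have "0 \<le> u y" "0 \<le> u z" using u0 r1(2) yz by auto
    moreover have "u y \<le> u x + s" "u z \<le> u x + s"
      using r3(2)[of y] r3(2)[of z] yz by (auto simp: dist_real_def dist_commute abs_if split: if_splits)
    ultimately have "\<bar>u y ^ m - u z ^ m\<bar> \<le> real m * (u x + s) ^ (m - 1) * \<bar>u y - u z\<bar>"
      by (intro abs_power_diff_le)
    also have "\<dots> \<le> real m * (u x + s) ^ (m - 1) * ((h x + s) * dist y z)"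
      using r2(2)[of y z] yz s(2) u0[OF x] by (intro mult_left_mono) auto
    also have "\<dots> = F s * dist y z" by (simp add: F_def)
    also have "\<dots> \<le> (F 0 + e) * dist y z" using s by (intro mult_right_mono) auto
    finally show "\<bar>u y ^ m - u z ^ m\<bar> \<le> (real m * u x ^ (m - 1) * h x + e) * dist y z"
      by (simp add: F_def)
  qed (use r1 r2 r3 in auto)
qed

lemma le_if_le_add_small:
  fixes x a b :: real
  assumes "\<And>e. 0 < e \<Longrightarrow> e < 1 \<Longrightarrow> x \<le> a + e * b"
  shows "x \<le> a"
proof (rule tendsto_lowerbound)
  show "((\<lambda>e. a + e * b) \<longlongrightarrow> a) (at_right 0)"
    by (rule tendsto_eq_intros refl | simp)+
  show "eventually (\<lambda>e. x \<le> a + e * b) (at_right 0)"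
    unfolding eventually_at_right_field by (intro exI[of _ 1]) (auto intro: assms)
qed simp

text \<open>Square integrability \<open>w_sq\<close> makes an additive error in the gradient
  negligible in the Poincare inequality; in the theorem it follows from the moment bound on
  \<open>w\<close>.\<close>

locale weighted_poincare_space =
  fixes G :: "(real ^ 'n) set" and \<mu> :: "(real ^ 'n) measure" and w :: "real ^ 'n \<Rightarrow> real"
  assumes open_G: "open G" and borel_prob: "borel_prob_on G \<mu>"
    and w_meas: "w \<in> borel_measurable (restrict_space borel G)"
    and w_nonneg: "\<And>x. x \<in> G \<Longrightarrow> w x \<ge> 0"
    and poincare: "weighted_poincare G \<mu> w"
    and w_sq: "(\<integral>\<^sup>+x. ennreal ((w x)\<^sup>2) \<partial>\<mu>) < \<infinity>"
begin

sublocale prob_space \<mu> using borel_prob by (simp add: borel_prob_on_def)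

lemma space_eq: "space \<mu> = G"
  using borel_prob sets_eq_imp_space_eq[of \<mu> "restrict_space borel G"]
  by (simp add: borel_prob_on_def space_restrict_space)

lemma measurable_eq: "borel_measurable \<mu> = borel_measurable (restrict_space borel G)"
  using borel_prob by (intro measurable_cong_sets) (auto simp: borel_prob_on_def)

lemma cont_meas: "continuous_on G f \<Longrightarrow> (f :: real ^ 'n \<Rightarrow> real) \<in> borel_measurable \<mu>"
  unfolding measurable_eq by (rule borel_measurable_continuous_on_restrict)

lemma w_measurable [measurable]: "w \<in> borel_measurable \<mu>"
  using w_meas by (simp add: measurable_eq)

lemma integrable_bounded_cont:
  assumes "continuous_on G f" "\<And>x. x \<in> G \<Longrightarrow> \<bar>f x\<bar> \<le> M"
  shows "integrable \<mu> (f :: real ^ 'n \<Rightarrow> real)"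
  by (rule integrable_const_bound[of _ M]) (use assms in \<open>auto simp: space_eq intro!: cont_meas\<close>)

text \<open>A smooth \<open>g\<close> within \<open>e\<close> of \<open>u\<close> satisfies the
  inequality with \<open>h + e\<close>; boundedness of \<open>u\<close> makes the variance stable
  under uniform approximation, and \<open>e\<close> tends to 0.\<close>

lemma Var_le_slope:
  assumes u: "continuous_on G u" "slope_le G u h" and h: "continuous_on G h" "\<And>x. x \<in> G \<Longrightarrow> h x \<ge> 0"
    and M: "\<And>x. x \<in> G \<Longrightarrow> \<bar>u x\<bar> \<le> M"
  shows "ennreal (Var \<mu> u) \<le> (\<integral>\<^sup>+x. ennreal ((h x)\<^sup>2 * (w x)\<^sup>2) \<partial>\<mu>)" (is "_ \<le> ?R")
proof (cases "?R = \<infinity>")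
  case False
  note [measurable] = cont_meas[OF h(1)]
  define A where "A = enn2real ?R"
  define W where "W = enn2real (\<integral>\<^sup>+x. ennreal ((w x)\<^sup>2) \<partial>\<mu>)"
  have A: "?R = ennreal A" "A \<ge> 0" using False by (auto simp: A_def less_top)
  have W: "(\<integral>\<^sup>+x. ennreal ((w x)\<^sup>2) \<partial>\<mu>) = ennreal W" "W \<ge> 0"
    using w_sq by (auto simp: W_def less_top)
  have "M \<ge> 0"
  proof -
    obtain x where "x \<in> G" using not_empty space_eq by auto
    then show ?thesis using M[of x] by simp
  qed
  have "Var \<mu> u \<le> A + e * (A + 2 * W + 2 * (2 * M + 1))" if e: "0 < e" "e < 1" for e
  proof -
    obtain g where g: "C_infinity_on G g" "\<And>x. x \<in> G \<Longrightarrow> \<bar>g x - u x\<bar> \<le> e"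
      "\<And>x. x \<in> G \<Longrightarrow> norm (gradient g x) \<le> h x + e"
      using smooth_approx[OF open_G u h(1) e(1)] by blast
    have gc: "continuous_on G g" using g(1) C_k_on_imp_continuous_on by (auto simp: C_infinity_on_def)
    have gM: "\<bar>g x\<bar> \<le> M + 1" if "x \<in> G" for x using g(2)[OF that] M[OF that] e by linarith
    then have "bounded (g ` G)" unfolding bounded_iff by auto
    then have "ennreal (Var \<mu> g) \<le> (\<integral>\<^sup>+x. ennreal ((norm (gradient g x))\<^sup>2 * (w x)\<^sup>2) \<partial>\<mu>)"
      using poincare g(1) by (simp add: weighted_poincare_def)
    also have "\<dots> \<le> (\<integral>\<^sup>+x. ennreal (1 + e) * ennreal ((h x)\<^sup>2 * (w x)\<^sup>2) + ennreal (2 * e) * ennreal ((w x)\<^sup>2) \<partial>\<mu>)"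
    proof (rule nn_integral_mono)
      fix x assume "x \<in> space \<mu>"
      then have x: "x \<in> G" by (simp add: space_eq)
      have "(norm (gradient g x))\<^sup>2 \<le> (h x + e)\<^sup>2" using g(3)[OF x] by (intro power_mono) auto
      \<comment> \<open>\<open>2 e h \<le> e h\<^sup>2 + e\<close> and
        \<open>e\<^sup>2 \<le> e\<close>: the cross term is split so that only the finite integrals
        \<open>A\<close> and \<open>W\<close> occur.\<close>
      also have "\<dots> \<le> (1 + e) * (h x)\<^sup>2 + 2 * e"
      proof -
        have "0 \<le> e * (h x - 1)\<^sup>2" using e by simp
        moreover have "e\<^sup>2 \<le> e" using e by (simp add: power2_eq_square mult_left_le)
        ultimately show ?thesis by (simp add: power2_eq_square algebra_simps)
      qed
      finally have "(norm (gradient g x))\<^sup>2 * (w x)\<^sup>2 \<le> ((1 + e) * (h x)\<^sup>2 + 2 * e) * (w x)\<^sup>2"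
        by (rule mult_right_mono) simp
      then have "ennreal ((norm (gradient g x))\<^sup>2 * (w x)\<^sup>2) \<le>
          ennreal ((1 + e) * ((h x)\<^sup>2 * (w x)\<^sup>2) + 2 * e * (w x)\<^sup>2)"
        by (intro ennreal_leI) (simp add: algebra_simps)
      also have "\<dots> = ennreal (1 + e) * ennreal ((h x)\<^sup>2 * (w x)\<^sup>2) + ennreal (2 * e) * ennreal ((w x)\<^sup>2)"
        using e by (simp add: ennreal_plus ennreal_mult)
      finally show "ennreal ((norm (gradient g x))\<^sup>2 * (w x)\<^sup>2) \<le> \<dots>" .
    qed
    also have "\<dots> = ennreal (1 + e) * ?R + ennreal (2 * e) * (\<integral>\<^sup>+x. ennreal ((w x)\<^sup>2) \<partial>\<mu>)"
      by (simp add: nn_integral_add nn_integral_cmult)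
    also have "\<dots> = ennreal ((1 + e) * A + 2 * e * W)"
    proof -
      have "ennreal ((1 + e) * A + 2 * e * W) = ennreal ((1 + e) * A) + ennreal (2 * e * W)"
        using e A(2) W(2) by (intro ennreal_plus) auto
      also have "ennreal ((1 + e) * A) = ennreal (1 + e) * ennreal A"
        using e A(2) by (intro ennreal_mult) auto
      also have "ennreal (2 * e * W) = ennreal (2 * e) * ennreal W"
        using e W(2) by (intro ennreal_mult) auto
      finally show ?thesis unfolding A(1) W(1) by (rule sym)
    qed
    finally have Vg: "Var \<mu> g \<le> (1 + e) * A + 2 * e * W"
      using e A(2) W(2) by (subst (asm) ennreal_le_iff) auto
    have int: "integrable \<mu> u" "integrable \<mu> g"
      using integrable_bounded_cont[OF u(1) M] integrable_bounded_cont[OF gc gM] by auto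
    have int2: "integrable \<mu> (\<lambda>x. (u x)\<^sup>2)" "integrable \<mu> (\<lambda>x. (g x)\<^sup>2)"
    proof -
      show "integrable \<mu> (\<lambda>x. (u x)\<^sup>2)"
        by (rule integrable_bounded_cont[of _ "M\<^sup>2"])
           (use u(1) M \<open>M \<ge> 0\<close> in \<open>auto intro!: continuous_intros simp: abs_le_square_iff[symmetric]\<close>)
      show "integrable \<mu> (\<lambda>x. (g x)\<^sup>2)"
        by (rule integrable_bounded_cont[of _ "(M + 1)\<^sup>2"])
           (use gc gM \<open>M \<ge> 0\<close> in \<open>auto intro!: continuous_intros simp: abs_le_square_iff[symmetric]\<close>)
    qed
    \<comment> \<open>Used twice: pointwise for \<open>u\<close> against \<open>g\<close>, and for
      their means.\<close>
    have sq: "a\<^sup>2 \<le> b\<^sup>2 + e * (2 * M + 1)" if "\<bar>a - b\<bar> \<le> e" "\<bar>a + b\<bar> \<le> 2 * M + 1" for a b :: real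
    proof -
      have "a\<^sup>2 - b\<^sup>2 = (a - b) * (a + b)" by (simp add: power2_eq_square algebra_simps)
      also have "\<dots> \<le> \<bar>a - b\<bar> * \<bar>a + b\<bar>" by (metis abs_ge_self abs_mult)
      also have "\<dots> \<le> e * (2 * M + 1)" using that e by (intro mult_mono) auto
      finally show ?thesis by simp
    qed
    have "(\<integral>x. (u x)\<^sup>2 \<partial>\<mu>) \<le> (\<integral>x. (g x)\<^sup>2 + e * (2 * M + 1) \<partial>\<mu>)"
    proof (rule integral_mono)
      fix x assume "x \<in> space \<mu>"
      then have x: "x \<in> G" by (simp add: space_eq)
      show "(u x)\<^sup>2 \<le> (g x)\<^sup>2 + e * (2 * M + 1)"
        by (rule sq) (use g(2)[OF x] M[OF x] e in linarith)+
    qed (auto intro: int2)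
    then have I2: "(\<integral>x. (u x)\<^sup>2 \<partial>\<mu>) \<le> (\<integral>x. (g x)\<^sup>2 \<partial>\<mu>) + e * (2 * M + 1)"
      using int2 by (simp add: prob_space)
    have bd: "\<bar>\<integral>x. f x \<partial>\<mu>\<bar> \<le> B" if "integrable \<mu> f" "\<And>x. x \<in> G \<Longrightarrow> \<bar>f x\<bar> \<le> B" for f :: "real ^ 'n \<Rightarrow> real" and B
      using integral_abs_bound_integral[of \<mu> f "\<lambda>_. B"] that by (simp add: space_eq prob_space[unfolded space_eq])
    have "\<bar>(\<integral>x. g x \<partial>\<mu>) - (\<integral>x. u x \<partial>\<mu>)\<bar> \<le> e" "\<bar>(\<integral>x. g x \<partial>\<mu>) + (\<integral>x. u x \<partial>\<mu>)\<bar> \<le> 2 * M + 1"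
    proof -
      have "\<bar>\<integral>x. g x - u x \<partial>\<mu>\<bar> \<le> e" using int g(2) by (intro bd) auto
      then show "\<bar>(\<integral>x. g x \<partial>\<mu>) - (\<integral>x. u x \<partial>\<mu>)\<bar> \<le> e" using int by simp
      have "\<bar>\<integral>x. g x + u x \<partial>\<mu>\<bar> \<le> 2 * M + 1"
        by (intro bd) (use int gM M in fastforce)+
      then show "\<bar>(\<integral>x. g x \<partial>\<mu>) + (\<integral>x. u x \<partial>\<mu>)\<bar> \<le> 2 * M + 1" using int by simp
    qed
    then have "(\<integral>x. g x \<partial>\<mu>)\<^sup>2 \<le> (\<integral>x. u x \<partial>\<mu>)\<^sup>2 + e * (2 * M + 1)" by (rule sq)
    then show ?thesis using I2 Vg unfolding Var_def by (simp add: algebra_simps)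
  qed
  then have "Var \<mu> u \<le> A" by (rule le_if_le_add_small)
  then show ?thesis by (simp add: A ennreal_leI)
qed simp

end

section \<open>Moment inequalities\<close>

text \<open>Young's inequality for the exponents \<open>m/(m-1)\<close> and \<open>m\<close>;
  integrated with normalised factors it takes the place of Hoelder's inequality.\<close>

lemma young_power:
  fixes a b :: real
  assumes "a \<ge> 0" "b \<ge> 0" "m \<ge> 1"
  shows "a ^ (m - 1) * b \<le> (real (m - 1) * a ^ m + b ^ m) / real m"
proof (cases "a = 0 \<or> b = 0")
  case True
  then show ?thesis using assms by (cases "m = 1") (auto simp: power_0_left zero_power)
next
  case False
  then have ab: "a > 0" "b > 0" using assms by auto
  have m: "real m > 0" using assms by simp
  have "(a ^ m) powr (real (m - 1) / real m) * (b ^ m) powr (1 / real m)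
      \<le> real (m - 1) / real m * a ^ m + 1 / real m * b ^ m"
    by (rule Youngs_inequality_0) (use assms ab in \<open>auto simp: field_simps of_nat_diff\<close>)
  moreover have "(a ^ m) powr (real (m - 1) / real m) = a ^ (m - 1)"
    using ab m by (simp add: powr_powr flip: powr_realpow)
  moreover have "(b ^ m) powr (1 / real m) = b"
    using ab m by (simp add: powr_powr flip: powr_realpow)
  ultimately show ?thesis using m by (simp add: field_simps)
qed

section \<open>Comparison of moments on a probability space\<close>

context prob_space
begin

text \<open>Jensen's inequality in pointwise form: the concave function \<open>y^(r/s)\<close> lies
  below its tangent at 1, taken at \<open>y = (|X|/C)^s\<close>. Stating it for an upper bound
  \<open>C\<close> keeps infinite norms out.\<close>

lemma powr_moment_mono:
  assumes [measurable]: "X \<in> borel_measurable M" and rs: "0 < r" "r \<le> s" and C: "C > 0"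
    and le: "(\<integral>\<^sup>+x. ennreal (\<bar>X x\<bar> powr s) \<partial>M) \<le> ennreal (C powr s)"
  shows "(\<integral>\<^sup>+x. ennreal (\<bar>X x\<bar> powr r) \<partial>M) \<le> ennreal (C powr r)"
proof -
  define c where "c = r / s * (C powr r / C powr s)"
  have c: "c \<ge> 0" "r / s \<ge> 0" "1 - r / s \<ge> 0" using rs by (auto simp: c_def)
  have pt: "ennreal (\<bar>X x\<bar> powr r) \<le> ennreal c * ennreal (\<bar>X x\<bar> powr s) + ennreal ((1 - r / s) * C powr r)" for x
  proof -
    have "\<bar>X x\<bar> powr r \<le> c * \<bar>X x\<bar> powr s + (1 - r / s) * C powr r"
    proof (cases "X x = 0")
      case False
      define y where "y = (\<bar>X x\<bar> / C) powr s"
      have y: "y > 0" using False C by (simp add: y_def)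
      have "y powr (r / s) * 1 powr (1 - r / s) \<le> r / s * y + (1 - r / s) * 1"
        by (rule Youngs_inequality_0) (use y c in auto)
      moreover have "y powr (r / s) = \<bar>X x\<bar> powr r / C powr r"
        using rs C unfolding y_def powr_powr by (simp add: powr_divide)
      ultimately have "\<bar>X x\<bar> powr r / C powr r \<le> r / s * y + (1 - r / s)" by simp
      then have "\<bar>X x\<bar> powr r \<le> (r / s * y + (1 - r / s)) * C powr r"
        using C by (simp add: pos_divide_le_eq)
      moreover have "y = \<bar>X x\<bar> powr s / C powr s" using C by (simp add: y_def powr_divide)
      ultimately show ?thesis by (simp add: c_def algebra_simps)
    qed (use c C in auto)
    then have "ennreal (\<bar>X x\<bar> powr r) \<le> ennreal (c * \<bar>X x\<bar> powr s + (1 - r / s) * C powr r)"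
      by (rule ennreal_leI)
    also have "\<dots> = ennreal c * ennreal (\<bar>X x\<bar> powr s) + ennreal ((1 - r / s) * C powr r)"
      using c by (subst ennreal_plus) (auto simp: ennreal_mult)
    finally show ?thesis .
  qed
  have "(\<integral>\<^sup>+x. ennreal (\<bar>X x\<bar> powr r) \<partial>M) \<le>
      (\<integral>\<^sup>+x. ennreal c * ennreal (\<bar>X x\<bar> powr s) + ennreal ((1 - r / s) * C powr r) \<partial>M)"
    by (intro nn_integral_mono pt)
  also have "\<dots> = ennreal c * (\<integral>\<^sup>+x. ennreal (\<bar>X x\<bar> powr s) \<partial>M) + ennreal ((1 - r / s) * C powr r)"
    by (simp add: nn_integral_add nn_integral_cmult emeasure_space_1)
  also have "\<dots> \<le> ennreal c * ennreal (C powr s) + ennreal ((1 - r / s) * C powr r)"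
    by (intro add_right_mono mult_left_mono le) simp
  also have "\<dots> = ennreal (c * C powr s + (1 - r / s) * C powr r)"
    using c by (subst ennreal_plus) (auto simp: ennreal_mult)
  also have "c * C powr s + (1 - r / s) * C powr r = C powr r"
    using C by (simp add: c_def field_simps)
  finally show ?thesis .
qed

lemma power_moment_mono:
  assumes "X \<in> borel_measurable M" "0 < r" "r \<le> s" "C > 0"
    and nn: "\<And>x. x \<in> space M \<Longrightarrow> X x \<ge> 0"
    and le: "(\<integral>\<^sup>+x. ennreal (X x ^ s) \<partial>M) \<le> ennreal (C ^ s)"
  shows "(\<integral>\<^sup>+x. ennreal (X x ^ r) \<partial>M) \<le> ennreal (C ^ r)"
proof -
  have eq: "(\<integral>\<^sup>+x. ennreal (\<bar>X x\<bar> powr real n) \<partial>M) = (\<integral>\<^sup>+x. ennreal (X x ^ n) \<partial>M)" if "n > 0" for n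
    by (rule nn_integral_cong) (use nn that in \<open>simp add: powr_realpow'\<close>)
  from powr_moment_mono[of X "real r" "real s" C] show ?thesis
    using assms eq[of r] eq[of s] by (simp add: powr_realpow)
qed

text \<open>Cauchy-Schwarz through \<open>2AB \<le> A\<^sup>2 + B\<^sup>2\<close>; the weights
  \<open>c\<close> and \<open>d\<close> are balanced so that each term contributes half of
  \<open>(a * b) ^ q\<close>.\<close>

lemma product_moment_le:
  assumes [measurable]: "X \<in> borel_measurable M" "Y \<in> borel_measurable M" and ab: "a > 0" "b > 0"
    and X: "(\<integral>\<^sup>+x. ennreal (X x ^ (2 * q)) \<partial>M) \<le> ennreal (a ^ (2 * q))"
    and Y: "(\<integral>\<^sup>+x. ennreal (Y x ^ (2 * q)) \<partial>M) \<le> ennreal (b ^ (2 * q))"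
  shows "(\<integral>\<^sup>+x. ennreal ((X x * Y x) ^ q) \<partial>M) \<le> ennreal ((a * b) ^ q)"
proof -
  define c d where "c = b ^ q / (2 * a ^ q)" and "d = a ^ q / (2 * b ^ q)"
  have cd: "c \<ge> 0" "d \<ge> 0" using ab by (auto simp: c_def d_def)
  have pe: "z ^ (2 * q) = z ^ q * z ^ q" for z :: real by (simp add: mult_2 power_add)
  have pt: "ennreal ((X x * Y x) ^ q) \<le> ennreal c * ennreal (X x ^ (2 * q)) + ennreal d * ennreal (Y x ^ (2 * q))" for x
  proof -
    have "0 \<le> (X x ^ q * b ^ q - Y x ^ q * a ^ q)\<^sup>2" by simp
    then have "(X x * Y x) ^ q \<le> c * X x ^ (2 * q) + d * Y x ^ (2 * q)"
      using ab unfolding c_def d_def pe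
      by (simp add: power_mult_distrib power2_eq_square field_simps)
    then have "ennreal ((X x * Y x) ^ q) \<le> ennreal (c * X x ^ (2 * q) + d * Y x ^ (2 * q))"
      by (rule ennreal_leI)
    also have "\<dots> = ennreal c * ennreal (X x ^ (2 * q)) + ennreal d * ennreal (Y x ^ (2 * q))"
      using cd by (subst ennreal_plus) (auto simp: ennreal_mult)
    finally show ?thesis .
  qed
  have "(\<integral>\<^sup>+x. ennreal ((X x * Y x) ^ q) \<partial>M) \<le>
      (\<integral>\<^sup>+x. ennreal c * ennreal (X x ^ (2 * q)) + ennreal d * ennreal (Y x ^ (2 * q)) \<partial>M)"
    by (intro nn_integral_mono pt)
  also have "\<dots> = ennreal c * (\<integral>\<^sup>+x. ennreal (X x ^ (2 * q)) \<partial>M) + ennreal d * (\<integral>\<^sup>+x. ennreal (Y x ^ (2 * q)) \<partial>M)"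
    by (simp add: nn_integral_add nn_integral_cmult)
  also have "\<dots> \<le> ennreal c * ennreal (a ^ (2 * q)) + ennreal d * ennreal (b ^ (2 * q))"
    by (intro add_mono mult_left_mono X Y) auto
  also have "\<dots> = ennreal (c * a ^ (2 * q) + d * b ^ (2 * q))"
    using cd ab by (subst ennreal_plus) (auto simp: ennreal_mult)
  also have "c * a ^ (2 * q) + d * b ^ (2 * q) = (a * b) ^ q"
    using ab unfolding pe by (simp add: c_def d_def power_mult_distrib field_simps)
  finally show ?thesis .
qed

end

section \<open>Growth of moments under the Poincare inequality\<close>

context weighted_poincare_space
begin

text \<open>The inequality for \<open>u ^ m\<close> and Hoelder give
  \<open>U^(2m) \<le> b^m + (m K)\<^sup>2 U^(2m-2)\<close>, where \<open>U\<close> is the norm of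
  order \<open>2m\<close> and \<open>b\<close> bounds the squared norm of order \<open>m\<close>.
  Dividing by \<open>U^(2m-2)\<close> is legitimate because boundedness of \<open>u\<close> makes
  \<open>U\<close> finite.\<close>

lemma bounded_moment_step:
  assumes u: "continuous_on G u" "slope_le G u h" and h: "continuous_on G h" "\<And>x. x \<in> G \<Longrightarrow> h x \<ge> 0"
    and u0: "\<And>x. x \<in> G \<Longrightarrow> 0 \<le> u x" and N: "\<And>x. x \<in> G \<Longrightarrow> u x \<le> N" and m: "m \<ge> 1"
    and b: "b \<ge> 0" "(\<integral>x. u x ^ m \<partial>\<mu>)\<^sup>2 \<le> b ^ m"
    and K: "K > 0" "(\<integral>\<^sup>+x. ennreal ((h x * w x) ^ (2 * m)) \<partial>\<mu>) \<le> ennreal (K ^ (2 * m))"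
  shows "(\<integral>x. u x ^ (2 * m) \<partial>\<mu>) \<le> (b + (real m * K)\<^sup>2) ^ m"
proof -
  note [measurable] = cont_meas[OF u(1)] cont_meas[OF h(1)]
  define V where "V = (\<integral>x. u x ^ (2 * m) \<partial>\<mu>)"
  show ?thesis
  proof (cases "V \<le> 0")
    case True
    have "0 \<le> (b + (real m * K)\<^sup>2) ^ m" using b by auto
    then show ?thesis using True unfolding V_def by linarith
  next
    case False
    then have V: "V > 0" by simp
    define U where "U = root (2 * m) V"
    have U: "U > 0" "U ^ (2 * m) = V" using V m by (auto simp: U_def)
    have intV: "integrable \<mu> (\<lambda>x. u x ^ n)" for n
      by (rule integrable_bounded_cont[of _ "N ^ n"])
         (use u u0 N in \<open>auto intro!: continuous_intros power_mono simp: power_abs\<close>)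
    have nnV: "(\<integral>\<^sup>+x. ennreal (u x ^ (2 * m)) \<partial>\<mu>) = ennreal V"
      unfolding V_def by (rule nn_integral_eq_integral[OF intV]) (auto simp: space_eq u0)
    \<comment> \<open>Young's inequality is applied to \<open>(u / U)\<^sup>2\<close> and
      \<open>(h w / K)\<^sup>2\<close>, whose \<open>m\<close>-th powers have integrals at most 1;
      the coefficients \<open>m - 1\<close> and \<open>1\<close> then add up to
      \<open>m\<close>.\<close>
    define c where "c = (real m)\<^sup>2 * U ^ (2 * m - 2) * K\<^sup>2 / real m"
    define c1 where "c1 = c * (real (m - 1) / U ^ (2 * m))"
    define c2 where "c2 = c / K ^ (2 * m)"
    have c: "c \<ge> 0" "c1 \<ge> 0" "c2 \<ge> 0" using U K by (auto simp: c_def c1_def c2_def)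
    have "ennreal (Var \<mu> (\<lambda>x. u x ^ m)) \<le> (\<integral>\<^sup>+x. ennreal ((real m * u x ^ (m - 1) * h x)\<^sup>2 * (w x)\<^sup>2) \<partial>\<mu>)"
    proof (rule Var_le_slope)
      show "slope_le G (\<lambda>x. u x ^ m) (\<lambda>x. real m * u x ^ (m - 1) * h x)"
        by (rule slope_le_power[OF open_G u u0])
      show "\<bar>u x ^ m\<bar> \<le> N ^ m" if "x \<in> G" for x
        using u0[OF that] N[OF that] by (auto simp: power_abs intro: power_mono)
    qed (use u h u0 in \<open>auto intro!: continuous_intros\<close>)
    also have "\<dots> \<le> (\<integral>\<^sup>+x. ennreal c1 * ennreal (u x ^ (2 * m)) + ennreal c2 * ennreal ((h x * w x) ^ (2 * m)) \<partial>\<mu>)"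
    proof (rule nn_integral_mono)
      fix x assume "x \<in> space \<mu>"
      define a where "a = (u x / U)\<^sup>2"
      define k where "k = (h x * w x / K)\<^sup>2"
      have "(real m * u x ^ (m - 1) * h x)\<^sup>2 * (w x)\<^sup>2 = (real m)\<^sup>2 * U ^ (2 * m - 2) * K\<^sup>2 * (a ^ (m - 1) * k)"
      proof -
        have "(u x ^ (m - 1))\<^sup>2 = U ^ (2 * m - 2) * a ^ (m - 1)"
        proof -
          have "2 * m - 2 = 2 * (m - 1)" by simp
          moreover have "u x ^ (m - 1) = U ^ (m - 1) * (u x / U) ^ (m - 1)"
            using U by (simp add: power_divide)
          moreover have "a ^ (m - 1) = ((u x / U) ^ (m - 1))\<^sup>2"
            unfolding a_def by (simp add: mult.commute flip: power_mult)
          ultimately show ?thesis by (simp only: power_even_eq power_mult_distrib)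
        qed
        moreover have "(h x)\<^sup>2 * (w x)\<^sup>2 = K\<^sup>2 * k" using K by (simp add: k_def power_divide power_mult_distrib)
        ultimately show ?thesis by (simp add: power_mult_distrib mult.assoc)
      qed
      also have "\<dots> \<le> (real m)\<^sup>2 * U ^ (2 * m - 2) * K\<^sup>2 * ((real (m - 1) * a ^ m + k ^ m) / real m)"
        using U by (intro mult_left_mono young_power m) (auto simp: a_def k_def)
      also have "\<dots> = c1 * u x ^ (2 * m) + c2 * (h x * w x) ^ (2 * m)"
      proof -
        have "a ^ m = u x ^ (2 * m) / U ^ (2 * m)" "k ^ m = (h x * w x) ^ (2 * m) / K ^ (2 * m)"
          unfolding a_def k_def power_mult[symmetric] by (rule power_divide)+
        then show ?thesis by (simp add: c1_def c2_def c_def add_divide_distrib distrib_left mult_ac)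
      qed
      finally have "ennreal ((real m * u x ^ (m - 1) * h x)\<^sup>2 * (w x)\<^sup>2) \<le>
          ennreal (c1 * u x ^ (2 * m) + c2 * (h x * w x) ^ (2 * m))" by (rule ennreal_leI)
      also have "\<dots> = ennreal c1 * ennreal (u x ^ (2 * m)) + ennreal c2 * ennreal ((h x * w x) ^ (2 * m))"
        using c by (subst ennreal_plus) (auto simp: ennreal_mult)
      finally show "ennreal ((real m * u x ^ (m - 1) * h x)\<^sup>2 * (w x)\<^sup>2) \<le> \<dots>" .
    qed
    also have "\<dots> = ennreal c1 * ennreal V + ennreal c2 * (\<integral>\<^sup>+x. ennreal ((h x * w x) ^ (2 * m)) \<partial>\<mu>)"
      by (simp add: nn_integral_add nn_integral_cmult nnV)
    also have "\<dots> \<le> ennreal c1 * ennreal V + ennreal c2 * ennreal (K ^ (2 * m))"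
      by (intro add_left_mono mult_left_mono K) auto
    also have "\<dots> = ennreal (c1 * V + c2 * K ^ (2 * m))"
      using c V K by (subst ennreal_plus) (auto simp: ennreal_mult)
    also have "c1 * V + c2 * K ^ (2 * m) = (real m)\<^sup>2 * U ^ (2 * m - 2) * K\<^sup>2"
    proof -
      have "c1 * V + c2 * K ^ (2 * m) = c * real (m - 1) + c"
        using U K by (simp add: c1_def c2_def U(2)[symmetric])
      also have "\<dots> = c * real m" using m by (simp add: of_nat_diff algebra_simps)
      finally show ?thesis using m by (simp add: c_def)
    qed
    finally have "Var \<mu> (\<lambda>x. u x ^ m) \<le> (real m)\<^sup>2 * U ^ (2 * m - 2) * K\<^sup>2"
      using U by (subst (asm) ennreal_le_iff) auto
    moreover have "Var \<mu> (\<lambda>x. u x ^ m) = V - (\<integral>x. u x ^ m \<partial>\<mu>)\<^sup>2"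
      by (simp add: Var_def V_def mult.commute flip: power_mult)
    ultimately have main: "U ^ (2 * m) \<le> b ^ m + U ^ (2 * m - 2) * (real m * K)\<^sup>2"
      using b(2) U(2) by (simp add: power_mult_distrib algebra_simps)
    \<comment> \<open>If \<open>b < U\<^sup>2\<close>, then \<open>b^m \<le> U^(2m-2) b\<close> and
      the common factor cancels.\<close>
    have "U\<^sup>2 \<le> b + (real m * K)\<^sup>2"
    proof (cases "U\<^sup>2 \<le> b")
      case True
      then show ?thesis by (smt (verit) zero_le_power2)
    next
      case False
      have e: "2 * m - 2 = 2 * (m - 1)" by simp
      have "b ^ m = b ^ (m - 1) * b" using m by (cases m) auto
      also have "\<dots> \<le> (U\<^sup>2) ^ (m - 1) * b" using False b by (intro mult_right_mono power_mono) auto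
      finally have "b ^ m \<le> U ^ (2 * m - 2) * b" by (simp add: e power_mult)
      moreover have "U ^ (2 * m) = U ^ (2 * m - 2) * U\<^sup>2"
        using m by (cases m) (auto simp: power2_eq_square)
      ultimately have "U ^ (2 * m - 2) * U\<^sup>2 \<le> U ^ (2 * m - 2) * (b + (real m * K)\<^sup>2)"
        using main by (simp add: algebra_simps)
      then show ?thesis using U(1) by (simp add: mult_le_cancel_left_pos)
    qed
    then have "(U\<^sup>2) ^ m \<le> (b + (real m * K)\<^sup>2) ^ m" by (intro power_mono) auto
    then show ?thesis using U(2) by (simp add: V_def power_mult)
  qed
qed

text \<open>Truncation at height \<open>N\<close> and monotone convergence remove boundedness. The
  power is \<open>m = 2 * l\<close>, so \<open>b\<close> bounds the squared norm of order
  \<open>2 * l\<close>, and the square of \<open>b ^ l\<close> is the bound required of the squared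
  mean.\<close>

lemma moment_step:
  assumes u: "continuous_on G u" "slope_le G u h" and h: "continuous_on G h" "\<And>x. x \<in> G \<Longrightarrow> h x \<ge> 0"
    and u0: "\<And>x. x \<in> G \<Longrightarrow> 0 \<le> u x" and l: "l \<ge> 1"
    and b: "b \<ge> 0" "(\<integral>\<^sup>+x. ennreal (u x ^ (2 * l)) \<partial>\<mu>) \<le> ennreal (b ^ l)"
    and K: "K > 0" "(\<integral>\<^sup>+x. ennreal ((h x * w x) ^ (4 * l)) \<partial>\<mu>) \<le> ennreal (K ^ (4 * l))"
  shows "(\<integral>\<^sup>+x. ennreal (u x ^ (4 * l)) \<partial>\<mu>) \<le> ennreal ((b + (2 * real l * K)\<^sup>2) ^ (2 * l))"
proof -
  note [measurable] = cont_meas[OF u(1)] cont_meas[OF h(1)]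
  define v where "v N x = min (u x) (real N)" for N :: nat and x
  have vc: "continuous_on G (v N)" for N unfolding v_def by (intro continuous_intros u)
  have v0: "0 \<le> v N x" if "x \<in> G" for N x using u0[OF that] by (simp add: v_def)
  have intv: "integrable \<mu> (\<lambda>x. v N x ^ n)" for N n
  proof (rule integrable_bounded_cont)
    show "continuous_on G (\<lambda>x. v N x ^ n)" by (intro continuous_on_power vc)
    show "\<bar>v N x ^ n\<bar> \<le> real N ^ n" if "x \<in> G" for x
      using v0[OF that, of N] by (simp add: power_abs power_mono v_def)
  qed
  have nn: "(\<integral>\<^sup>+x. ennreal (v N x ^ n) \<partial>\<mu>) = ennreal (\<integral>x. v N x ^ n \<partial>\<mu>)" for N n
    by (rule nn_integral_eq_integral[OF intv]) (auto simp: space_eq v0)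
  have bound: "(\<integral>\<^sup>+x. ennreal (v N x ^ (4 * l)) \<partial>\<mu>) \<le> ennreal ((b + (2 * real l * K)\<^sup>2) ^ (2 * l))" for N
  proof -
    have "ennreal (\<integral>x. v N x ^ (2 * l) \<partial>\<mu>) \<le> (\<integral>\<^sup>+x. ennreal (u x ^ (2 * l)) \<partial>\<mu>)"
      unfolding nn[symmetric]
      by (intro nn_integral_mono ennreal_leI power_mono) (auto simp: space_eq v_def u0)
    also note b(2)
    finally have 1: "(\<integral>x. v N x ^ (2 * l) \<partial>\<mu>) \<le> b ^ l"
      using b(1) by (subst (asm) ennreal_le_iff) auto
    have "0 \<le> (\<integral>x. v N x ^ (2 * l) \<partial>\<mu>)" by (intro Bochner_Integration.integral_nonneg_AE AE_I2) (auto simp: space_eq v0)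
    then have "(\<integral>x. v N x ^ (2 * l) \<partial>\<mu>)\<^sup>2 \<le> (b ^ l)\<^sup>2" using 1 by (intro power_mono) auto
    then have 2: "(\<integral>x. v N x ^ (2 * l) \<partial>\<mu>)\<^sup>2 \<le> b ^ (2 * l)" by (simp add: power_even_eq)
    have "(\<integral>x. v N x ^ (2 * (2 * l)) \<partial>\<mu>) \<le> (b + (real (2 * l) * K)\<^sup>2) ^ (2 * l)"
    proof (rule bounded_moment_step[OF vc _ h(1) h(2) v0 _ _ b(1) 2 K(1), where N="real N"])
      show "slope_le G (v N) h" unfolding v_def by (rule slope_le_min[OF u(2)])
    qed (use l K(2) in \<open>auto simp: v_def\<close>)
    then show ?thesis unfolding nn by (intro ennreal_leI) simp
  qed
  \<comment> \<open>Setting the functions to 0 off \<open>G\<close> makes them monotone in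
    \<open>N\<close> at every point; \<open>u\<close> is known to be nonnegative on \<open>G\<close>
    only.\<close>
  have inc: "incseq (\<lambda>N x. ennreal (if x \<in> G then v N x ^ (4 * l) else 0))"
    by (auto simp: incseq_def le_fun_def v_def u0 intro!: ennreal_leI power_mono)
  have "(\<integral>\<^sup>+x. ennreal (u x ^ (4 * l)) \<partial>\<mu>) \<le> (\<integral>\<^sup>+x. (SUP N. ennreal (if x \<in> G then v N x ^ (4 * l) else 0)) \<partial>\<mu>)"
  proof (rule nn_integral_mono)
    fix x assume "x \<in> space \<mu>"
    then have x: "x \<in> G" by (simp add: space_eq)
    obtain N where "u x \<le> real N" using real_arch_simple by blast
    then have "ennreal (u x ^ (4 * l)) = ennreal (if x \<in> G then v N x ^ (4 * l) else 0)"
      using x by (simp add: v_def)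
    also have "\<dots> \<le> (SUP N. ennreal (if x \<in> G then v N x ^ (4 * l) else 0))" by (rule SUP_upper) simp
    finally show "ennreal (u x ^ (4 * l)) \<le> \<dots>" .
  qed
  also have "\<dots> = (SUP N. \<integral>\<^sup>+x. ennreal (if x \<in> G then v N x ^ (4 * l) else 0) \<partial>\<mu>)"
  proof (rule nn_integral_monotone_convergence_SUP[OF inc])
    fix N
    have "(\<lambda>x. ennreal (v N x ^ (4 * l))) \<in> borel_measurable \<mu>"
      unfolding v_def by measurable
    then show "(\<lambda>x. ennreal (if x \<in> G then v N x ^ (4 * l) else 0)) \<in> borel_measurable \<mu>"
      by (rule measurable_cong[THEN iffD1, rotated]) (simp add: space_eq)
  qed
  also have "\<dots> = (SUP N. \<integral>\<^sup>+x. ennreal (v N x ^ (4 * l)) \<partial>\<mu>)"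
    by (intro SUP_cong refl nn_integral_cong) (simp add: space_eq)
  also have "\<dots> \<le> ennreal ((b + (2 * real l * K)\<^sup>2) ^ (2 * l))"
    by (intro SUP_least bound)
  finally show ?thesis .
qed

text \<open>The increments \<open>(2 * l * K)\<^sup>2\<close> with \<open>2 * l = 2 ^ Suc i\<close>
  grow by the factor 4, and \<open>1/3 + 1 = 4/3\<close> explains the constant. All lower moments of
  \<open>h w\<close> obey the same \<open>K\<close> by monotonicity of norms.\<close>

lemma dyadic_moment_le:
  assumes u: "continuous_on G u" "slope_le G u h" and h: "continuous_on G h" "\<And>x. x \<in> G \<Longrightarrow> h x \<ge> 0"
    and u0: "\<And>x. x \<in> G \<Longrightarrow> 0 \<le> u x"
    and B: "B \<ge> 0" "(\<integral>\<^sup>+x. ennreal (u x ^ 2) \<partial>\<mu>) \<le> ennreal (B\<^sup>2)"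
    and K: "K > 0" "(\<integral>\<^sup>+x. ennreal ((h x * w x) ^ (2 ^ Suc j)) \<partial>\<mu>) \<le> ennreal (K ^ (2 ^ Suc j))"
  shows "(\<integral>\<^sup>+x. ennreal (u x ^ (2 ^ Suc j)) \<partial>\<mu>) \<le> ennreal ((B\<^sup>2 + (2 ^ Suc j)\<^sup>2 / 3 * K\<^sup>2) ^ (2 ^ j))"
proof -
  have hw: "(\<lambda>x. h x * w x) \<in> borel_measurable \<mu>" using cont_meas[OF h(1)] by measurable
  have "i \<le> j \<Longrightarrow> (\<integral>\<^sup>+x. ennreal (u x ^ (2 ^ Suc i)) \<partial>\<mu>) \<le> ennreal ((B\<^sup>2 + (2 ^ Suc i)\<^sup>2 / 3 * K\<^sup>2) ^ (2 ^ i))" for i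
  proof (induction i)
    case 0
    have "(\<integral>\<^sup>+x. ennreal (u x ^ 2) \<partial>\<mu>) \<le> ennreal (B\<^sup>2 + 2\<^sup>2 / 3 * K\<^sup>2)"
      by (rule order_trans[OF B(2)]) (auto intro!: ennreal_leI)
    then show ?case by simp
  next
    case (Suc i)
    define l where "l = (2 :: nat) ^ i"
    have l: "2 ^ Suc (Suc i) = 4 * l" "2 ^ Suc i = 2 * l" "real l = 2 ^ i" by (auto simp: l_def)
    have "(\<integral>\<^sup>+x. ennreal ((h x * w x) ^ (4 * l)) \<partial>\<mu>) \<le> ennreal (K ^ (4 * l))"
    proof (rule power_moment_mono[OF hw _ _ K(1) _ K(2)])
      show "4 * l \<le> 2 ^ Suc j" using Suc.prems unfolding l(1)[symmetric] by (intro power_increasing) auto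
    qed (auto simp: l_def space_eq h w_nonneg)
    from moment_step[OF u h u0 _ _ _ K(1) this, of "B\<^sup>2 + (2 ^ Suc i)\<^sup>2 / 3 * K\<^sup>2"]
    have "(\<integral>\<^sup>+x. ennreal (u x ^ (4 * l)) \<partial>\<mu>) \<le>
        ennreal ((B\<^sup>2 + (2 ^ Suc i)\<^sup>2 / 3 * K\<^sup>2 + (2 * real l * K)\<^sup>2) ^ (2 * l))"
      using Suc by (simp add: l_def)
    also have "B\<^sup>2 + (2 ^ Suc i)\<^sup>2 / 3 * K\<^sup>2 + (2 * real l * K)\<^sup>2 = B\<^sup>2 + (2 ^ Suc (Suc i))\<^sup>2 / 3 * K\<^sup>2"
      by (simp add: l(3) power_mult_distrib field_simps)
    finally show ?case by (simp only: l(1)) (simp add: l_def)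
  qed
  then show ?thesis by simp
qed

text \<open>This starts the doubling for \<open>f\<close> itself, for which no second moment is
  assumed. Two-sided truncations are bounded, their means tend to the mean 0 of \<open>f\<close> by
  dominated convergence, and Fatou's lemma passes to the limit.\<close>

lemma second_moment_le:
  assumes f: "continuous_on G f" "slope_le G f h" and h: "continuous_on G h" "\<And>x. x \<in> G \<Longrightarrow> h x \<ge> 0"
    and int: "integrable \<mu> f" "(\<integral>x. f x \<partial>\<mu>) = 0"
  shows "(\<integral>\<^sup>+x. ennreal ((f x)\<^sup>2) \<partial>\<mu>) \<le> (\<integral>\<^sup>+x. ennreal ((h x)\<^sup>2 * (w x)\<^sup>2) \<partial>\<mu>)" (is "_ \<le> ?R")
proof -
  note [measurable] = cont_meas[OF f(1)]
  define v where "v N x = min (max (f x) (- real N)) (real N)" for N :: nat and x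
  have vc: "continuous_on G (v N)" for N unfolding v_def by (intro continuous_intros f)
  have [measurable]: "v N \<in> borel_measurable \<mu>" for N by (rule cont_meas[OF vc])
  have vN: "\<bar>v N x\<bar> \<le> real N" for N x by (auto simp: v_def)
  have vf: "\<bar>v N x\<bar> \<le> \<bar>f x\<bar>" for N x by (auto simp: v_def)
  have lim: "(\<lambda>N. v N x) \<longlonglongrightarrow> f x" for x
  proof (rule tendsto_eventually)
    obtain N0 where "\<bar>f x\<bar> \<le> real N0" using real_arch_simple by blast
    then show "eventually (\<lambda>N. v N x = f x) sequentially"
      unfolding eventually_sequentially by (intro exI[of _ N0]) (auto simp: v_def)
  qed
  have "(\<lambda>N. \<integral>x. v N x \<partial>\<mu>) \<longlonglongrightarrow> (\<integral>x. f x \<partial>\<mu>)"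
    by (rule integral_dominated_convergence[where w="\<lambda>x. \<bar>f x\<bar>"])
       (use int lim vf in auto)
  then have lim0: "(\<lambda>N. ?R + ennreal ((\<integral>x. v N x \<partial>\<mu>)\<^sup>2)) \<longlonglongrightarrow> ?R + ennreal (0\<^sup>2)"
    using int(2) by (intro tendsto_add tendsto_const tendsto_ennrealI tendsto_power) simp
  have bd: "(\<integral>\<^sup>+x. ennreal ((v N x)\<^sup>2) \<partial>\<mu>) \<le> ?R + ennreal ((\<integral>x. v N x \<partial>\<mu>)\<^sup>2)" for N
  proof -
    have 1: "ennreal (Var \<mu> (v N)) \<le> ?R"
    proof (rule Var_le_slope[OF vc _ h vN])
      show "slope_le G (v N) h" unfolding v_def by (intro slope_le_min slope_le_max f)
    qed
    have "integrable \<mu> (\<lambda>x. (v N x)\<^sup>2)"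
      by (rule integrable_bounded_cont[of _ "(real N)\<^sup>2"])
         (use vc vN in \<open>auto intro!: continuous_intros simp: abs_le_square_iff[symmetric]\<close>)
    then have 2: "(\<integral>\<^sup>+x. ennreal ((v N x)\<^sup>2) \<partial>\<mu>) = ennreal (\<integral>x. (v N x)\<^sup>2 \<partial>\<mu>)"
      by (rule nn_integral_eq_integral) auto
    \<comment> \<open>\<open>ennreal\<close> sends negative reals to 0; the detour over
      \<open>max 0\<close> spares a proof that the variance is nonnegative.\<close>
    have 3: "ennreal (\<integral>x. (v N x)\<^sup>2 \<partial>\<mu>) \<le> ennreal (Var \<mu> (v N)) + ennreal ((\<integral>x. v N x \<partial>\<mu>)\<^sup>2)"
    proof -
      have "ennreal (\<integral>x. (v N x)\<^sup>2 \<partial>\<mu>) = ennreal (Var \<mu> (v N) + (\<integral>x. v N x \<partial>\<mu>)\<^sup>2)"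
        by (simp add: Var_def)
      also have "\<dots> \<le> ennreal (max 0 (Var \<mu> (v N)) + (\<integral>x. v N x \<partial>\<mu>)\<^sup>2)"
        by (intro ennreal_leI) simp
      also have "\<dots> = ennreal (max 0 (Var \<mu> (v N))) + ennreal ((\<integral>x. v N x \<partial>\<mu>)\<^sup>2)"
        by (rule ennreal_plus) auto
      also have "ennreal (max 0 (Var \<mu> (v N))) = ennreal (Var \<mu> (v N))"
        by (simp add: max_def ennreal_neg)
      finally show ?thesis .
    qed
    show ?thesis unfolding 2 by (rule order_trans[OF 3 add_right_mono[OF 1]])
  qed
  have "(\<integral>\<^sup>+x. ennreal ((f x)\<^sup>2) \<partial>\<mu>) = (\<integral>\<^sup>+x. liminf (\<lambda>N. ennreal ((v N x)\<^sup>2)) \<partial>\<mu>)"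
  proof (rule nn_integral_cong)
    fix x
    have "(\<lambda>N. ennreal ((v N x)\<^sup>2)) \<longlonglongrightarrow> ennreal ((f x)\<^sup>2)"
      by (intro tendsto_ennrealI tendsto_power lim)
    then show "ennreal ((f x)\<^sup>2) = liminf (\<lambda>N. ennreal ((v N x)\<^sup>2))"
      by (rule lim_imp_Liminf[OF sequentially_bot, symmetric])
  qed
  also have "\<dots> \<le> liminf (\<lambda>N. \<integral>\<^sup>+x. ennreal ((v N x)\<^sup>2) \<partial>\<mu>)"
    by (rule nn_integral_liminf) measurable
  also have "\<dots> \<le> liminf (\<lambda>N. ?R + ennreal ((\<integral>x. v N x \<partial>\<mu>)\<^sup>2))"
    by (intro Liminf_mono always_eventually allI bd)
  also have "\<dots> = ?R" using lim_imp_Liminf[OF _ lim0] by simp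
  finally show ?thesis .
qed

end

section \<open>Operator norms of derivative tensors\<close>

lemma finite_lists_length [simp]: "finite {js :: 'n::finite list. length js = k}"
  using finite_lists_length_eq[of "UNIV :: 'n set" k] by simp

lemma C_k_on_iter_partial:
  assumes "C_k_on d G f" "length js + k \<le> d"
  shows "C_k_on k G (iter_partial js f)"
  using assms unfolding C_k_on_def by (simp add: iter_partial_append[symmetric])

lemma C_k_on_deriv_form:
  assumes "open G" "C_k_on d G f" "j + k \<le> d"
  shows "C_k_on j G (\<lambda>x. deriv_form k f x v)"
  unfolding deriv_form_def
  by (intro C_k_on_sum C_k_on_mult C_k_on_const C_k_on_iter_partial[OF assms(2)] assms(1))
     (use assms(3) in auto)

text \<open>The new direction occupies slot 0 because \<open>iter_partial\<close> puts the
  derivative taken last at the head of the list; hence \<open>case_nat\<close>.\<close>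

lemma gradient_deriv_form:
  fixes f :: "real ^ 'n \<Rightarrow> real"
  assumes "open G" "C_k_on d G f" "Suc k \<le> d" "x \<in> G"
  shows "gradient (\<lambda>x. deriv_form k f x v) x \<bullet> \<xi> = deriv_form (Suc k) f x (case_nat \<xi> v)"
proof -
  let ?L = "\<lambda>k. {js :: 'n list. length js = k}"
  let ?P = "\<lambda>js. \<Prod>j<k. v j $ (js ! j)"
  have p: "has_partial (\<lambda>x. deriv_form k f x v) (\<Sum>js\<in>?L k. iter_partial (i # js) f x * ?P js) i x" for i
    unfolding deriv_form_def
  proof (rule DERIV_sum)
    fix js assume "js \<in> ?L k"
    then have "C_k_on (Suc 0) G (iter_partial js f)"
      using assms(2,3) by (intro C_k_on_iter_partial) auto
    from DERIV_cmult_right[OF C_k_on_SucD(2)[OF this assms(4)], of i "?P js"]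
    show "has_partial (\<lambda>x. iter_partial js f x * ?P js) (iter_partial (i # js) f x * ?P js) i x"
      by simp
  qed
  have L: "?L (Suc k) = (\<lambda>(i, js). i # js) ` (UNIV \<times> ?L k)"
    by (auto simp: length_Suc_conv image_iff)
  have "deriv_form (Suc k) f x (case_nat \<xi> v) =
      (\<Sum>(i, js)\<in>UNIV \<times> ?L k. iter_partial (i # js) f x * (\<Prod>j<Suc k. case_nat \<xi> v j $ ((i # js) ! j)))"
    unfolding deriv_form_def L by (subst sum.reindex) (auto simp: inj_on_def case_prod_beta o_def)
  also have "\<dots> = (\<Sum>i\<in>UNIV. \<Sum>js\<in>?L k. iter_partial (i # js) f x * (\<xi> $ i * ?P js))"
    unfolding prod.lessThan_Suc_shift by (simp add: sum.cartesian_product)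
  also have "\<dots> = gradient (\<lambda>x. deriv_form k f x v) x \<bullet> \<xi>"
    unfolding inner_vec_def gradient_def
    by (simp add: has_partial_imp[OF p] sum_distrib_left mult_ac)
  finally show ?thesis by simp
qed

definition unit_tuple :: "nat \<Rightarrow> (nat \<Rightarrow> real ^ 'n) \<Rightarrow> bool" where
  "unit_tuple k v \<longleftrightarrow> (\<forall>j<k. norm (v j) = 1)"

lemma unit_tuple_exists: "\<exists>v :: nat \<Rightarrow> real ^ 'n. unit_tuple k v"
  by (intro exI[of _ "\<lambda>_. axis undefined 1"]) (simp add: unit_tuple_def norm_axis_1)

lemma abs_prod_components_le_1:
  assumes "unit_tuple k v"
  shows "\<bar>\<Prod>j<k. v j $ (js ! j)\<bar> \<le> 1"
  unfolding abs_prod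
proof (rule prod_le_1)
  fix j assume "j \<in> {..<k}"
  then show "0 \<le> \<bar>v j $ (js ! j)\<bar> \<and> \<bar>v j $ (js ! j)\<bar> \<le> 1"
    using assms component_le_norm_cart[of "v j" "js ! j"] by (simp add: unit_tuple_def)
qed

lemma deriv_form_diff_le:
  assumes "unit_tuple k v"
  shows "deriv_form k f x v \<le> deriv_form k f y v +
    (\<Sum>js | length js = k. \<bar>iter_partial js f x - iter_partial js f y\<bar>)"
proof -
  have "deriv_form k f x v - deriv_form k f y v =
      (\<Sum>js | length js = k. (iter_partial js f x - iter_partial js f y) * (\<Prod>j<k. v j $ (js ! j)))"
    unfolding deriv_form_def by (simp add: sum_subtractf left_diff_distrib)
  also have "\<dots> \<le> (\<Sum>js | length js = k. \<bar>iter_partial js f x - iter_partial js f y\<bar>)"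
  proof (rule sum_mono)
    fix js
    have "(iter_partial js f x - iter_partial js f y) * (\<Prod>j<k. v j $ (js ! j)) \<le>
        \<bar>iter_partial js f x - iter_partial js f y\<bar> * \<bar>\<Prod>j<k. v j $ (js ! j)\<bar>"
      by (metis abs_ge_self abs_mult)
    also have "\<dots> \<le> \<bar>iter_partial js f x - iter_partial js f y\<bar> * 1"
      by (intro mult_left_mono abs_prod_components_le_1 assms) simp
    finally show "(iter_partial js f x - iter_partial js f y) * (\<Prod>j<k. v j $ (js ! j)) \<le>
        \<bar>iter_partial js f x - iter_partial js f y\<bar>" by simp
  qed
  finally show ?thesis by simp
qed

lemma op_norm_eq: "op_norm k f x = Sup {deriv_form k f x v |v. unit_tuple k v}"
  by (simp add: op_norm_def unit_tuple_def)

lemma op_norm_le: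
  assumes "\<And>v. unit_tuple k v \<Longrightarrow> deriv_form k f x v \<le> c"
  shows "op_norm k f x \<le> c"
  unfolding op_norm_eq using unit_tuple_exists[of k] by (intro cSup_least) (auto intro: assms)

lemma deriv_form_le_op_norm:
  assumes "unit_tuple k v"
  shows "deriv_form k f x v \<le> op_norm k f x"
  unfolding op_norm_eq
proof (rule cSup_upper)
  show "deriv_form k f x v \<in> {deriv_form k f x v |v. unit_tuple k v}" using assms by blast
  have "deriv_form k f x v \<le> (\<Sum>js | length js = k. \<bar>iter_partial js f x\<bar>)" if "unit_tuple k v" for v
  proof -
    have "deriv_form k f x v \<le> (\<Sum>js | length js = k. \<bar>iter_partial js f x * (\<Prod>j<k. v j $ (js ! j))\<bar>)"
      unfolding deriv_form_def by (intro sum_mono) simp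
    also have "\<dots> \<le> (\<Sum>js | length js = k. \<bar>iter_partial js f x\<bar>)"
      unfolding abs_mult by (intro sum_mono mult_left_le abs_prod_components_le_1 that) simp
    finally show ?thesis .
  qed
  then show "bdd_above {deriv_form k f x v |v. unit_tuple k v}"
    unfolding bdd_above_def by blast
qed

text \<open>At order 0 no absolute value appears, so \<open>slope_le_op_norm\<close> with
  \<open>k = 0\<close> speaks of \<open>f\<close> itself.\<close>

lemma op_norm_0: "op_norm 0 f x = f x"
  by (simp add: op_norm_def deriv_form_def)

text \<open>Reversing one argument reverses the sign of the form, which takes at least one
  argument.\<close>

lemma op_norm_nonneg:
  assumes "k \<ge> 1" shows "op_norm k f x \<ge> 0"
proof -
  obtain v :: "nat \<Rightarrow> real ^ 'a" where v: "unit_tuple k v" using unit_tuple_exists by blast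
  define v' where "v' = v(0 := - v 0)"
  have v': "unit_tuple k v'" using v by (auto simp: unit_tuple_def v'_def)
  obtain k' where k': "k = Suc k'" using assms by (cases k) auto
  have "(\<Prod>j<k. v' j $ (js ! j)) = - (\<Prod>j<k. v j $ (js ! j))" for js
    unfolding k' prod.lessThan_Suc_shift by (simp add: v'_def)
  then have "deriv_form k f x v' = - deriv_form k f x v"
    unfolding deriv_form_def by (simp add: sum_negf)
  then show ?thesis using deriv_form_le_op_norm[OF v, of f x] deriv_form_le_op_norm[OF v', of f x] by simp
qed

text \<open>A supremum moves no more than its members do uniformly, and components of unit vectors
  are at most 1 in absolute value. This yields continuity.\<close>

lemma op_norm_diff_le:
  "\<bar>op_norm k f x - op_norm k f y\<bar> \<le> (\<Sum>js | length js = k. \<bar>iter_partial js f x - iter_partial js f y\<bar>)"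
proof -
  have "op_norm k f x \<le> op_norm k f y + (\<Sum>js | length js = k. \<bar>iter_partial js f x - iter_partial js f y\<bar>)" for x y
  proof (rule op_norm_le)
    fix v :: "nat \<Rightarrow> real ^ 'a" assume v: "unit_tuple k v"
    show "deriv_form k f x v \<le> op_norm k f y + (\<Sum>js | length js = k. \<bar>iter_partial js f x - iter_partial js f y\<bar>)"
      using deriv_form_diff_le[OF v, of f x y] deriv_form_le_op_norm[OF v, of f y] by linarith
  qed
  from this[of x y] this[of y x] show ?thesis by (simp add: abs_minus_commute)
qed

lemma continuous_on_op_norm:
  assumes "C_k_on d G f" "k \<le> d"
  shows "continuous_on G (op_norm k f)"
  unfolding continuous_on_def
proof
  fix x assume x: "x \<in> G"
  have "((\<lambda>y. \<Sum>js | length js = k. \<bar>iter_partial js f y - iter_partial js f x\<bar>) \<longlongrightarrow>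
      (\<Sum>js\<in>{js. length js = k}. \<bar>iter_partial js f x - iter_partial js f x\<bar>)) (at x within G)"
  proof (intro tendsto_sum tendsto_rabs tendsto_diff tendsto_const)
    fix js :: "'a list" assume "js \<in> {js. length js = k}"
    then have "continuous_on G (iter_partial js f)" using assms by (simp add: C_k_on_def)
    then show "(iter_partial js f \<longlongrightarrow> iter_partial js f x) (at x within G)"
      using x by (simp add: continuous_on_def)
  qed
  then have "((\<lambda>y. \<Sum>js | length js = k. \<bar>iter_partial js f y - iter_partial js f x\<bar>) \<longlongrightarrow> 0) (at x within G)"
    by simp
  then have "((\<lambda>y. op_norm k f y - op_norm k f x) \<longlongrightarrow> 0) (at x within G)"
    by (rule Lim_null_comparison[rotated]) (simp add: op_norm_diff_le)
  then show "(op_norm k f \<longlongrightarrow> op_norm k f x) (at x within G)" by (rule LIM_zero_cancel)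
qed

text \<open>For fixed unit arguments the form of order \<open>k\<close> has directional derivatives
  given by the form of order \<open>Suc k\<close>, hence the Lipschitz constant \<open>B\<close> on
  a small ball; the bound is uniform in the arguments and survives the supremum.\<close>

lemma slope_le_op_norm:
  fixes f :: "real ^ 'n \<Rightarrow> real"
  assumes G: "open G" and f: "C_k_on d G f" and k: "Suc k \<le> d"
  shows "slope_le G (op_norm k f) (op_norm (Suc k) f)"
  unfolding slope_le_def
proof (intro ballI allI impI)
  fix x e assume x: "x \<in> G" and e: "(e :: real) > 0"
  obtain r1 where r1: "r1 > 0" "ball x r1 \<subseteq> G" using G x openE by blast
  have "isCont (op_norm (Suc k) f) x"
    using continuous_on_op_norm[OF f k] G x by (simp add: continuous_on_eq_continuous_at)
  then obtain r2 where r2: "r2 > 0"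
      "\<And>y. dist y x < r2 \<Longrightarrow> dist (op_norm (Suc k) f y) (op_norm (Suc k) f x) < e"
    using e unfolding continuous_at_eps_delta by meson
  define r where "r = min r1 r2"
  define B where "B = op_norm (Suc k) f x + e"
  have r: "r > 0" "ball x r \<subseteq> G" using r1 r2 by (auto simp: r_def)
  have B: "op_norm (Suc k) f y \<le> B" if "y \<in> ball x r" for y
    using r2(2)[of y] that by (auto simp: r_def B_def dist_real_def dist_commute abs_if split: if_splits)
  have lip: "\<bar>deriv_form k f y v - deriv_form k f z v\<bar> \<le> B * dist y z"
    if yz: "y \<in> ball x r" "z \<in> ball x r" and v: "unit_tuple k v" for y z v
  proof -
    have "norm (deriv_form k f y v - deriv_form k f z v) \<le> B * norm (y - z)"
    proof (rule differentiable_bound[of "ball x r" "\<lambda>x. deriv_form k f x v"])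
      fix \<xi> assume \<xi>: "\<xi> \<in> ball x r"
      then have \<xi>G: "\<xi> \<in> G" using r by blast
      have "C_k_on (Suc 0) G (\<lambda>x. deriv_form k f x v)" using C_k_on_deriv_form[OF G f] k by simp
      from C_1_has_derivative[OF G this \<xi>G]
      show "((\<lambda>x. deriv_form k f x v) has_derivative (\<lambda>h. gradient (\<lambda>x. deriv_form k f x v) \<xi> \<bullet> h)) (at \<xi> within ball x r)"
        by (rule has_derivative_at_withinI)
      have le: "gradient (\<lambda>x. deriv_form k f x v) \<xi> \<bullet> h \<le> B * norm h" for h
      proof (cases "h = 0")
        case False
        define u where "u = h /\<^sub>R norm h"
        have "unit_tuple (Suc k) (case_nat u v)"
          using v False by (auto simp: unit_tuple_def u_def split: nat.split)
        from deriv_form_le_op_norm[OF this, of f \<xi>]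
        have "gradient (\<lambda>x. deriv_form k f x v) \<xi> \<bullet> u \<le> B"
          using gradient_deriv_form[OF G f k \<xi>G, of v u] B[OF \<xi>] by simp
        then have "norm h * (gradient (\<lambda>x. deriv_form k f x v) \<xi> \<bullet> u) \<le> norm h * B"
          by (rule mult_left_mono) simp
        moreover have "norm h * (gradient (\<lambda>x. deriv_form k f x v) \<xi> \<bullet> u) =
            gradient (\<lambda>x. deriv_form k f x v) \<xi> \<bullet> h"
          using False by (simp add: u_def)
        ultimately show ?thesis by (simp add: mult.commute)
      qed simp
      show "onorm (\<lambda>h. gradient (\<lambda>x. deriv_form k f x v) \<xi> \<bullet> h) \<le> B"
      proof (rule onorm_le)
        fix h show "norm (gradient (\<lambda>x. deriv_form k f x v) \<xi> \<bullet> h) \<le> B * norm h"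
          using le[of h] le[of "- h"] by (simp add: abs_le_iff)
      qed
    qed (use yz in auto)
    then show ?thesis by (simp add: dist_norm)
  qed
  have "op_norm k f y \<le> op_norm k f z + B * dist y z" if "y \<in> ball x r" "z \<in> ball x r" for y z
  proof (rule op_norm_le)
    fix v :: "nat \<Rightarrow> real ^ 'n" assume v: "unit_tuple k v"
    show "deriv_form k f y v \<le> op_norm k f z + B * dist y z"
      using lip[OF that v] deriv_form_le_op_norm[OF v, of f z] by linarith
  qed
  then have "\<bar>op_norm k f y - op_norm k f z\<bar> \<le> B * dist y z" if "y \<in> ball x r" "z \<in> ball x r" for y z
    using that by (smt (verit, best) dist_commute)
  then show "\<exists>r>0. \<forall>y\<in>ball x r. \<forall>z\<in>ball x r.
      \<bar>op_norm k f y - op_norm k f z\<bar> \<le> (op_norm (Suc k) f x + e) * dist y z"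
    using r(1) unfolding B_def by blast
qed

section \<open>Higher order concentration\<close>

text \<open>Cauchy-Schwarz separates \<open>h\<close> from \<open>w\<close> at the price of doubling
  the exponent, so order \<open>Suc k\<close> enters with \<open>2 ^ Suc k * q\<close>. The assumed
  second moment of order \<open>k\<close> gives the summand 1.\<close>

lemma (in weighted_poincare_space) moment_recursion:
  fixes f :: "real ^ 'n \<Rightarrow> real" and j :: nat
  defines "q \<equiv> 2 ^ Suc j"
  assumes f: "C_k_on d G f" and k: "1 \<le> k" "k < d" and C: "C > 0" and S: "S > 0"
    and w: "(\<integral>\<^sup>+x. ennreal (w x ^ (2 ^ d * q)) \<partial>\<mu>) \<le> ennreal (C ^ (2 ^ d * q))"
    and B: "(\<integral>\<^sup>+x. ennreal ((op_norm k f x)\<^sup>2) \<partial>\<mu>) \<le> 1"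
    and IH: "(\<integral>\<^sup>+x. ennreal (op_norm (Suc k) f x ^ (2 ^ Suc k * q)) \<partial>\<mu>) \<le> ennreal (S ^ (2 ^ Suc k * q))"
  shows "(\<integral>\<^sup>+x. ennreal (op_norm k f x ^ (2 ^ k * q)) \<partial>\<mu>)
    \<le> ennreal ((1 + real q * C * 2 ^ k * S) ^ (2 ^ k * q))"
proof -
  let ?u = "op_norm k f" and ?h = "op_norm (Suc k) f"
  define Q where "Q = (2 :: nat) ^ Suc (k + j)"
  have Q: "2 ^ k * q = Q" "2 ^ Suc k * q = 2 * Q" "2 * 2 ^ (k + j) = Q" by (auto simp: q_def Q_def power_add)
  have uc: "continuous_on G ?u" and hc: "continuous_on G ?h"
    using k by (auto intro!: continuous_on_op_norm[OF f])
  have sl: "slope_le G ?u ?h" using k by (intro slope_le_op_norm[OF open_G f]) simp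
  have wQ: "(\<integral>\<^sup>+x. ennreal (w x ^ (2 * Q)) \<partial>\<mu>) \<le> ennreal (C ^ (2 * Q))"
  proof (rule power_moment_mono[OF w_measurable _ _ C _ w])
    have "2 ^ Suc k * q \<le> 2 ^ d * q" using k by (intro mult_right_mono power_increasing) auto
    then show "2 * Q \<le> 2 ^ d * q" by (simp only: Q)
  qed (auto simp: Q_def space_eq w_nonneg)
  have K: "(\<integral>\<^sup>+x. ennreal ((?h x * w x) ^ Q) \<partial>\<mu>) \<le> ennreal ((S * C) ^ Q)"
    using IH wQ by (intro product_moment_le cont_meas hc w_measurable S C) (simp_all only: Q)
  have B1: "(\<integral>\<^sup>+x. ennreal (?u x ^ 2) \<partial>\<mu>) \<le> ennreal (1\<^sup>2)" using B by simp
  have "(\<integral>\<^sup>+x. ennreal (?u x ^ Q) \<partial>\<mu>) \<le> ennreal ((1\<^sup>2 + (2 ^ Suc (k + j))\<^sup>2 / 3 * (S * C)\<^sup>2) ^ (2 ^ (k + j)))"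
    unfolding Q_def
    by (rule dyadic_moment_le[OF uc sl hc _ _ _ B1 _ K[unfolded Q_def]])
       (use k S C in \<open>auto intro: op_norm_nonneg\<close>)
  \<comment> \<open>\<open>1 + y\<^sup>2/3 \<le> (1 + y)\<^sup>2\<close> for
    \<open>y = Q S C\<close>: an affine recursion is easier to unroll than one with square
    roots.\<close>
  also have "\<dots> \<le> ennreal (((1 + real Q * (S * C))\<^sup>2) ^ (2 ^ (k + j)))"
  proof (intro ennreal_leI power_mono)
    have "real Q = 2 ^ Suc (k + j)" by (simp add: Q_def)
    moreover have "0 \<le> real Q * (S * C)" using S C by simp
    ultimately show "1\<^sup>2 + (2 ^ Suc (k + j))\<^sup>2 / 3 * (S * C)\<^sup>2 \<le> (1 + real Q * (S * C))\<^sup>2"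
      unfolding power2_sum power_mult_distrib[symmetric] times_divide_eq_left
      using zero_le_power2[of "real Q * (S * C)"] by (simp add: power_mult_distrib)
  qed auto
  also have "((1 + real Q * (S * C))\<^sup>2) ^ (2 ^ (k + j)) = (1 + real Q * (S * C)) ^ Q"
    unfolding power_mult[symmetric] Q(3) ..
  also have "real Q * (S * C) = real q * C * 2 ^ k * S"
    unfolding Q(1)[symmetric] by simp
  finally show ?thesis by (simp only: Q)
qed

text \<open>At the last level the second moment of \<open>f\<close> comes from the Poincare
  inequality and the mean 0. It is bounded in terms of \<open>K\<close> rather than by 1, so both
  terms combine into one without a summand 1.\<close>

lemma (in weighted_poincare_space) centered_moment_le:
  fixes f :: "real ^ 'n \<Rightarrow> real" and j :: nat
  defines "q \<equiv> 2 ^ Suc j"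
  assumes d: "d \<ge> 1" and f: "C_k_on d G f" "integrable \<mu> f" "(\<integral>x. f x \<partial>\<mu>) = 0" and C: "C > 0" and S: "S > 0"
    and w: "(\<integral>\<^sup>+x. ennreal (w x ^ (2 ^ d * q)) \<partial>\<mu>) \<le> ennreal (C ^ (2 ^ d * q))"
    and IH: "(\<integral>\<^sup>+x. ennreal (op_norm 1 f x ^ (2 * q)) \<partial>\<mu>) \<le> ennreal (S ^ (2 * q))"
  shows "(\<integral>\<^sup>+x. ennreal (\<bar>f x\<bar> ^ q) \<partial>\<mu>) \<le> ennreal ((real q * C * S) ^ q)"
proof -
  let ?h = "op_norm 1 f"
  have q: "2 * 2 ^ j = q" "real q = 2 ^ Suc j" "real q \<ge> 2" by (auto simp: q_def)
  have fc: "continuous_on G f" by (rule C_k_on_imp_continuous_on[OF f(1)])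
  have hc: "continuous_on G ?h" using d by (intro continuous_on_op_norm[OF f(1)])
  have "op_norm 0 f = f" by (rule ext) (rule op_norm_0)
  then have sl: "slope_le G f ?h" using slope_le_op_norm[OF open_G f(1), of 0] d by simp
  have h0: "0 \<le> ?h x" for x by (rule op_norm_nonneg) simp
  have wQ: "(\<integral>\<^sup>+x. ennreal (w x ^ (2 * q)) \<partial>\<mu>) \<le> ennreal (C ^ (2 * q))"
  proof (rule power_moment_mono[OF w_measurable _ _ C _ w])
    have "2 ^ 1 * q \<le> 2 ^ d * q" using d by (intro mult_right_mono power_increasing) auto
    then show "2 * q \<le> 2 ^ d * q" by simp
  qed (auto simp: q_def space_eq w_nonneg)
  define K where "K = S * C"
  have K0: "K > 0" using S C by (simp add: K_def)
  have hw: "(\<lambda>x. ?h x * w x) \<in> borel_measurable \<mu>" using cont_meas[OF hc] by measurable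
  have K: "(\<integral>\<^sup>+x. ennreal ((?h x * w x) ^ q) \<partial>\<mu>) \<le> ennreal (K ^ q)"
    unfolding K_def by (intro product_moment_le cont_meas hc w_measurable S C IH wQ)
  have K2: "(\<integral>\<^sup>+x. ennreal ((?h x * w x) ^ 2) \<partial>\<mu>) \<le> ennreal (K ^ 2)"
    by (rule power_moment_mono[OF hw _ _ K0 _ K])
       (auto simp: q_def space_eq intro!: mult_nonneg_nonneg op_norm_nonneg w_nonneg)
  have "(\<integral>\<^sup>+x. ennreal ((f x)\<^sup>2) \<partial>\<mu>) \<le> (\<integral>\<^sup>+x. ennreal ((?h x)\<^sup>2 * (w x)\<^sup>2) \<partial>\<mu>)"
    by (rule second_moment_le[OF fc sl hc h0 f(2,3)])
  then have f2: "(\<integral>\<^sup>+x. ennreal (\<bar>f x\<bar>\<^sup>2) \<partial>\<mu>) \<le> ennreal (K\<^sup>2)"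
    using K2 by (simp add: power_mult_distrib)
  have "(\<integral>\<^sup>+x. ennreal (\<bar>f x\<bar> ^ q) \<partial>\<mu>) \<le> ennreal ((K\<^sup>2 + (2 ^ Suc j)\<^sup>2 / 3 * K\<^sup>2) ^ (2 ^ j))"
    unfolding q_def
    by (rule dyadic_moment_le[OF _ slope_le_abs[OF sl] hc h0 _ _ f2 K0 K[unfolded q_def]])
       (use fc K0 in \<open>auto intro!: continuous_intros\<close>)
  \<comment> \<open>\<open>1 + q\<^sup>2/3 \<le> q\<^sup>2\<close> because
    \<open>q \<ge> 2\<close>.\<close>
  also have "\<dots> \<le> ennreal (((real q * K)\<^sup>2) ^ (2 ^ j))"
  proof (intro ennreal_leI power_mono)
    have "2\<^sup>2 \<le> (real q)\<^sup>2" using q(3) by (intro power_mono) auto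
    then have "(1 + (real q)\<^sup>2 / 3) * K\<^sup>2 \<le> (real q)\<^sup>2 * K\<^sup>2" by (intro mult_right_mono) auto
    then show "K\<^sup>2 + (2 ^ Suc j)\<^sup>2 / 3 * K\<^sup>2 \<le> (real q * K)\<^sup>2"
      unfolding q(2) by (simp add: power_mult_distrib algebra_simps)
  qed auto
  also have "((real q * K)\<^sup>2) ^ (2 ^ j) = (real q * C * S) ^ q"
    unfolding power_mult[symmetric] q(1) K_def by (simp add: mult_ac)
  finally show ?thesis .
qed

text \<open>The coefficients \<open>a\<^sup>k 2\<^bsup>k(k-1)/2\<^esup>\<close> in the unrolled recursion \<open>A\<^sub>k = 1 + a 2\<^sup>k A\<^sub>k\<^sub>+\<^sub>1\<close> for the moment bounds.\<close>

primrec recursion_coeff :: "real \<Rightarrow> nat \<Rightarrow> real" where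
  "recursion_coeff a 0 = 1"
| "recursion_coeff a (Suc k) = recursion_coeff a k * (a * 2 ^ k)"

lemma recursion_coeff_pos: "a > 0 \<Longrightarrow> recursion_coeff a k > 0"
  by (induction k) auto

text \<open>Squaring avoids half-integral exponents: the square of the coefficient is
  \<open>a^(2k) 2^(k(k-1))\<close>, and \<open>k - 1 \<le> d - 1\<close> bounds it by a power of
  \<open>Y\<^sup>2\<close>.\<close>

lemma recursion_coeff_le:
  assumes "a \<ge> 0" "Y \<ge> 0" "k \<le> d" "Y\<^sup>2 = a\<^sup>2 * 2 ^ (d - 1)"
  shows "recursion_coeff a k \<le> Y ^ k"
proof (rule power2_le_imp_le)
  have "(recursion_coeff a k)\<^sup>2 = (a\<^sup>2) ^ k * 2 ^ (k * (k - 1))"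
  proof (induction k)
    case (Suc k)
    have e: "Suc k * (Suc k - 1) = k * (k - 1) + 2 * k" by (cases k) auto
    show ?case unfolding e power_add recursion_coeff.simps power_mult_distrib Suc
      by (simp add: mult_ac flip: power_mult)
  qed simp
  also have "\<dots> \<le> (a\<^sup>2) ^ k * 2 ^ (k * (d - 1))"
    using assms by (intro mult_left_mono power_increasing mult_left_mono) auto
  also have "\<dots> = (Y ^ k)\<^sup>2"
    using assms(4) by (metis mult.commute power_mult power_mult_distrib)
  finally show "(recursion_coeff a k)\<^sup>2 \<le> (Y ^ k)\<^sup>2" .
qed (use assms in simp)

text \<open>A geometric sum dominated by its last term; it is applied to \<open>Y = q X\<close>,
  where \<open>q \<ge> 2\<close> and \<open>X \<ge> 1\<close> supply the hypothesis.\<close>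

lemma sum_powers_le:
  fixes Y :: real
  assumes "Y \<ge> 2"
  shows "(\<Sum>i=1..d. Y ^ i) \<le> 2 * Y ^ d"
proof (induction d)
  case (Suc d)
  have "2 * Y ^ d \<le> Y * Y ^ d" using assms by (intro mult_right_mono) auto
  with Suc show ?case by simp
qed simp

lemma (in weighted_poincare_space) higher_order_moment_le:
  fixes f :: "real ^ 'n \<Rightarrow> real" and j :: nat
  defines "q \<equiv> 2 ^ Suc j"
  assumes d: "d \<ge> 1" and f: "C_k_on d G f" "integrable \<mu> f" "(\<integral>x. f x \<partial>\<mu>) = 0"
    and C: "C > 0" and X: "X \<ge> 1" "X\<^sup>2 = C\<^sup>2 * 2 ^ (d - 1)"
    and w: "(\<integral>\<^sup>+x. ennreal (w x ^ (2 ^ d * q)) \<partial>\<mu>) \<le> ennreal (C ^ (2 ^ d * q))"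
    and B: "\<And>k. 1 \<le> k \<Longrightarrow> k < d \<Longrightarrow> (\<integral>\<^sup>+x. ennreal ((op_norm k f x)\<^sup>2) \<partial>\<mu>) \<le> 1"
    and top: "AE x in \<mu>. op_norm d f x \<le> 1"
  shows "(\<integral>\<^sup>+x. ennreal (\<bar>f x\<bar> ^ q) \<partial>\<mu>) \<le> ennreal (((2 * real q * X) ^ d) ^ q)"
proof -
  define b where "b = recursion_coeff (real q * C)"
  \<comment> \<open>The solution of the recursion with end value \<open>S d = 1\<close>: a tail sum
    of the coefficients divided by \<open>b k\<close>, so that \<open>Srec\<close> is an
    identity.\<close>
  define S where "S k = (\<Sum>i=k..d. b i) / b k" for k
  have q: "real q \<ge> 2" by (simp add: q_def)
  have b: "b i > 0" for i using C q unfolding b_def by (intro recursion_coeff_pos) simp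
  have S: "S k > 0" if "k \<le> d" for k
    unfolding S_def using that b by (intro divide_pos_pos sum_pos) auto
  have Srec: "S k = 1 + real q * C * 2 ^ k * S (Suc k)" if "k < d" for k
  proof -
    have "(\<Sum>i=k..d. b i) = b k + (\<Sum>i=Suc k..d. b i)" using that by (simp add: sum.atLeast_Suc_atMost)
    moreover have "b (Suc k) = b k * (real q * C * 2 ^ k)" by (simp add: b_def)
    ultimately show ?thesis using b[of k] C q by (simp add: S_def field_simps)
  qed
  \<comment> \<open>Downward induction from order \<open>d\<close>, where the norm is almost
    everywhere at most 1, to order 1.\<close>
  have "(\<integral>\<^sup>+x. ennreal (op_norm 1 f x ^ (2 ^ 1 * q)) \<partial>\<mu>) \<le> ennreal (S 1 ^ (2 ^ 1 * q))"
    using d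
  proof (induction rule: inc_induct)
    case base
    have "(\<integral>\<^sup>+x. ennreal (op_norm d f x ^ (2 ^ d * q)) \<partial>\<mu>) \<le> (\<integral>\<^sup>+x. 1 \<partial>\<mu>)"
      using top by (intro nn_integral_mono_AE, elim eventually_mono)
        (use d in \<open>auto intro!: power_le_one op_norm_nonneg\<close>)
    also have "\<dots> = 1" by (simp add: emeasure_space_1)
    also have "1 = ennreal (S d ^ (2 ^ d * q))" using b[of d] by (simp add: S_def)
    finally show ?case .
  next
    case (step k)
    have "(\<integral>\<^sup>+x. ennreal (op_norm k f x ^ (2 ^ k * q)) \<partial>\<mu>)
        \<le> ennreal ((1 + real q * C * 2 ^ k * S (Suc k)) ^ (2 ^ k * q))"
      unfolding q_def
      by (rule moment_recursion[OF f(1) step(1,2) C S w[unfolded q_def] B[OF step(1,2)] step(3)[unfolded q_def]])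
         (use step in simp)
    then show ?case using Srec[OF step(2)] by simp
  qed
  then have "(\<integral>\<^sup>+x. ennreal (op_norm 1 f x ^ (2 * q)) \<partial>\<mu>) \<le> ennreal (S 1 ^ (2 * q))" by simp
  from centered_moment_le[OF d f C S[OF d] w[unfolded q_def] this[unfolded q_def]]
  have "(\<integral>\<^sup>+x. ennreal (\<bar>f x\<bar> ^ q) \<partial>\<mu>) \<le> ennreal ((real q * C * S 1) ^ q)" by (simp only: q_def)
  also have "\<dots> \<le> ennreal (((2 * real q * X) ^ d) ^ q)"
  \<comment> \<open>Since \<open>b 1 = q C\<close>, the factor in front turns \<open>S 1\<close>
    into the plain sum of the coefficients, which is at most
    \<open>2 (q X)^d \<le> (2 q X)^d\<close>.\<close>
  proof (intro ennreal_leI power_mono)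
    have Y: "real q * X \<ge> 2" using mult_mono[of 2 "real q" 1 X] q X by simp
    have "real q * C * S 1 = (\<Sum>i=1..d. b i)"
      using C q by (simp add: S_def b_def)
    also have "\<dots> \<le> (\<Sum>i=1..d. (real q * X) ^ i)"
      unfolding b_def using C X q
      by (intro sum_mono recursion_coeff_le[where d=d]) (auto simp: power_mult_distrib)
    also have "\<dots> \<le> 2 * (real q * X) ^ d" by (rule sum_powers_le[OF Y])
    also have "\<dots> \<le> 2 ^ d * (real q * X) ^ d"
      using d Y power_increasing[of 1 d "2::real"] by (intro mult_right_mono) auto
    finally show "real q * C * S 1 \<le> (2 * real q * X) ^ d" by (simp add: power_mult_distrib)
    show "0 \<le> real q * C * S 1" using C S[OF d] by simp
  qed
  finally show ?thesis .
qed

section \<open>From moment bounds to tail bounds\<close>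

lemma Lq_norm_leD:
  assumes "Lq_norm M q g \<le> ennreal C" "C \<ge> 0" "q > 0"
  shows "(\<integral>\<^sup>+x. ennreal (\<bar>g x\<bar> powr q) \<partial>M) \<le> ennreal (C powr q)"
proof -
  let ?I = "\<integral>\<^sup>+x. ennreal (\<bar>g x\<bar> powr q) \<partial>M"
  have fin: "?I \<noteq> \<infinity>" using assms(1) by (auto simp: Lq_norm_def top_unique)
  then have "enn2real ?I powr (1 / q) \<le> C"
    using assms(1,2) by (simp add: Lq_norm_def ennreal_le_iff)
  then have "(enn2real ?I powr (1 / q)) powr q \<le> C powr q"
    using assms by (intro powr_mono2) auto
  then have "enn2real ?I \<le> C powr q" using assms(3) by (simp add: powr_powr)
  then show ?thesis using fin by (metis ennreal_enn2real ennreal_leI infinity_ennreal_def less_top)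
qed

lemma (in prob_space) markov_power:
  assumes [measurable]: "f \<in> borel_measurable M" and A: "A \<ge> 0" and t: "t > 0"
    and le: "(\<integral>\<^sup>+x. ennreal (\<bar>f x\<bar> ^ n) \<partial>M) \<le> ennreal (A ^ n)"
  shows "prob {x \<in> space M. \<bar>f x\<bar> \<ge> t} \<le> (A / t) ^ n"
proof -
  let ?E = "{x \<in> space M. \<bar>f x\<bar> \<ge> t}"
  have "ennreal (t ^ n * prob ?E) = (\<integral>\<^sup>+x. ennreal (t ^ n) * indicator ?E x \<partial>M)"
    using t by (simp add: nn_integral_cmult_indicator emeasure_eq_measure ennreal_mult)
  also have "\<dots> \<le> (\<integral>\<^sup>+x. ennreal (\<bar>f x\<bar> ^ n) \<partial>M)"
    by (intro nn_integral_mono) (use t in \<open>auto simp: indicator_def intro!: ennreal_leI power_mono\<close>)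
  also note le
  finally have "t ^ n * prob ?E \<le> A ^ n" using A by (subst (asm) ennreal_le_iff) auto
  then show ?thesis using t by (simp add: power_divide field_simps)
qed

text \<open>For \<open>y = e q\<close> the claim reduces to \<open>(y - 1)/e \<le> 2 ln y\<close>,
  which follows from \<open>ln y \<ge> 1 - 1/y\<close> and \<open>y \<le> 2 e\<close>. It serves the
  range where Markov's inequality is used with second moments.\<close>

lemma small_exponent_tail:
  assumes "1 / exp 1 \<le> q" "q \<le> (2 :: real)"
  shows "(1 / (2 * exp 1 * q))\<^sup>2 \<le> exp (1 / exp 1 - q)"
proof -
  have "0 < 1 / exp (1 :: real)" by simp
  then have q: "q > 0" using assms(1) by linarith
  define y where "y = exp 1 * q"
  have y: "y \<ge> 1" "y \<le> 2 * exp 1" using assms by (auto simp: y_def field_simps)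
  have "(y - 1) / (2 * exp 1) \<le> (y - 1) / y" using y by (intro divide_left_mono) auto
  also have "\<dots> \<le> ln y"
    using ln_le_minus_one[of "1 / y"] y by (simp add: ln_div field_simps)
  finally have "(y - 1) / exp 1 \<le> 2 * ln y" by (simp add: field_simps)
  moreover have "(y - 1) / exp 1 = q - 1 / exp 1" by (simp add: y_def field_simps)
  ultimately have l: "- (2 * ln y) \<le> 1 / exp 1 - q" by simp
  have "(1 / (2 * exp 1 * q))\<^sup>2 \<le> (1 / y)\<^sup>2"
    using q by (intro power_mono divide_left_mono) (auto simp: y_def mult_ac)
  also have "\<dots> = exp (- (2 * ln y))"
  proof -
    have "exp (- (2 * ln y)) = exp (- ln y) * exp (- ln y)" by (simp flip: exp_add)
    then show ?thesis using y by (simp add: exp_minus power2_eq_square inverse_eq_divide)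
  qed
  also have "\<dots> \<le> exp (1 / exp 1 - q)" using l by simp
  finally show ?thesis .
qed

lemma dyadic_bracket:
  assumes "q \<ge> (2 :: real)"
  obtains j :: nat where "2 ^ Suc j \<le> q" "q < 2 ^ Suc (Suc j)"
proof -
  define m where "m = (LEAST m. q < 2 ^ m)"
  have "\<exists>m. q < 2 ^ m" using real_arch_pow[of 2 q] by simp
  then have m: "q < 2 ^ m" unfolding m_def by (rule LeastI_ex)
  have "m \<noteq> 0" using m assms by (intro notI) simp
  moreover have "m \<noteq> 1" using m assms by (intro notI) simp
  ultimately obtain j where j: "m = Suc (Suc j)" by (metis One_nat_def not0_implies_Suc)
  have "\<not> q < 2 ^ Suc j" using not_less_Least[of "Suc j" "\<lambda>m. q < 2 ^ m"] by (simp add: m_def[symmetric] j)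
  then show ?thesis using that[of j] m j by simp
qed

text \<open>The base is at most \<open>1/(4e) \<le> exp(-2)\<close>; the 2 in this exponent makes up
  for \<open>n\<close> being possibly as small as \<open>q/2\<close>.\<close>

lemma large_exponent_tail:
  fixes q :: real and n :: nat
  assumes "0 < n" "real n \<le> q" "q \<le> 2 * real n"
  shows "(real n / (4 * exp 1 * q)) ^ n \<le> exp (- q)"
proof -
  have e: "exp (1 :: real) \<le> 4" using exp_le by simp
  have "real n / (4 * exp 1 * q) \<le> 1 / (4 * exp 1)" using assms by (simp add: field_simps)
  also have "\<dots> \<le> 1 / (exp 1 * exp 1)" using e by (intro divide_left_mono mult_right_mono) auto
  also have "\<dots> = exp (- 2)" by (simp add: exp_minus inverse_eq_divide flip: exp_add)
  finally have "(real n / (4 * exp 1 * q)) ^ n \<le> exp (- 2) ^ n" using assms by (intro power_mono) auto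
  also have "\<dots> = exp (- (2 * real n))" by (simp flip: exp_of_nat_mult add: mult.commute)
  also have "\<dots> \<le> exp (- q)" using assms by simp
  finally show ?thesis .
qed

theorem corollary1p5:
  fixes G :: "(real ^ 'n) set"
    and \<mu> :: "(real ^ 'n) measure"
    and w f :: "real ^ 'n \<Rightarrow> real"
    and d :: nat
    and p C t :: real
  assumes "d \<ge> 1"
    and "open G"
    and "w \<in> borel_measurable (restrict_space borel G)"
    and "\<forall>x\<in>G. w x \<ge> 0"
    and "borel_prob_on G \<mu>"
    and "weighted_poincare G \<mu> w"
    and "C_k_on d G f"
    and "integrable \<mu> f"
    and "(\<integral>x. f x \<partial>\<mu>) = 0"
    and "\<forall>k\<in>{1..<d}. Lq_norm \<mu> 2 (op_norm k f) \<le> 1"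
    and "Linf_norm \<mu> (op_norm d f) \<le> 1"
    and "p \<ge> 2"
    and "C \<ge> 2 powr (- (real d - 1) / 2)"
    and "Lq_norm \<mu> (2 ^ d * p) w \<le> ennreal C"
    and "0 \<le> t"
    and "t \<le> (2 powr ((real d + 5) / 2) * C * exp 1 * p) ^ d"
  shows "measure \<mu> {x \<in> G. \<bar>f x\<bar> \<ge> t}
    \<le> exp (real d / exp 1)
       * exp (- (real d * t powr (1 / real d)) / (2 powr ((real d + 5) / 2) * C * exp 1))"
proof -
  note d = assms(1) and p = assms(12)
  have C: "C > 0" using assms(13) powr_gt_zero[of 2 "- (real d - 1) / 2"] by linarith
  \<comment> \<open>The one exponent at which a moment of \<open>w\<close> is given; all lower ones
    follow in \<open>wr\<close>.\<close>
  define s where "s = 2 ^ d * p"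
  have s: "s \<ge> 2" using p d mult_mono[of 1 "2 ^ d" 2 p] by (simp add: s_def)
  interpret pr: prob_space \<mu> using assms(5) by (simp add: borel_prob_on_def)
  have wm: "w \<in> borel_measurable \<mu>"
    using assms(3,5) measurable_cong_sets[of \<mu> "restrict_space borel G" borel "borel :: real measure"]
    by (simp add: borel_prob_on_def)
  have ws: "(\<integral>\<^sup>+x. ennreal (\<bar>w x\<bar> powr s) \<partial>\<mu>) \<le> ennreal (C powr s)"
    using assms(14) C s by (intro Lq_norm_leD) (auto simp: s_def)
  have wr: "(\<integral>\<^sup>+x. ennreal (\<bar>w x\<bar> powr r) \<partial>\<mu>) \<le> ennreal (C powr r)" if "0 < r" "r \<le> s" for r
    by (rule pr.powr_moment_mono[OF wm that C ws])
  interpret weighted_poincare_space G \<mu> w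
  proof
    have "(\<integral>\<^sup>+x. ennreal ((w x)\<^sup>2) \<partial>\<mu>) = (\<integral>\<^sup>+x. ennreal (\<bar>w x\<bar> powr 2) \<partial>\<mu>)"
      by (simp add: powr_numeral)
    also have "\<dots> < \<infinity>" using wr[of 2] s by (auto intro: le_less_trans)
    finally show "(\<integral>\<^sup>+x. ennreal ((w x)\<^sup>2) \<partial>\<mu>) < \<infinity>" .
  qed (use assms in auto)
  have fm: "f \<in> borel_measurable \<mu>" using assms(8) by auto
  \<comment> \<open>The lower bound on \<open>C\<close> says precisely that
    \<open>X \<ge> 1\<close>.\<close>
  define X where "X = 2 powr ((real d - 1) / 2) * C"
  have X1: "X \<ge> 1"
  proof -
    have "(real d - 1) / 2 + - (real d - 1) / 2 = 0" by (simp add: field_simps)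
    then have "1 = 2 powr ((real d - 1) / 2) * 2 powr (- (real d - 1) / 2)"
      by (simp only: powr_add[symmetric]) simp
    also have "\<dots> \<le> X" unfolding X_def using assms(13) by (intro mult_left_mono) auto
    finally show ?thesis .
  qed
  have X2: "X\<^sup>2 = C\<^sup>2 * 2 ^ (d - 1)"
  proof -
    have "(2 powr ((real d - 1) / 2))\<^sup>2 = 2 powr (real (d - 1))"
      using d by (simp add: power2_eq_square of_nat_diff flip: powr_add)
    then show ?thesis by (simp add: X_def power_mult_distrib powr_realpow)
  qed
  have B: "(\<integral>\<^sup>+x. ennreal ((op_norm k f x)\<^sup>2) \<partial>\<mu>) \<le> 1" if "1 \<le> k" "k < d" for k
  proof -
    have "Lq_norm \<mu> 2 (op_norm k f) \<le> ennreal 1" using assms(10) that by simp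
    from Lq_norm_leD[OF this] show ?thesis by (simp add: powr_numeral)
  qed
  have top: "AE x in \<mu>. op_norm d f x \<le> 1"
  proof -
    have "AE x in \<mu>. ennreal \<bar>op_norm d f x\<bar> \<le> Linf_norm \<mu> (op_norm d f)"
      unfolding Linf_norm_def by (rule esssup_AE)
    then show ?thesis
    proof eventually_elim
      case (elim x)
      then have "ennreal \<bar>op_norm d f x\<bar> \<le> 1" using assms(11) by (rule order_trans)
      then show ?case by (simp add: ennreal_le_1)
    qed
  qed
  have moment: "(\<integral>\<^sup>+x. ennreal (\<bar>f x\<bar> ^ (2 ^ Suc j)) \<partial>\<mu>) \<le> ennreal (((2 * real (2 ^ Suc j) * X) ^ d) ^ (2 ^ Suc j))"
    if "2 ^ Suc j \<le> p" for j
  proof (rule higher_order_moment_le[OF d assms(7-9) C X1 X2 _ B top])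
    let ?N = "2 ^ d * 2 ^ Suc j :: nat"
    have "(\<integral>\<^sup>+x. ennreal (w x ^ ?N) \<partial>\<mu>) = (\<integral>\<^sup>+x. ennreal (\<bar>w x\<bar> powr real ?N) \<partial>\<mu>)"
      by (rule nn_integral_cong) (subst powr_realpow', auto simp: space_eq w_nonneg)
    also have "\<dots> \<le> ennreal (C powr real ?N)"
      using that by (intro wr) (auto simp: s_def)
    also have "C powr real ?N = C ^ ?N" using C by (rule powr_realpow)
    finally show "(\<integral>\<^sup>+x. ennreal (w x ^ ?N) \<partial>\<mu>) \<le> ennreal (C ^ ?N)" .
  qed
  \<comment> \<open>The scale of the stated bound is \<open>8 X e\<close>: the factor
    \<open>2 X\<close> cancels that of the moment bound, and \<open>4 e\<close> remains for the two
    tail estimates.\<close>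
  define T where "T = 2 powr ((real d + 5) / 2) * C * exp 1"
  have T: "T = 8 * X * exp 1"
  proof -
    have "(real d + 5) / 2 = 3 + (real d - 1) / 2" by (simp add: field_simps)
    then have "2 powr ((real d + 5) / 2) = 8 * 2 powr ((real d - 1) / 2)"
      by (simp only: powr_add) simp
    then show ?thesis by (simp add: T_def X_def)
  qed
  have T0: "T > 0" using X1 by (simp add: T)
  define z where "z = t powr (1 / real d)"
  have z: "z ^ d = t" "z \<ge> 0" using d assms(15) by (auto simp: z_def powr_realpow' powr_powr simp flip: powr_realpow')
  \<comment> \<open>With \<open>t = (T q)^d\<close> the right-hand side is the \<open>d\<close>-th
    power of \<open>exp (1/e - q)\<close>, and the allowed range of \<open>t\<close> becomes
    \<open>q \<le> p\<close>, so the moment bounds cover all dyadic exponents up to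
    \<open>q\<close>.\<close>
  define q where "q = z / T"
  have zq: "z = T * q" using T0 by (simp add: q_def)
  have "z \<le> T * p"
  proof (rule power_le_imp_le_base)
    show "z ^ Suc (d - 1) \<le> (T * p) ^ Suc (d - 1)" using assms(16) d z by (simp add: T_def)
  qed (use T0 p in simp)
  then have qp: "q \<le> p" using T0 by (simp add: q_def field_simps)
  have rhs: "exp (real d / exp 1) * exp (- (real d * t powr (1 / real d)) / (2 powr ((real d + 5) / 2) * C * exp 1))
      = exp (1 / exp 1 - q) ^ d"
    unfolding T_def[symmetric] z_def[symmetric] zq
    using T0 by (simp add: algebra_simps flip: exp_add exp_of_nat_mult)
  have markov: "measure \<mu> {x \<in> G. \<bar>f x\<bar> \<ge> t} \<le> ((real (2 ^ Suc j) / (4 * exp 1 * q)) ^ (2 ^ Suc j)) ^ d"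
    if "2 ^ Suc j \<le> p" "q > 0" for j
  proof -
    let ?n = "2 ^ Suc j :: nat"
    have t: "t > 0" using that T0 by (simp add: z(1)[symmetric] zq)
    have "measure \<mu> {x \<in> G. \<bar>f x\<bar> \<ge> t} \<le> ((2 * real ?n * X) ^ d / t) ^ ?n"
      using pr.markov_power[OF fm _ t moment[OF that(1)]] X1 by (simp add: space_eq)
    also have "(2 * real ?n * X) ^ d / t = (2 * real ?n * X / (T * q)) ^ d"
      unfolding z(1)[symmetric] zq by (simp add: power_divide)
    also have "2 * real ?n * X / (T * q) = real ?n / (4 * exp 1 * q)"
      using X1 by (simp add: T)
    also have "((real ?n / (4 * exp 1 * q)) ^ d) ^ ?n = ((real ?n / (4 * exp 1 * q)) ^ ?n) ^ d"
      unfolding power_mult[symmetric] by (simp only: mult.commute)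
    finally show ?thesis .
  qed
  have "measure \<mu> {x \<in> G. \<bar>f x\<bar> \<ge> t} \<le> exp (1 / exp 1 - q) ^ d"
  proof -
    \<comment> \<open>In the first range the right-hand side is at least 1; the second uses the
      exponent 2, the third the largest power of two not exceeding \<open>q\<close>.\<close>
    consider "q \<le> 1 / exp 1" | "1 / exp 1 < q" "q < 2" | "q \<ge> 2" by linarith
    then show ?thesis
    proof cases
      case 1
      then have "1 \<le> exp (1 / exp 1 - q) ^ d" by (intro one_le_power) simp
      then show ?thesis using pr.prob_le_1 order_trans by blast
    next
      case 2
      have "q > 0" using 2 by (smt (verit) divide_pos_pos exp_gt_zero)
      have "measure \<mu> {x \<in> G. \<bar>f x\<bar> \<ge> t} \<le> ((1 / (2 * exp 1 * q))\<^sup>2) ^ d"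
        using markov[of 0] p \<open>q > 0\<close> by (simp add: mult_ac)
      also have "\<dots> \<le> exp (1 / exp 1 - q) ^ d"
        using 2 by (intro power_mono small_exponent_tail) auto
      finally show ?thesis .
    next
      case 3
      obtain j :: nat where j: "2 ^ Suc j \<le> q" "q < 2 ^ Suc (Suc j)" using dyadic_bracket[OF 3] .
      have "measure \<mu> {x \<in> G. \<bar>f x\<bar> \<ge> t} \<le> ((real (2 ^ Suc j) / (4 * exp 1 * q)) ^ (2 ^ Suc j)) ^ d"
        using j qp 3 by (intro markov) auto
      also have "\<dots> \<le> exp (- q) ^ d"
        using j 3 by (intro power_mono large_exponent_tail) auto
      also have "\<dots> \<le> exp (1 / exp 1 - q) ^ d" by (intro power_mono) auto
      finally show ?thesis .
    qed
  qed
  then show ?thesis unfolding rhs .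
qed

end
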